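(* Let $a(n)$ be defined by $$G(q)=\sum_{n\ge 0}a(n)q^n:=\frac{1}{(q;q^4)_\infty\,(-q^3;q^4)_\infty}.$$ Then: (1) $a(n)\ge 0$ for every integer $n\ge 0$; (2) for every $n\ge 0$ we have $a(n)=|e_n-o_n|$, i.e. $G(q)=\sum_{n\ge 0}|e_n-o_n|\,q^n$.
   Context: Notation: $(a;q)_\infty:=\prod_{k\ge 0}(1-aq^k)$; the products are regarded as formal power series in $q$ (equivalently, analytic for $|q|<1$). Meanders and index: let $\alpha=(\alpha_1,\dots,\alpha_m)$ and $\beta=(\beta_1,\dots,\beta_\ell)$ be two compositions of $n$. The meander of $(\alpha\mid\beta)$ is the graph on vertices $1,\dots,n$ constructed as follows. For each block $\alpha_j$, occupying the vertices $s+1,\dots,s+\alpha_j$ with $s=\alpha_1+\dots+\alpha_{j-1}$, add the edges $\{s+i,\ s+\alpha_j+1-i\}$ for all $1\le i<(\alpha_j+1)/2$ (top edges). Do the same for each block of $\beta$ (bottom edges). Every vertex then has degree at most 2, so each connected component is either a cycle or a path; an isolated vertex counts as a path. If $C$ is the number of cycles and $P$ the number of paths, the index of $(\alpha\mid\beta)$ is $2C+P-1$. By the Dergachev–Kirillov formula, this equals the Lie-algebraic index $\min_{f\in\mathfrak g^*}\dim\{x\in\mathfrak g: f([x,\cdot])=0\}$ of the seaweed subalgebra $\mathfrak g\subseteq\mathfrak{sl}_n$ associated to $(\alpha\mid\beta)$. (Using instead the seaweed subalgebra of $\mathfrak{gl}_n$ shifts every index by $1$, which does not affect $|e_n-o_n|$.)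 The index of a partition $\lambda=(\lambda_1\ge\lambda_2\ge\dots\ge\lambda_k)$ of $n$ is the index of the pair $(\lambda\mid(n))$, where the parts of $\lambda$ are taken in the nonincreasing order $\lambda_1,\dots,\lambda_k$ and $(n)$ is the one-part composition. $e_n$ denotes the number of partitions of $n$ into odd parts whose index is even. $o_n$ denotes the number of partitions of $n$ into odd parts whose index is odd. *)

theory Defs
  imports "HOL-Computational_Algebra.Formal_Power_Series"
begin

section \<open>The generating function G(q) = 1/((q;q^4)_oo (-q^3;q^4)_oo)\<close>

text \<open>Finite truncation of the product (q;q^4)_oo (-q^3;q^4)_oo, i.e.
  prod_{k<N} (1 - q^(4k+1)) (1 + q^(4k+3)).\<close>
definition G_denom_trunc :: "nat \<Rightarrow> real fps" where
  "G_denom_trunc N = (\<Prod>k<N. (1 - fps_X ^ (4*k+1)) * (1 + fps_X ^ (4*k+3)))"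

text \<open>The formal infinite product is the fps whose n-th coefficient is the n-th
  coefficient of any truncation containing all factors with exponent \<le> n;
  the truncation to N = n+1 factors suffices (factors with index k \<ge> n+1 have
  exponent > n).  G is the fps inverse of this product.\<close>
definition G_denom :: "real fps" where
  "G_denom = Abs_fps (\<lambda>n. fps_nth (G_denom_trunc (Suc n)) n)"

definition G :: "real fps" where
  "G = inverse G_denom"

definition a :: "nat \<Rightarrow> real" where
  "a n = fps_nth G n"

section \<open>Meanders and index\<close>

text \<open>Edges contributed by a composition (list of block sizes): for the block
  number j, starting after s = sum of earlier blocks, with size b, the edges
  {s+i, s+b+1-i} for 1 \<le> i < (b+1)/2.\<close>
definition comp_edges :: "nat list \<Rightarrow> (nat \<times> nat) set" where
  "comp_edges al = {(s + i, s + b + 1 - i) | j s b i.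
      j < length al \<and> s = sum_list (take j al) \<and> b = al ! j \<and> 1 \<le> i \<and> 2 * i < b + 1}"

text \<open>Vertex v is incident to an edge of the composition.\<close>
definition incident :: "nat list \<Rightarrow> nat \<Rightarrow> bool" where
  "incident al v \<longleftrightarrow> (\<exists>u. (v, u) \<in> comp_edges al \<or> (u, v) \<in> comp_edges al)"

definition meander_rel :: "nat list \<Rightarrow> nat list \<Rightarrow> (nat \<times> nat) set" where
  "meander_rel al be = (let E = comp_edges al \<union> comp_edges be in E \<union> E\<inverse>)"

text \<open>Connected components of the meander graph on vertices 1..n
  (n = sum of the parts).\<close>
definition meander_components :: "nat list \<Rightarrow> nat list \<Rightarrow> nat set set" where
  "meander_components al be = {1..sum_list al} // ((meander_rel al be)\<^sup>*)"

text \<open>Every vertex has at most one top and at most one bottom edge, so a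
  component is a cycle iff every vertex in it has degree 2, i.e. has both a top and
  a bottom edge (a doubled edge counts as a cycle of length 2).\<close>
definition is_cycle_comp :: "nat list \<Rightarrow> nat list \<Rightarrow> nat set \<Rightarrow> bool" where
  "is_cycle_comp al be C \<longleftrightarrow> (\<forall>v\<in>C. incident al v \<and> incident be v)"

definition num_cycles :: "nat list \<Rightarrow> nat list \<Rightarrow> nat" where
  "num_cycles al be = card {C \<in> meander_components al be. is_cycle_comp al be C}"

definition num_paths :: "nat list \<Rightarrow> nat list \<Rightarrow> nat" where
  "num_paths al be = card {C \<in> meander_components al be. \<not> is_cycle_comp al be C}"

definition meander_index :: "nat list \<Rightarrow> nat list \<Rightarrow> int" where
  "meander_index al be = 2 * int (num_cycles al be) + int (num_paths al be) - 1"

text \<open>Partitions of n into odd parts, as nonincreasing lists.\<close>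
definition odd_partitions :: "nat \<Rightarrow> nat list set" where
  "odd_partitions n = {xs. sorted_wrt (\<ge>) xs \<and> (\<forall>x\<in>set xs. odd x) \<and> sum_list xs = n}"

definition partition_index :: "nat list \<Rightarrow> int" where
  "partition_index lam = meander_index lam [sum_list lam]"

definition e_count :: "nat \<Rightarrow> nat" where
  "e_count n = card {lam \<in> odd_partitions n. even (partition_index lam)}"

definition o_count :: "nat \<Rightarrow> nat" where
  "o_count n = card {lam \<in> odd_partitions n. odd (partition_index lam)}"

end

theory Submission
  imports Defs "HOL-Complex_Analysis.Complex_Analysis"
begin

text \<open>
  The top and the bottom edges of a meander are two matchings, so each path has one vertex more
  than it has edges and each cycle has equally many. Hence the number of paths of a partition of
  \<open>n\<close> into odd parts is \<open>n\<close> minus the number of edges, and the parity of the index is that of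
  \<open>\<Sum>\<lfloor>\<lambda>\<^sub>i / 2\<rfloor>\<close> up to a shift depending on \<open>n\<close> only. Since \<open>(- 1) ^ \<lfloor>\<lambda>\<^sub>i / 2\<rfloor>\<close> is \<open>- 1\<close> exactly for the parts
  congruent to 3 modulo 4, this gives \<open>e\<^sub>n - o\<^sub>n = \<plusminus> a(n)\<close>, and everything is reduced to \<open>a(n) \<ge> 0\<close>.

  For \<open>n \<ge> 5000\<close> this is the circle method with radius \<open>exp (- t)\<close>, \<open>t = pi / sqrt (48 n)\<close>: up to constants
  \<open>log G (exp (- t - i \<theta>))\<close> is \<open>pi\<^sup>2 / (48 (t + i \<theta>))\<close> near \<open>\<theta> = 0\<close>, and the same asymptotics hold near
  \<open>\<theta> = pi\<close> with a constant factor smaller by a power of \<open>t\<close>. The remaining arcs are exponentially smaller, and explicit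
  error terms make the contribution of \<open>\<theta> = 0\<close> dominate from 5000 on.

  For \<open>n < 5000\<close> the coefficients are computed. With \<open>y = - q\<^sup>2\<close> one has \<open>G = 1 / (q; y)\<^sub>\<infinity>\<close>, and
  Cauchy's identity \<open>1 / (q; y)\<^sub>\<infinity> = \<Sum>\<^sub>k q\<^sup>k y\<^bsup>k (k - 1)\<^esup> / ((y; y)\<^sub>k (q; y)\<^sub>k)\<close> leaves only 50 terms,
  which are summed in Horner form.
\<close>

section \<open>The generating function on the unit disc\<close>

text \<open>Two competitors come close to the peak at \<theta> = 0. In
  \<open>log G = Le + Lo\<close>, split by the parity of the summation index, \<open>Le\<close> is
  unchanged under \<open>q\<close> to \<open>- q\<close> and carries the exponential growth near 0
  and pi, while \<open>Lo\<close> changes sign. The peak at pi therefore has the same exponent and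
  loses only the factor \<open>exp (- 2 * Lo0 t)\<close>, where \<open>Lo0 t\<close> grows like
  \<open>ln (1 / t) / 4\<close>. Near pi / 2 the product is governed by the dilogarithm at
  \<open>\<i>\<close>, whose imaginary part is Catalan's constant; the exponent there reaches about
  0.1838 / t, against pi^2 / 48 / t, about 0.2056 / t, at the peak. Both gaps open slowly with n, so
  every constant has to be explicit, and the many coefficients below the threshold need an exact
  computation. Angles are measured in units of t, as \<theta> = u t, and each arc integral is
  compared with \<open>A * t / \<rho>\<close>, the height of the peak times its width.\<close>

definition qlog :: "complex \<Rightarrow> complex \<Rightarrow> complex" where
  "qlog w p = (\<Sum>m. w ^ m / (of_nat m * (1 - p ^ m)))"

lemma norm_one_minus_power_ge:
  fixes p :: complex
  assumes "norm p < 1" "m > 0"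
  shows "norm (1 - p ^ m) \<ge> 1 - norm p"
proof -
  have "norm (p ^ m) \<le> norm p"
    using power_decreasing[of 1 m "norm p"] assms by (simp add: norm_power)
  then show ?thesis using norm_triangle_ineq2[of 1 "p^m"] by simp
qed

lemma qlog_term_bound:
  fixes w p :: complex
  assumes "norm p < 1"
  shows "norm (w ^ m / (of_nat m * (1 - p ^ m))) \<le> norm w ^ m / (1 - norm p)"
proof (cases "m = 0")
  case True
  then show ?thesis using assms by simp
next
  case False
  then have "norm (1 - p ^ m) \<ge> 1 - norm p" using norm_one_minus_power_ge assms by auto
  moreover have "real m \<ge> 1" using False by simp
  ultimately have "1 * (1 - norm p) \<le> real m * norm (1 - p ^ m)"
    using assms by (intro mult_mono) auto
  then show ?thesis
    using assms False by (auto simp: norm_divide norm_mult norm_power intro!: divide_left_mono mult_pos_pos)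
qed

lemma qlog_sums:
  assumes "norm w < 1" "norm p < 1"
  shows "(\<lambda>m. w ^ m / (of_nat m * (1 - p ^ m))) sums qlog w p"
  unfolding qlog_def
proof (rule summable_sums, rule summable_comparison_test')
  show "summable (\<lambda>m. norm w ^ m / (1 - norm p))"
    using assms by (intro summable_divide summable_geometric) auto
qed (use assms qlog_term_bound in auto)

lemma minus_Ln_sums:
  fixes w :: complex
  assumes "norm w < 1"
  shows "(\<lambda>m. w ^ m / of_nat m) sums (- Ln (1 - w))"
proof -
  have "(\<lambda>n. - ((w)^n) / of_nat n) sums ln (1 - w)"
    using Ln_series'[of "-w"] assms by simp
  from sums_minus[OF this] show ?thesis by simp
qed

text \<open>Expanding the logarithms and summing the finite geometric series in \<open>p ^ m\<close>
  gives the series of \<open>qlog w p\<close> minus that of \<open>qlog (w * p ^ K) p\<close>. So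
  \<open>qlog w p\<close> is minus the logarithm of the infinite product of the
  \<open>1 - w * p ^ k\<close>, with a rate of convergence that is uniform on smaller discs.\<close>

lemma qlog_partial:
  assumes w: "norm w < 1" and p: "norm p < 1"
  shows "norm ((\<Sum>k<K. - Ln (1 - w * p ^ k)) - qlog w p) \<le> norm p ^ K / ((1 - norm w) * (1 - norm p))"
proof -
  have lt: "norm (w * p ^ k) < 1" for k
  proof -
    have "norm (p ^ k) \<le> 1" using p by (simp add: norm_power power_le_one)
    then show ?thesis using w
      by (metis mult_left_le norm_ge_zero norm_mult order_le_less_trans)
  qed
  have "(\<lambda>m. \<Sum>k<K. (w * p ^ k) ^ m / of_nat m) sums (\<Sum>k<K. - Ln (1 - w * p ^ k))"
    by (intro sums_sum minus_Ln_sums lt)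
  moreover have "(\<Sum>k<K. (w * p ^ k) ^ m / of_nat m) =
      w ^ m / (of_nat m * (1 - p ^ m)) - (w * p ^ K) ^ m / (of_nat m * (1 - p ^ m))" for m
  \<comment> \<open>At \<open>m = 0\<close> every summand is 0 by the convention on division by
    zero.\<close>
  proof (cases "m = 0")
    case False
    have ne: "p ^ m \<noteq> 1"
      using norm_one_minus_power_ge[OF p, of m] False p by auto
    have "(\<Sum>k<K. (w * p ^ k) ^ m / of_nat m) = w ^ m / of_nat m * (\<Sum>k<K. (p ^ m) ^ k)"
      by (simp add: sum_distrib_left power_mult_distrib mult_ac flip: power_mult)
    also have "\<dots> = w ^ m / of_nat m * ((1 - (p ^ m) ^ K) / (1 - p ^ m))"
      using ne by (simp add: geometric_sum[OF ne] divide_simps) (simp add: algebra_simps)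
    also have "\<dots> = w ^ m / (of_nat m * (1 - p ^ m)) - (w * p ^ K) ^ m / (of_nat m * (1 - p ^ m))"
      by (simp add: diff_divide_distrib power_mult_distrib algebra_simps flip: power_mult)
    finally show ?thesis .
  qed auto
  ultimately have "(\<lambda>m. w ^ m / (of_nat m * (1 - p ^ m)) - (w * p ^ K) ^ m / (of_nat m * (1 - p ^ m))) sums (\<Sum>k<K. - Ln (1 - w * p ^ k))"
    by simp
  from sums_diff[OF this qlog_sums[OF w p]]
  have s: "(\<lambda>m. - ((w * p ^ K) ^ m / (of_nat m * (1 - p ^ m)))) sums ((\<Sum>k<K. - Ln (1 - w * p ^ k)) - qlog w p)"
    by simp
  have b: "norm (- ((w * p ^ K) ^ m / (of_nat m * (1 - p ^ m)))) \<le> norm p ^ K / (1 - norm p) * norm w ^ m" for m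
  proof (cases "m = 0")
    case False
    have "norm (- ((w * p ^ K) ^ m / (of_nat m * (1 - p ^ m)))) \<le> norm (w * p ^ K) ^ m / (1 - norm p)"
      using qlog_term_bound[OF p, of "w * p ^ K" m] by simp
    also have "norm (w * p ^ K) ^ m \<le> norm w ^ m * norm p ^ K"
      using False p power_decreasing[of K "K * m" "norm p"]
      by (auto simp: norm_mult norm_power power_mult_distrib intro!: mult_left_mono simp flip: power_mult)
    finally show ?thesis using p by (simp add: divide_right_mono mult_ac)
  qed (use p in auto)
  have g: "(\<lambda>m. norm p ^ K / (1 - norm p) * norm w ^ m) sums (norm p ^ K / (1 - norm p) * (1 / (1 - norm w)))"
    using w by (intro sums_mult geometric_sums) auto
  have "norm ((\<Sum>k<K. - Ln (1 - w * p ^ k)) - qlog w p) \<le> (norm p ^ K / (1 - norm p) * (1 / (1 - norm w)))"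
    by (rule norm_sums_le[OF s g b])
  then show ?thesis by (simp add: mult_ac)
qed

lemma qlog_Ln_sums:
  assumes w: "norm w < 1" and p: "norm p < 1"
  shows "(\<lambda>k. - Ln (1 - w * p ^ k)) sums qlog w p"
  unfolding sums_def
proof (rule Lim_transform2[OF tendsto_const])
  show "(\<lambda>K. qlog w p - (\<Sum>k<K. - Ln (1 - w * p ^ k))) \<longlonglongrightarrow> 0"
  proof (rule Lim_null_comparison)
    show "\<forall>\<^sub>F K in sequentially. norm (qlog w p - (\<Sum>k<K. - Ln (1 - w * p ^ k))) \<le> norm p ^ K / ((1 - norm w) * (1 - norm p))"
      using qlog_partial[OF assms] by (simp add: norm_minus_commute)
    show "(\<lambda>K. norm p ^ K / ((1 - norm w) * (1 - norm p))) \<longlonglongrightarrow> 0"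
      using p by (intro tendsto_divide_zero LIMSEQ_power_zero) auto
  qed
qed

section \<open>Truncated products and their uniform limit\<close>

definition gN :: "nat \<Rightarrow> complex \<Rightarrow> complex" where
  "gN N q = inverse (\<Prod>k<N. (1 - q ^ (4*k+1)) * (1 + q ^ (4*k+3)))"

text \<open>In terms of \<open>y = - (q^2)\<close> the two factors with index \<open>k\<close> are
  those with exponents \<open>2*k\<close> and \<open>2*k+1\<close> of one product, so a single
  \<open>qlog\<close> serves for both arithmetic progressions.\<close>

lemma gN_denom_eq: "(\<Prod>k<N. (1 - q ^ (4*k+1)) * (1 + q ^ (4*k+3))) = (\<Prod>j<2*N. 1 - q * (- (q^2)) ^ j)"
  for q :: complex
proof (induction N)
  case (Suc N)
  have e: "(- (q^2)) ^ (2*N) = q ^ (4*N)"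
    by (simp add: power_mult power2_eq_square flip: power_add)
       (metis (no_types, lifting) mult_2 numeral_Bit0 power2_eq_square power_add power_mult)
  have "(\<Prod>j<2 * Suc N. 1 - q * (- (q^2)) ^ j) = (\<Prod>j<2*N. 1 - q * (- (q^2)) ^ j) *
     ((1 - q * (- (q^2)) ^ (2*N)) * (1 - q * (- (q^2)) ^ (2*N+1)))"
    by simp
  also have "(1 - q * (- (q^2)) ^ (2*N)) = 1 - q ^ (4*N+1)" using e by simp
  also have "(1 - q * (- (q^2)) ^ (2*N+1)) = 1 + q ^ (4*N+3)"
    using e by (simp add: power_add eval_nat_numeral)
  finally show ?case by (simp only: prod.lessThan_Suc Suc.IH)
qed auto

lemma gN_eq_exp:
  assumes "norm q < 1"
  shows "gN N q = exp (\<Sum>j<2*N. - Ln (1 - q * (- (q^2)) ^ j))"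
proof -
  have ne: "1 - q * (- (q^2)) ^ j \<noteq> 0" for j
  proof
    assume "1 - q * (- (q^2)) ^ j = 0"
    then have "norm (q * (- (q^2)) ^ j) = 1" by (metis eq_iff_diff_eq_0 norm_one)
    then have "norm q ^ (2*j+1) = 1" by (simp add: norm_mult norm_power power_mult)
    moreover have "norm q ^ (2*j+1) < 1" using assms by (intro power_less_one_iff[THEN iffD2]) auto
    ultimately show False by simp
  qed
  show ?thesis
    unfolding gN_def gN_denom_eq using ne
    by (simp add: exp_sum exp_minus prod_inversef[symmetric] comp_def)
qed

text \<open>With the base of \<open>gN_denom_eq\<close> this is a logarithm of G inside the unit
  disc.\<close>

definition Lq :: "complex \<Rightarrow> complex" where
  "Lq q = qlog q (- (q^2))"

text \<open>The logarithms converge uniformly by \<open>qlog_partial\<close>. Uniformity passes to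
  the products because the limit is bounded on the disc and \<open>exp\<close> is uniformly
  continuous on a slightly larger ball.\<close>

lemma gN_uniform_limit:
  assumes r: "0 < r" "r < 1"
  shows "uniform_limit (cball 0 r) gN (\<lambda>q. exp (Lq q)) sequentially"
proof -
  have b: "norm (Lq q) \<le> 1 / ((1 - r) * (1 - r^2))" if "q \<in> cball 0 r" for q
  proof -
    have q: "norm q \<le> r" using that by simp
    then have p: "norm (- (q^2)) \<le> r^2" by (simp add: norm_power power_mono)
    have r2: "r^2 < 1" using r by (simp add: power_less_one_iff)
    have "norm (Lq q) \<le> 1 / ((1 - norm q) * (1 - norm (- (q^2))))"
      using qlog_partial[of q "- (q^2)" 0] q p r r2 by (simp add: Lq_def)
    also have "\<dots> \<le> 1 / ((1 - r) * (1 - r^2))"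
      using q p r r2 by (intro divide_left_mono mult_mono mult_pos_pos) auto
    finally show ?thesis .
  qed
  define B where "B = 1 / ((1 - r) * (1 - r^2))"
  have r2: "0 < r^2" "r^2 < 1" using r by (auto simp: power_less_one_iff)
  have B0: "B > 0" using r r2 by (simp add: B_def)
  have u: "uniform_limit (cball 0 r) (\<lambda>N q. \<Sum>j<2*N. - Ln (1 - q * (- (q^2)) ^ j)) Lq sequentially"
  proof (rule uniform_limitI)
    fix e :: real assume e: "e > 0"
    have "(\<lambda>N. (r^2) ^ (2*N) * B) \<longlonglongrightarrow> 0"
      using r2 by (auto intro!: tendsto_mult_left_zero LIMSEQ_power_zero
          simp only: power_mult power_less_one_iff real_norm_def abs_power2 abs_of_nonneg zero_le_power2)
    then have "\<forall>\<^sub>F N in sequentially. (r^2) ^ (2*N) * B < e"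
      using e by (rule order_tendstoD)
    then show "\<forall>\<^sub>F N in sequentially. \<forall>q\<in>cball 0 r. dist (\<Sum>j<2*N. - Ln (1 - q * (- (q^2)) ^ j)) (Lq q) < e"
    proof eventually_elim
      case (elim N)
      show ?case
      proof
        fix q :: complex assume "q \<in> cball 0 r"
        then have q: "norm q \<le> r" by simp
        then have p: "norm (- (q^2)) \<le> r^2" by (simp add: norm_power power_mono)
        have "dist (\<Sum>j<2*N. - Ln (1 - q * (- (q^2)) ^ j)) (Lq q) \<le> norm (- (q^2)) ^ (2*N) / ((1 - norm q) * (1 - norm (- (q^2))))"
          using qlog_partial[of q "- (q^2)" "2*N"] q p r r2 by (simp add: Lq_def dist_norm)
        also have "\<dots> \<le> (r^2) ^ (2*N) / ((1 - r) * (1 - r^2))"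
          using q p r r2 by (intro frac_le power_mono mult_mono mult_pos_pos) auto
        also have "\<dots> = (r^2) ^ (2*N) * B" by (simp add: B_def)
        finally show "dist (\<Sum>j<2*N. - Ln (1 - q * (- (q^2)) ^ j)) (Lq q) < e" using elim by simp
      qed
    qed
  qed
  have "uniform_limit (cball 0 r) (\<lambda>N q. exp (\<Sum>j<2*N. - Ln (1 - q * (- (q^2)) ^ j))) (\<lambda>q. exp (Lq q)) sequentially"
  proof (rule uniform_limit_compose_uniformly_continuous_on[of _ _ _ _ "cball 0 (B + 1)", OF u])
    show "uniformly_continuous_on (cball 0 (B+1)) (exp :: complex \<Rightarrow> complex)"
      by (intro compact_uniformly_continuous continuous_intros) auto
    show "\<forall>\<^sub>F N in sequentially. \<forall>q\<in>cball 0 r. (\<Sum>j<2*N. - Ln (1 - q * (- (q^2)) ^ j)) \<in> cball 0 (B+1)"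
      using uniform_limitD[OF u zero_less_one]
    proof eventually_elim
      case (elim N)
      show ?case
      proof
        fix q :: complex assume q: "q \<in> cball 0 r"
        have "dist 0 (Lq q) \<le> B" using b[OF q] by (simp add: B_def)
        then show "(\<Sum>j<2*N. - Ln (1 - q * (- (q^2)) ^ j)) \<in> cball 0 (B+1)"
          using elim q dist_triangle[of 0 "(\<Sum>j<2*N. - Ln (1 - q * (- (q^2)) ^ j))" "Lq q"]
          by (force simp: dist_commute)
      qed
    qed
  qed auto
  then show ?thesis
  proof (rule uniform_limit_cong'[THEN iffD1, rotated -1])
    show "\<And>q N. q \<in> cball 0 r \<Longrightarrow> exp (\<Sum>j<2*N. - Ln (1 - q * (- (q^2)) ^ j)) = gN N q"
      using gN_eq_exp r by auto
  qed auto
qed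

section \<open>Coefficients of G as integrals over a circle\<close>

definition fps_cplx :: "real fps \<Rightarrow> complex fps" where
  "fps_cplx f = Abs_fps (\<lambda>n. complex_of_real (fps_nth f n))"

lemma fps_cplx_simps:
  "fps_cplx 1 = 1" "fps_cplx (f + g) = fps_cplx f + fps_cplx g" "fps_cplx (f - g) = fps_cplx f - fps_cplx g"
  "fps_cplx (f * g) = fps_cplx f * fps_cplx g" "fps_cplx (fps_X ^ k) = fps_X ^ k"
  by (auto simp: fps_eq_iff fps_cplx_def fps_mult_nth fps_X_power_nth)

lemma fps_cplx_prod: "fps_cplx (\<Prod>k<(n::nat). f k) = (\<Prod>k<n. fps_cplx (f k))"
  by (induction n) (simp_all add: fps_cplx_simps)

lemma G_denom_trunc_nth_0: "fps_nth (G_denom_trunc N) 0 = 1"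
  by (induction N) (simp_all add: G_denom_trunc_def fps_mult_nth)

lemma G_denom_trunc_Suc:
  assumes "n \<le> N"
  shows "fps_nth (G_denom_trunc (Suc N)) n = fps_nth (G_denom_trunc N) n"
proof -
  define P :: "real fps" where "P = G_denom_trunc N"
  define i j where "i = 4*N+1" and "j = 4*N+3"
  have "G_denom_trunc (Suc N) = P * ((1 - fps_X ^ i) * (1 + fps_X ^ j))"
    by (simp only: G_denom_trunc_def P_def i_def j_def prod.lessThan_Suc)
  also have "\<dots> = P - fps_X ^ i * P + fps_X ^ j * (P * (1 - fps_X ^ i))"
    by (simp add: algebra_simps)
  finally have "G_denom_trunc (Suc N) = P - fps_X ^ i * P + fps_X ^ j * (P * (1 - fps_X ^ i))" .
  moreover have "n < i" "n < j" using assms by (auto simp: i_def j_def)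
  ultimately show ?thesis by (simp add: fps_X_power_mult_nth P_def)
qed

lemma G_denom_trunc_stable:
  assumes "n < N"
  shows "fps_nth (G_denom_trunc N) n = fps_nth G_denom n"
proof -
  have "fps_nth (G_denom_trunc (Suc n + k)) n = fps_nth (G_denom_trunc (Suc n)) n" for k
    by (induction k) (use G_denom_trunc_Suc in auto)
  from this[of "N - Suc n"] show ?thesis using assms by (simp add: G_denom_def)
qed

text \<open>The difference of the inverses is \<open>inverse f * inverse g * (g - f)\<close>, and
  \<open>g - f\<close> has no coefficients up to \<open>n\<close>.\<close>

lemma fps_inverse_nth_cong:
  fixes f g :: "'a::field fps"
  assumes "\<And>i. i \<le> n \<Longrightarrow> fps_nth f i = fps_nth g i" "fps_nth f 0 \<noteq> 0"
  shows "fps_nth (inverse f) n = fps_nth (inverse g) n"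
proof -
  have g0: "fps_nth g 0 \<noteq> 0" using assms by (metis zero_le)
  have "inverse f - inverse g = inverse f * inverse g * (g - f)"
    using assms(2) g0 inverse_mult_eq_1[of f] inverse_mult_eq_1[of g]
    by (simp add: algebra_simps)
  then have "fps_nth (inverse f - inverse g) n = (\<Sum>i=0..n. fps_nth (inverse f * inverse g) i * fps_nth (g - f) (n - i))"
    by (simp add: fps_mult_nth)
  also have "\<dots> = 0" using assms by (intro sum.neutral) auto
  finally show ?thesis by simp
qed

lemma a_eq_trunc:
  assumes "n < N"
  shows "a n = fps_nth (inverse (G_denom_trunc N)) n"
  unfolding a_def G_def
proof (rule fps_inverse_nth_cong)
  show "fps_nth G_denom i = fps_nth (G_denom_trunc N) i" if "i \<le> n" for i
    using assms that by (intro G_denom_trunc_stable[symmetric]) simp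
  show "fps_nth G_denom 0 \<noteq> 0" using G_denom_trunc_nth_0 by (simp add: G_denom_def)
qed

lemma gN_expansion: "gN N has_fps_expansion fps_cplx (inverse (G_denom_trunc N))"
proof -
  define D :: "complex fps" where "D = (\<Prod>k<N. (1 - fps_X ^ (4*k+1)) * (1 + fps_X ^ (4*k+3)))"
  have D: "fps_cplx (G_denom_trunc N) = D"
    by (simp only: G_denom_trunc_def fps_cplx_prod fps_cplx_simps D_def)
  have D0: "fps_nth D 0 \<noteq> 0" using G_denom_trunc_nth_0[of N] by (simp add: D[symmetric] fps_cplx_def)
  have "fps_cplx (inverse (G_denom_trunc N)) * D = 1"
    using inverse_mult_eq_1[of "G_denom_trunc N"] G_denom_trunc_nth_0[of N]
    by (simp flip: D fps_cplx_simps)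
  then have "fps_cplx (inverse (G_denom_trunc N)) = inverse D"
    by (metis fps_inverse_unique mult.commute)
  moreover have "(\<lambda>q. inverse (\<Prod>k<N. (1 - q ^ (4*k+1)) * (1 + q ^ (4*k+3)))) has_fps_expansion inverse D"
    unfolding D_def
    by (intro has_fps_expansion_inverse has_fps_expansion_prod has_fps_expansion_mult
        has_fps_expansion_add has_fps_expansion_diff has_fps_expansion_1 has_fps_expansion_fps_X_power D0[unfolded D_def])
  ultimately show ?thesis unfolding gN_def[abs_def] by simp
qed

lemma gN_holomorphic: "gN N holomorphic_on ball 0 1"
proof -
  have "(\<Prod>k<N. (1 - q ^ (4*k+1)) * (1 + q ^ (4*k+3))) \<noteq> 0" if "q \<in> ball 0 1" for q :: complex
  proof -
    have "q ^ (4*k+1) \<noteq> 1" "q ^ (4*k+3) \<noteq> -1" for k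
    proof -
      have "norm (q ^ m) < 1" if "m > 0" for m
        using \<open>q \<in> ball 0 1\<close> that by (simp add: norm_power power_less_one_iff)
      from this[of "4*k+1"] this[of "4*k+3"] show "q ^ (4*k+1) \<noteq> 1" "q ^ (4*k+3) \<noteq> -1" by force+
    qed
    then show ?thesis by (simp add: add_eq_0_iff del: power_Suc power_add)
  qed
  then show ?thesis unfolding gN_def[abs_def] by (intro holomorphic_intros) auto
qed

text \<open>Cauchy's formula is applied to the rational truncation, whose coefficient is already
  exactly \<open>a n\<close> once \<open>N > n\<close>. Only the integrand still has to pass to the
  limit.\<close>

lemma gN_coeff_integral:
  assumes r: "0 < r" "r < 1" and n: "n < N"
  shows "((\<lambda>x. gN N (of_real r * cis (2*pi*x)) * cis (- (real n * (2*pi*x)))) has_integral of_real (a n * r ^ n)) {0..1}"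
proof -
  have hol: "gN N holomorphic_on cball 0 r" "gN N holomorphic_on ball 0 r"
    by (rule holomorphic_on_subset[OF gN_holomorphic]; use r in auto)+
  have "(deriv ^^ n) (gN N) 0 / fact n = of_real (a n)"
    using fps_nth_fps_expansion[OF gN_expansion[of N], of n] a_eq_trunc[OF n] by (simp add: fps_cplx_def)
  then have d: "(deriv ^^ n) (gN N) 0 = of_real (a n) * fact n" by (simp add: field_simps)
  have "((\<lambda>u. gN N u / (u-0) ^ (Suc n)) has_contour_integral ((2 * pi * \<i>) / (fact n) * (deriv ^^ n) (gN N) 0)) (circlepath 0 r)"
    using hol r by (intro Cauchy_has_contour_integral_higher_derivative_circlepath holomorphic_on_imp_continuous_on) auto
  then have "((\<lambda>x. gN N (circlepath 0 r x) / circlepath 0 r x ^ (Suc n) * vector_derivative (circlepath 0 r) (at x within {0..1}))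
      has_integral (2 * pi * \<i> * of_real (a n))) {0..1}"
    unfolding has_contour_integral_def by (simp add: d mult.assoc)
  then have "((\<lambda>x. gN N (of_real r * cis (2*pi*x)) * cis (- (real n * (2*pi*x))) * (2 * pi * \<i> / of_real r ^ n))
      has_integral (2 * pi * \<i> * of_real (a n))) {0..1}"
  proof (rule has_integral_eq[rotated])
    fix x :: real assume x: "x \<in> {0..1}"
    have c: "circlepath 0 r x = of_real r * cis (2*pi*x)"
      by (simp add: circlepath cis_conv_exp mult_ac)
    have "vector_derivative (circlepath 0 r) (at x within {0..1}) = 2 * pi * \<i> * r * exp (2 * of_real pi * \<i> * x)"
      using x by (simp add: vector_derivative_circlepath01)
    then have v: "vector_derivative (circlepath 0 r) (at x within {0..1}) = 2 * pi * \<i> * (of_real r * cis (2*pi*x))"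
      by (simp add: cis_conv_exp mult_ac)
    have p: "cis (2*pi*x) ^ n * cis (- (real n * (2*pi*x))) = 1"
      by (simp add: Complex.DeMoivre cis_mult)
    have nz: "(of_real r * cis (2*pi*x)) \<noteq> 0" using r by simp
    have "gN N (circlepath 0 r x) / circlepath 0 r x ^ (Suc n) * vector_derivative (circlepath 0 r) (at x within {0..1})
      = gN N (of_real r * cis (2*pi*x)) * (2 * pi * \<i>) / (of_real r * cis (2*pi*x)) ^ n"
      unfolding c v using nz by (simp add: field_simps)
    also have "\<dots> = gN N (of_real r * cis (2*pi*x)) * (2 * pi * \<i>) / of_real r ^ n * (1 / cis (2*pi*x) ^ n)"
      by (simp add: power_mult_distrib)
    also have "1 / cis (2*pi*x) ^ n = cis (- (real n * (2*pi*x)))"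
      using p by (metis (no_types, lifting) cis_neq_zero eq_divide_eq mult.commute power_not_zero)
    finally show "gN N (circlepath 0 r x) / circlepath 0 r x ^ Suc n * vector_derivative (circlepath 0 r) (at x within {0..1}) =
         gN N (of_real r * cis (2*pi*x)) * cis (- (real n * (2*pi*x))) * (2 * pi * \<i> / of_real r ^ n)"
      by (simp add: mult_ac)
  qed
  from has_integral_mult_left[OF this, of "of_real r ^ n / (2 * pi * \<i>)"] show ?thesis
    using r by (simp add: mult_ac)
qed

lemma Lq_cnj: "Lq (cnj q) = cnj (Lq q)" if "norm q < 1"
proof -
  have p: "norm (- (q^2)) < 1" using that by (simp add: norm_power power_less_one_iff)
  have "(\<lambda>m. cnj (q ^ m / (of_nat m * (1 - (- (q^2)) ^ m)))) sums cnj (Lq q)"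
    unfolding Lq_def sums_cnj by (rule qlog_sums[OF that p])
  then show ?thesis unfolding Lq_def qlog_def[of "cnj q"] by (simp add: sums_iff)
qed

text \<open>G has real coefficients, so the integrand at \<open>2 * pi - \<theta>\<close> is the
  conjugate of that at \<theta>; hence the half circle and the real part suffice.\<close>

lemma a_integral:
  fixes r :: real and n :: nat
  assumes r: "0 < r" "r < 1"
  defines "h \<equiv> \<lambda>\<theta>. exp (Lq (of_real r * cis \<theta>)) * cis (- (real n * \<theta>))"
  shows "continuous_on UNIV h"
    and "((\<lambda>\<theta>. Re (h \<theta>)) has_integral (pi * a n * r ^ n)) {0..pi}"
proof -
  have inball: "of_real r * cis x \<in> cball 0 r" for x using r by (simp add: norm_mult)
  have cont: "continuous_on (cball 0 r) (\<lambda>q. exp (Lq q))"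
  proof (rule uniform_limit_theorem[OF _ gN_uniform_limit[OF r]])
    show "\<forall>\<^sub>F N in sequentially. continuous_on (cball 0 r) (gN N)"
      using r by (intro always_eventually allI holomorphic_on_imp_continuous_on holomorphic_on_subset[OF gN_holomorphic]) auto
  qed auto
  show ch: "continuous_on UNIV h"
    unfolding h_def
    by (intro continuous_intros continuous_on_compose2[OF cont]) (use inball in auto)
  have ul: "uniform_limit {0..1} (\<lambda>N x. gN N (of_real r * cis (2*pi*x)) * cis (- (real n * (2*pi*x))))
     (\<lambda>x. h (2*pi*x)) sequentially"
    unfolding uniform_limit_iff
  proof (intro allI impI)
    fix e :: real assume "e > 0"
    from uniform_limitD[OF gN_uniform_limit[OF r] this]
    show "\<forall>\<^sub>F N in sequentially. \<forall>x\<in>{0..1}. dist (gN N (of_real r * cis (2*pi*x)) * cis (- (real n * (2*pi*x)))) (h (2*pi*x)) < e"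
    proof eventually_elim
      case (elim N)
      show ?case
      proof
        fix x :: real assume "x \<in> {0..1}"
        have "dist (gN N (of_real r * cis (2*pi*x)) * cis (- (real n * (2*pi*x)))) (h (2*pi*x)) =
           dist (gN N (of_real r * cis (2*pi*x))) (exp (Lq (of_real r * cis (2*pi*x))))"
          by (simp add: h_def dist_norm norm_mult flip: left_diff_distrib)
        then show "dist (gN N (of_real r * cis (2*pi*x)) * cis (- (real n * (2*pi*x)))) (h (2*pi*x)) < e"
          using bspec[OF elim inball[of "2*pi*x"]] by simp
      qed
    qed
  qed
  obtain I J where I: "\<And>N. ((\<lambda>x. gN N (of_real r * cis (2*pi*x)) * cis (- (real n * (2*pi*x)))) has_integral I N) {0..1}"
    and J: "((\<lambda>x. h (2*pi*x)) has_integral J) {0..1}" and IJ: "I \<longlonglongrightarrow> J"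
  proof (rule uniform_limit_integral[OF ul])
    fix N show "continuous_on {0..1} (\<lambda>x. gN N (of_real r * cis (2*pi*x)) * cis (- (real n * (2*pi*x))))"
      by (intro continuous_intros continuous_on_compose2[OF holomorphic_on_imp_continuous_on[OF gN_holomorphic]])
         (use r in \<open>auto simp: norm_mult\<close>)
  qed auto
  have "I N = of_real (a n * r ^ n)" if "N > n" for N
    using has_integral_unique[OF I gN_coeff_integral[OF r that]] .
  then have "I \<longlonglongrightarrow> of_real (a n * r ^ n)"
    by (intro tendsto_eventually) (auto intro!: eventually_mono[OF eventually_gt_at_top[of n]])
  then have J2: "J = of_real (a n * r ^ n)" using IJ LIMSEQ_unique by blast
  have "((\<lambda>x. h x) has_integral (2 * pi) *\<^sub>R J) {0..2*pi}"
  proof -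
    have "(\<lambda>x. x * (pi * 2)) ` {0..1} = {0..pi * 2}"
      using image_affinity_atLeastAtMost[of "pi * 2" 0 0 1] by (simp add: mult.commute)
    then show ?thesis
      using has_integral_stretch_real[OF J, of "1/(2*pi)"] by (simp add: field_simps)
  qed
  then have "(Re \<circ> h has_integral Re ((2 * pi) *\<^sub>R J)) {0..2*pi}"
    by (rule has_integral_linear[OF _ bounded_linear_Re])
  moreover have "Re ((2 * pi) *\<^sub>R J) = 2 * pi * a n * r ^ n"
    by (simp add: J2 del: of_real_mult of_real_power)
  ultimately have H: "((\<lambda>x. Re (h x)) has_integral (2 * pi * a n * r ^ n)) {0..2*pi}"
    by (simp add: o_def mult.assoc)
  have int: "(\<lambda>x. Re (h x)) integrable_on {u..v}" for u v
    by (intro integrable_continuous_interval continuous_on_Re continuous_on_subset[OF ch]) auto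
  have sym: "Re (h (2*pi - x)) = Re (h x)" for x
  proof -
    have q: "of_real r * cis (2*pi - x) = cnj (of_real r * cis x)"
      by (simp add: cis_cnj complex_eq_iff)
    have c: "cis (- (real n * (2*pi - x))) = cnj (cis (- (real n * x)))"
    proof -
      have "cis (- (real n * (2*pi - x))) = cis (real n * x) * cis (2 * pi * real_of_int (- int n))"
        by (simp add: cis_mult algebra_simps)
      also have "cis (2 * pi * real_of_int (- int n)) = 1" by (rule cis_multiple_2pi) auto
      finally show ?thesis by (simp add: cis_cnj)
    qed
    have "norm (of_real r * cis x) < 1" using r by (simp add: norm_mult)
    from Lq_cnj[OF this] have "exp (Lq (cnj (of_real r * cis x))) = cnj (exp (Lq (of_real r * cis x)))"
      by (simp only: exp_cnj)
    then have "h (2*pi - x) = cnj (h x)"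
      unfolding h_def q c by (simp only: complex_cnj_mult[of "exp _"])
    then show ?thesis by simp
  qed
  have "((\<lambda>x. Re (h x)) has_integral integral {0..pi} (\<lambda>x. Re (h x))) {0..pi}"
    using int integrable_integral by blast
  then have "((\<lambda>x. Re (h (2*pi - x))) has_integral integral {0..pi} (\<lambda>x. Re (h x))) {pi..2*pi}"
    using has_integral_affinity[of "\<lambda>x. Re (h x)" "integral {0..pi} (\<lambda>x. Re (h x))" 0 pi "-1" "2*pi"]
    by (simp add: image_affinity_interval)
  then have "integral {pi..2*pi} (\<lambda>x. Re (h x)) = integral {0..pi} (\<lambda>x. Re (h x))"
    by (simp add: sym integral_unique)
  moreover have "integral {0..pi} (\<lambda>x. Re (h x)) + integral {pi..2*pi} (\<lambda>x. Re (h x)) = integral {0..2*pi} (\<lambda>x. Re (h x))"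
    by (intro Henstock_Kurzweil_Integration.integral_combine int) auto
  ultimately have "integral {0..pi} (\<lambda>x. Re (h x)) = pi * a n * r ^ n"
    using integral_unique[OF H] by simp
  then show "((\<lambda>\<theta>. Re (h \<theta>)) has_integral (pi * a n * r ^ n)) {0..pi}"
    using integrable_integral[OF int, of 0 pi] by simp
qed

section \<open>Meanders\<close>

text \<open>Edges are stored with an orientation; disjointness of \<open>Domain\<close> and
  \<open>Range\<close> excludes two edges that meet head to tail.\<close>

definition matching :: "('v \<times> 'v) set \<Rightarrow> bool" where
  "matching M \<longleftrightarrow> inj_on fst M \<and> inj_on snd M \<and> Domain M \<inter> Range M = {}"

lemma matching_card:
  assumes M: "matching M" "finite M" and C: "finite C" "\<And>u v. (u, v) \<in> M \<Longrightarrow> u \<in> C \<longleftrightarrow> v \<in> C"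
  shows "2 * card (Domain M \<inter> C) = card (C \<inter> (Domain M \<union> Range M))"
proof -
  define F where "F = {e \<in> M. fst e \<in> C}"
  have D: "Domain M \<inter> C = fst ` F" and R: "Range M \<inter> C = snd ` F"
    using C(2) by (force simp: F_def)+
  have "inj_on fst F" "inj_on snd F" using M(1) by (auto simp: matching_def F_def inj_on_def)
  then have "card (Domain M \<inter> C) = card (Range M \<inter> C)" unfolding D R by (simp add: card_image)
  moreover have "C \<inter> (Domain M \<union> Range M) = (Domain M \<inter> C) \<union> (Range M \<inter> C)" by blast
  moreover have "card ((Domain M \<inter> C) \<union> (Range M \<inter> C)) = card (Domain M \<inter> C) + card (Range M \<inter> C)"
    using M(1) C(1) by (intro card_Un_disjoint) (auto simp: matching_def)
  ultimately show ?thesis by simp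
qed

text \<open>A breadth-first spanning tree: every vertex except \<open>x\<close> is assigned the edge
  to a neighbour nearer to \<open>x\<close>. Two vertices sharing an edge would each be nearer to
  \<open>x\<close> than the other, so the assignment is injective.\<close>

lemma connected_card_le:
  fixes E :: "('v \<times> 'v) set"
  defines "R \<equiv> E \<union> E\<inverse>"
  assumes "finite E"
  shows "card (R\<^sup>* `` {x}) \<le> card {e \<in> E. fst e \<in> R\<^sup>* `` {x}} + 1"
proof -
  define C where "C = R\<^sup>* `` {x}"
  define d where "d y = (LEAST n. (x, y) \<in> R ^^ n)" for y
  have par: "\<exists>p. (p, y) \<in> R \<and> p \<in> C \<and> d p < d y" if "y \<in> C - {x}" for y
  proof -
    have "\<exists>n. (x, y) \<in> R ^^ n" using that by (auto simp: C_def rtrancl_is_UN_relpow)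
    then have xy: "(x, y) \<in> R ^^ d y" unfolding d_def by (rule LeastI_ex)
    moreover have "d y \<noteq> 0" using xy that by (intro notI) auto
    ultimately obtain m where m: "d y = Suc m" "(x, y) \<in> R ^^ Suc m" by (metis not0_implies_Suc)
    obtain p where p: "(x, p) \<in> R ^^ m" "(p, y) \<in> R" using m(2) by auto
    have "d p \<le> m" unfolding d_def by (rule Least_le) (rule p)
    moreover have "p \<in> C" using relpow_imp_rtrancl[OF p(1)] by (simp add: C_def)
    ultimately show ?thesis using p(2) m(1) by auto
  qed
  then obtain p where p: "\<And>y. y \<in> C - {x} \<Longrightarrow> (p y, y) \<in> R \<and> p y \<in> C \<and> d (p y) < d y" by metis
  define g where "g y = (if (p y, y) \<in> E then (p y, y) else (y, p y))" for y
  have "inj_on g (C - {x})"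
  proof (rule inj_onI)
    fix y z assume y: "y \<in> C - {x}" and z: "z \<in> C - {x}" and eq: "g y = g z"
    show "y = z" using p[OF y] p[OF z] eq by (auto simp: g_def split: if_splits)
  qed
  moreover have "g ` (C - {x}) \<subseteq> {e \<in> E. fst e \<in> C}"
    using p by (fastforce simp: g_def R_def)
  ultimately have le: "card (C - {x}) \<le> card {e \<in> E. fst e \<in> C}"
    using assms(2) by (intro card_inj_on_le) auto
  show ?thesis
  proof (cases "finite C")
    case True
    have "x \<in> C" by (simp add: C_def)
    then show ?thesis using le True card_Suc_Diff1[OF True \<open>x \<in> C\<close>] by (simp add: C_def)
  qed (simp add: C_def)
qed

lemma card_quotient_sum:
  assumes r: "equiv UNIV r" and V: "finite V" and X: "X \<subseteq> V"
  shows "card X = (\<Sum>C\<in>V // r. card (X \<inter> C))"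
proof -
  have "X = (\<Union>C\<in>V // r. X \<inter> C)"
    using X equiv_class_self[OF r] by (auto simp: quotient_def)
  then have "card X = card (\<Union>C\<in>V // r. X \<inter> C)" by simp
  also have "\<dots> = (\<Sum>C\<in>V // r. card (X \<inter> C))"
  proof (rule card_UN_disjoint)
    show "finite (V // r)" using V by (auto simp: quotient_def)
    show "\<forall>C\<in>V // r. finite (X \<inter> C)" using V X by (auto intro: finite_subset)
    have "V // r \<subseteq> UNIV // r" by (auto simp: quotient_def)
    then show "\<forall>C\<in>V // r. \<forall>D\<in>V // r. C \<noteq> D \<longrightarrow> X \<inter> C \<inter> (X \<inter> D) = {}"
      using quotient_disj[OF r] by blast
  qed
  finally show ?thesis .
qed

text \<open>Euler characteristic: a union of two matchings has one vertex more than edges on each path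
  and equally many on each cycle (a doubled edge being counted twice).\<close>

lemma card_paths:
  fixes V :: "'v set"
  assumes V: "finite V" and sub: "M \<subseteq> V \<times> V" "N \<subseteq> V \<times> V" and mat: "matching M" "matching N"
  defines "R \<equiv> (M \<union> N) \<union> (M \<union> N)\<inverse>"
  shows "card {C \<in> V // R\<^sup>*. \<not> (\<forall>v\<in>C. v \<in> Domain M \<union> Range M \<and> v \<in> Domain N \<union> Range N)} + card M + card N = card V"
proof -
  define cyc where "cyc C \<longleftrightarrow> (\<forall>v\<in>C. v \<in> Domain M \<union> Range M \<and> v \<in> Domain N \<union> Range N)" for C
  have fin: "finite M" "finite N" using V sub by (auto intro: finite_subset)
  have "sym R" by (auto simp: R_def sym_def)
  then have eqv: "equiv UNIV (R\<^sup>*)" by (auto simp: equiv_def refl_rtrancl sym_rtrancl trans_rtrancl)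
  \<comment> \<open>On a cycle each matching covers \<open>C\<close>, so each has half as many edges
    as \<open>C\<close> has vertices. Otherwise some vertex is missed by one matching, so the edges
    are fewer than the vertices, and connectedness shows that they fall short by exactly
    one.\<close>
  have comp: "card C = card (Domain M \<inter> C) + card (Domain N \<inter> C) + (if cyc C then 0 else 1)"
    if C: "C \<in> V // R\<^sup>*" for C
  proof -
    obtain x where x: "x \<in> V" "C = R\<^sup>* `` {x}" using C by (auto simp: quotient_def)
    have "C \<subseteq> V"
    proof
      fix y assume "y \<in> C"
      then have "(x, y) \<in> R\<^sup>*" using x by simp
      then show "y \<in> V" by (induction rule: rtrancl_induct) (use x sub in \<open>auto simp: R_def\<close>)
    qed
    then have fC: "finite C" using V by (rule finite_subset)
    have "u \<in> C \<longleftrightarrow> v \<in> C" if "(u, v) \<in> R" for u v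
    proof -
      have "(v, u) \<in> R" using that by (auto simp: R_def)
      then show ?thesis using that by (auto simp: x intro: rtrancl_into_rtrancl)
    qed
    then have cl: "u \<in> C \<longleftrightarrow> v \<in> C" if "(u, v) \<in> M \<union> N" for u v using that by (auto simp: R_def)
    have cM: "2 * card (Domain M \<inter> C) = card (C \<inter> (Domain M \<union> Range M))"
      using mat fin fC cl by (intro matching_card) auto
    have cN: "2 * card (Domain N \<inter> C) = card (C \<inter> (Domain N \<union> Range N))"
      using mat fin fC cl by (intro matching_card) auto
    show ?thesis
    proof (cases "cyc C")
      case True
      then have "C \<inter> (Domain M \<union> Range M) = C" "C \<inter> (Domain N \<union> Range N) = C" by (auto simp: cyc_def)
      then show ?thesis using cM cN True by simp
    next
      case False
      have le: "card (C \<inter> (Domain M \<union> Range M)) \<le> card C" "card (C \<inter> (Domain N \<union> Range N)) \<le> card C"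
        using fC by (auto intro: card_mono)
      have "C \<inter> (Domain M \<union> Range M) \<subset> C \<or> C \<inter> (Domain N \<union> Range N) \<subset> C"
        using False by (auto simp: cyc_def)
      then have "card (C \<inter> (Domain M \<union> Range M)) < card C \<or> card (C \<inter> (Domain N \<union> Range N)) < card C"
        using fC psubset_card_mono by blast
      then have lt: "card (Domain M \<inter> C) + card (Domain N \<inter> C) < card C" using le cM cN by arith
      have "card C \<le> card {e \<in> M \<union> N. fst e \<in> C} + 1"
        using connected_card_le[of "M \<union> N" x] fin unfolding x(2) R_def by simp
      also have "{e \<in> M \<union> N. fst e \<in> C} = {e \<in> M. fst e \<in> C} \<union> {e \<in> N. fst e \<in> C}" by auto
      also have "card \<dots> \<le> card {e \<in> M. fst e \<in> C} + card {e \<in> N. fst e \<in> C}" by (rule card_Un_le)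
      also have "card {e \<in> M. fst e \<in> C} = card (fst ` {e \<in> M. fst e \<in> C})"
        using mat by (intro card_image[symmetric]) (auto simp: matching_def inj_on_def)
      also have "fst ` {e \<in> M. fst e \<in> C} = Domain M \<inter> C" by force
      also have "card {e \<in> N. fst e \<in> C} = card (fst ` {e \<in> N. fst e \<in> C})"
        using mat by (intro card_image[symmetric]) (auto simp: matching_def inj_on_def)
      also have "fst ` {e \<in> N. fst e \<in> C} = Domain N \<inter> C" by force
      finally show ?thesis using lt False by simp
    qed
  qed
  have CV: "C \<subseteq> V" if C: "C \<in> V // R\<^sup>*" for C
  proof
    fix y assume "y \<in> C"
    then obtain x where "x \<in> V" "(x, y) \<in> R\<^sup>*" using C by (auto simp: quotient_def)
    from this(2,1) show "y \<in> V" by (induction rule: rtrancl_induct) (use sub in \<open>auto simp: R_def\<close>)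
  qed
  have finQ: "finite (V // R\<^sup>*)" using V by (auto simp: quotient_def)
  have "card V = (\<Sum>C\<in>V // R\<^sup>*. card (V \<inter> C))" by (rule card_quotient_sum[OF eqv V]) simp
  also have "\<dots> = (\<Sum>C\<in>V // R\<^sup>*. card C)"
  proof (rule sum.cong)
    fix C assume "C \<in> V // R\<^sup>*"
    then have "V \<inter> C = C" using CV by blast
    then show "card (V \<inter> C) = card C" by simp
  qed simp
  also have "\<dots> = (\<Sum>C\<in>V // R\<^sup>*. card (Domain M \<inter> C)) + (\<Sum>C\<in>V // R\<^sup>*. card (Domain N \<inter> C))
      + (\<Sum>C\<in>V // R\<^sup>*. if cyc C then 0 else 1)"
    by (simp add: comp sum.distrib)
  also have "(\<Sum>C\<in>V // R\<^sup>*. card (Domain M \<inter> C)) = card (Domain M)"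
    using sub by (intro card_quotient_sum[OF eqv V, symmetric]) auto
  also have "Domain M = fst ` M" by force
  also have "card (fst ` M) = card M" using mat by (intro card_image) (simp add: matching_def)
  also have "(\<Sum>C\<in>V // R\<^sup>*. card (Domain N \<inter> C)) = card (Domain N)"
    using sub by (intro card_quotient_sum[OF eqv V, symmetric]) auto
  also have "Domain N = fst ` N" by force
  also have "card (fst ` N) = card N" using mat by (intro card_image) (simp add: matching_def)
  also have "(\<Sum>C\<in>V // R\<^sup>*. if cyc C then 0 else (1::nat)) = card {C \<in> V // R\<^sup>*. \<not> cyc C}"
    using finQ by (simp add: sum.If_cases Int_def)
  finally show ?thesis unfolding cyc_def by simp
qed

section \<open>The edges of a composition\<close>

lemma comp_edges_Nil: "comp_edges [] = {}"
  by (simp add: comp_edges_def)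

lemma comp_edges_Cons:
  "comp_edges (b # al) = (\<lambda>i. (i, b + 1 - i)) ` {1..b div 2} \<union> (\<lambda>(u, v). (b + u, b + v)) ` comp_edges al"
  (is "?L = ?A \<union> ?B")
proof (intro equalityI subsetI)
  fix e assume "e \<in> ?L"
  then obtain j i where j: "j < length (b # al)" "1 \<le> i" "2 * i < (b # al) ! j + 1"
    "e = (sum_list (take j (b # al)) + i, sum_list (take j (b # al)) + (b # al) ! j + 1 - i)"
    by (auto simp: comp_edges_def)
  show "e \<in> ?A \<union> ?B"
  proof (cases j)
    case 0
    then show ?thesis using j by auto
  next
    case (Suc l)
    have "(sum_list (take l al) + i, sum_list (take l al) + al ! l + 1 - i) \<in> comp_edges al"
      using j Suc unfolding comp_edges_def by auto
    then have "(b + (sum_list (take l al) + i), b + (sum_list (take l al) + al ! l + 1 - i)) \<in> ?B" by force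
    moreover have "e = (b + (sum_list (take l al) + i), b + (sum_list (take l al) + al ! l + 1 - i))"
      using j Suc by auto
    ultimately show ?thesis by simp
  qed
next
  fix e assume "e \<in> ?A \<union> ?B"
  then show "e \<in> ?L"
  proof
    assume "e \<in> ?A"
    then obtain i where "i \<in> {1..b div 2}" "e = (i, b + 1 - i)" by auto
    then show ?thesis unfolding comp_edges_def mem_Collect_eq
      by (intro exI[of _ i] exI[of _ b] exI[of _ "0::nat"]) auto
  next
    assume "e \<in> ?B"
    then obtain j i where j: "j < length al" "1 \<le> i" "2 * i < al ! j + 1"
      "e = (b + (sum_list (take j al) + i), b + (sum_list (take j al) + al ! j + 1 - i))"
      by (auto simp: comp_edges_def)
    then show ?thesis unfolding comp_edges_def mem_Collect_eq
      by - (rule exI[of _ "Suc j"], rule exI[of _ "b + sum_list (take j al)"], rule exI[of _ "al ! j"], rule exI[of _ i], auto)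
  qed
qed

lemma comp_edges_bounds: "(u, v) \<in> comp_edges al \<Longrightarrow> 1 \<le> u \<and> u \<le> sum_list al \<and> 1 \<le> v \<and> v \<le> sum_list al"
proof (induction al arbitrary: u v)
  case (Cons b al)
  from Cons.prems consider i where "i \<in> {1..b div 2}" "u = i" "v = b + 1 - i"
    | u' v' where "(u', v') \<in> comp_edges al" "u = b + u'" "v = b + v'"
    unfolding comp_edges_Cons by auto
  then show ?case using Cons.IH by cases fastforce+
qed (simp add: comp_edges_Nil)

text \<open>The ends of an edge in the first block satisfy \<open>u < v\<close> and
  \<open>u + v = b + 1\<close>, so each end determines the other and no vertex is both a left and a
  right end. All later edges lie beyond \<open>b\<close>.\<close>

lemma matching_comp_edges: "matching (comp_edges al)"
proof (induction al)
  case Nil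
  then show ?case by (simp add: comp_edges_Nil matching_def)
next
  case (Cons b al)
  define A where "A = (\<lambda>i. (i, b + 1 - i)) ` {1..b div 2}"
  define B where "B = (\<lambda>(u, v). (b + u, b + v)) ` comp_edges al"
  have A: "u \<le> b \<and> v \<le> b \<and> u < v \<and> u + v = b + 1" if "(u, v) \<in> A" for u v using that by (auto simp: A_def)
  have B: "u > b \<and> v > b \<and> (u - b, v - b) \<in> comp_edges al" if uv: "(u, v) \<in> B" for u v
  proof -
    obtain u' v' where "(u', v') \<in> comp_edges al" "u = b + u'" "v = b + v'" using uv by (auto simp: B_def)
    then show ?thesis using comp_edges_bounds[of u' v' al] by simp
  qed
  have inj: "(u = u' \<longleftrightarrow> v = v') \<and> u \<noteq> v'" if "(u, v) \<in> comp_edges al" "(u', v') \<in> comp_edges al" for u v u' v'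
  proof -
    have inj: "inj_on fst (comp_edges al)" "inj_on snd (comp_edges al)" using Cons.IH by (auto simp: matching_def)
    have "u = u' \<Longrightarrow> v = v'" using inj_onD[OF inj(1) _ that] by simp
    moreover have "v = v' \<Longrightarrow> u = u'" using inj_onD[OF inj(2) _ that] by simp
    moreover have "u \<noteq> v'" using that Cons.IH unfolding matching_def by blast
    ultimately show ?thesis by blast
  qed
  have main: "(u = u' \<longleftrightarrow> v = v') \<and> u \<noteq> v'" if h: "(u, v) \<in> A \<union> B" "(u', v') \<in> A \<union> B" for u v u' v'
  proof -
    have "(u, v) \<in> A \<or> (u, v) \<in> B" "(u', v') \<in> A \<or> (u', v') \<in> B" using h by simp_all
    then show ?thesis
    proof (elim disjE)
      assume "(u, v) \<in> A" "(u', v') \<in> A"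
      from A[OF this(1)] A[OF this(2)] show ?thesis by auto
    next
      assume "(u, v) \<in> A" "(u', v') \<in> B"
      from A[OF this(1)] B[OF this(2)] show ?thesis by auto
    next
      assume "(u, v) \<in> B" "(u', v') \<in> A"
      from B[OF this(1)] A[OF this(2)] show ?thesis by auto
    next
      assume h: "(u, v) \<in> B" "(u', v') \<in> B"
      have "(u - b = u' - b \<longleftrightarrow> v - b = v' - b) \<and> u - b \<noteq> v' - b" using B[OF h(1)] B[OF h(2)] by (intro inj) auto
      then show ?thesis using B[OF h(1)] B[OF h(2)] by auto
    qed
  qed
  have pair: "(fst e = fst e' \<longleftrightarrow> snd e = snd e') \<and> fst e \<noteq> snd e'" if "e \<in> A \<union> B" "e' \<in> A \<union> B" for e e'
    using that by (intro main) (simp_all only: prod.collapse)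
  have "inj_on fst (A \<union> B)" using pair by (intro inj_onI prod_eqI) blast+
  moreover have "inj_on snd (A \<union> B)" using pair by (intro inj_onI prod_eqI) blast+
  moreover have "Domain (A \<union> B) \<inter> Range (A \<union> B) = {}"
  proof (rule ccontr)
    assume "Domain (A \<union> B) \<inter> Range (A \<union> B) \<noteq> {}"
    then obtain u v w where "(u, v) \<in> A \<union> B" "(w, u) \<in> A \<union> B" by (auto simp: Domain_iff Range_iff)
    then show False using main by blast
  qed
  ultimately show ?case unfolding comp_edges_Cons A_def[symmetric] B_def[symmetric] by (simp add: matching_def)
qed

lemma finite_comp_edges: "finite (comp_edges al)"
  by (induction al) (simp_all add: comp_edges_Nil comp_edges_Cons)

lemma card_comp_edges: "card (comp_edges al) = (\<Sum>b\<leftarrow>al. b div 2)"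
proof (induction al)
  case (Cons b al)
  have "card (comp_edges (b # al)) = card ((\<lambda>i. (i, b + 1 - i)) ` {1..b div 2}) + card ((\<lambda>(u, v). (b + u, b + v)) ` comp_edges al)"
    unfolding comp_edges_Cons
  proof (intro card_Un_disjoint)
    show "(\<lambda>i. (i, b + 1 - i)) ` {1..b div 2} \<inter> (\<lambda>(u, v). (b + u, b + v)) ` comp_edges al = {}"
      using comp_edges_bounds[of _ _ al] by fastforce
  qed (auto simp: finite_comp_edges)
  also have "card ((\<lambda>i. (i, b + 1 - i)) ` {1..b div 2}) = b div 2"
    by (subst card_image) (auto simp: inj_on_def)
  also have "card ((\<lambda>(u, v). (b + u, b + v)) ` comp_edges al) = card (comp_edges al)"
    by (subst card_image) (auto simp: inj_on_def)
  finally show ?case using Cons.IH by simp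
qed (simp add: comp_edges_Nil)

lemma num_paths_eq:
  assumes "sum_list al = sum_list be"
  shows "num_paths al be + (\<Sum>b\<leftarrow>al. b div 2) + (\<Sum>b\<leftarrow>be. b div 2) = sum_list al"
proof -
  have inc: "incident al v \<longleftrightarrow> v \<in> Domain (comp_edges al) \<union> Range (comp_edges al)" for al v
    by (auto simp: incident_def)
  have "comp_edges al \<subseteq> {1..sum_list al} \<times> {1..sum_list al}" "comp_edges be \<subseteq> {1..sum_list al} \<times> {1..sum_list al}"
    using comp_edges_bounds[of _ _ al] comp_edges_bounds[of _ _ be] assms by fastforce+
  from card_paths[OF _ this matching_comp_edges matching_comp_edges]
  show ?thesis
    by (simp add: num_paths_def meander_components_def is_cycle_comp_def meander_rel_def Let_def inc card_comp_edges)
qed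

text \<open>The cycles contribute an even number, so only the parity of the number of paths matters.
  Adding the sum over the parts, where \<open>num_paths_eq\<close> would subtract it, changes no
  parity and avoids truncated subtraction.\<close>

lemma partition_index_parity:
  "even (partition_index lam) \<longleftrightarrow> odd (sum_list lam - sum_list lam div 2 + (\<Sum>b\<leftarrow>lam. b div 2))"
proof -
  define P where "P = num_paths lam [sum_list lam]"
  have "P + (\<Sum>b\<leftarrow>lam. b div 2) + sum_list lam div 2 = sum_list lam"
    using num_paths_eq[of lam "[sum_list lam]"] by (simp add: P_def)
  then have "sum_list lam - sum_list lam div 2 = P + (\<Sum>b\<leftarrow>lam. b div 2)" by simp
  then have "sum_list lam - sum_list lam div 2 + (\<Sum>b\<leftarrow>lam. b div 2) = P + 2 * (\<Sum>b\<leftarrow>lam. b div 2)" by simp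
  then show ?thesis by (simp add: partition_index_def meander_index_def P_def[symmetric])
qed

section \<open>Signed counting of partitions into odd parts\<close>

definition part_weight :: "nat list \<Rightarrow> real" where
  "part_weight lam = (- 1) ^ (\<Sum>b\<leftarrow>lam. b div 2)"

definition bounded_parts :: "nat \<Rightarrow> nat \<Rightarrow> nat list set" where
  "bounded_parts m n = {lam \<in> odd_partitions n. \<forall>x\<in>set lam. x < 2 * m}"

definition weight_series :: "nat \<Rightarrow> real fps" where
  "weight_series m = Abs_fps (\<lambda>n. \<Sum>lam\<in>bounded_parts m n. part_weight lam)"

lemma finite_odd_partitions: "finite (odd_partitions n)"
proof (rule finite_subset)
  show "finite {xs. set xs \<subseteq> {..n} \<and> length xs \<le> n}" by (rule finite_lists_length_le) simp
  have len: "length xs \<le> sum_list xs" if "\<forall>x\<in>set xs. odd x" for xs :: "nat list"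
    using that
  proof (induction xs)
    case (Cons x xs)
    then have "x \<ge> 1" by (simp add: odd_pos Suc_leI)
    then show ?case using Cons by simp
  qed simp
  show "odd_partitions n \<subseteq> {xs. set xs \<subseteq> {..n} \<and> length xs \<le> n}"
    using len member_le_sum_list by (auto simp: odd_partitions_def)
qed

text \<open>Either the largest admissible part does not occur, or it stands at the head of the
  nonincreasing list and can be removed.\<close>

lemma bounded_parts_Suc:
  "bounded_parts (Suc m) n = bounded_parts m n \<union>
     (if n < 2 * m + 1 then {} else (#) (2 * m + 1) ` bounded_parts (Suc m) (n - (2 * m + 1)))" (is "?L = ?R")
proof (intro equalityI subsetI)
  fix xs assume xs: "xs \<in> ?L"
  show "xs \<in> ?R"
  proof (cases "2 * m + 1 \<in> set xs")
    case False
    have "x < 2 * m" if "x \<in> set xs" for x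
    proof -
      have "odd x" "x < 2 * Suc m" "x \<noteq> 2 * m + 1"
        using xs that False by (auto simp: bounded_parts_def odd_partitions_def)
      then show ?thesis by presburger
    qed
    then show ?thesis using xs by (simp add: bounded_parts_def)
  next
    case True
    then obtain y ys where y: "xs = y # ys" by (cases xs) auto
    have "y \<ge> 2 * m + 1" using True xs y by (auto simp: bounded_parts_def odd_partitions_def)
    moreover have "y < 2 * Suc m" using xs y by (auto simp: bounded_parts_def)
    ultimately have "y = 2 * m + 1" by simp
    then show ?thesis using xs y by (auto simp: bounded_parts_def odd_partitions_def)
  qed
next
  fix xs assume "xs \<in> ?R"
  then show "xs \<in> ?L"
    by (fastforce simp: bounded_parts_def odd_partitions_def split: if_splits)
qed

text \<open>Removing a part \<open>2 * m + 1\<close> removes the sign \<open>(- 1) ^ m\<close>,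
  since \<open>(2 * m + 1) div 2 = m\<close>.\<close>

lemma weight_series_Suc: "weight_series (Suc m) * (1 - fps_const ((- 1) ^ m) * fps_X ^ (2 * m + 1)) = weight_series m"
proof (rule fps_ext)
  fix n
  define c where "c = 2 * m + 1"
  have fin: "finite (bounded_parts m n)" for m n
    using finite_odd_partitions by (simp add: bounded_parts_def)
  have "(\<Sum>lam\<in>bounded_parts (Suc m) n. part_weight lam) = (\<Sum>lam\<in>bounded_parts m n. part_weight lam)
      + (- 1) ^ m * (if n < c then 0 else \<Sum>lam\<in>bounded_parts (Suc m) (n - c). part_weight lam)"
  proof (cases "n < c")
    case True
    then show ?thesis by (subst bounded_parts_Suc) (simp add: c_def)
  next
    case False
    have "bounded_parts (Suc m) n = bounded_parts m n \<union> (#) c ` bounded_parts (Suc m) (n - c)"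
      using bounded_parts_Suc[of m n] False by (simp add: c_def)
    moreover have "bounded_parts m n \<inter> (#) c ` bounded_parts (Suc m) (n - c) = {}"
      by (auto simp: bounded_parts_def c_def)
    ultimately have "(\<Sum>lam\<in>bounded_parts (Suc m) n. part_weight lam) = (\<Sum>lam\<in>bounded_parts m n. part_weight lam)
        + (\<Sum>lam\<in>(#) c ` bounded_parts (Suc m) (n - c). part_weight lam)"
      using fin by (simp only: sum.union_disjoint finite_imageI)
    also have "(\<Sum>lam\<in>(#) c ` bounded_parts (Suc m) (n - c). part_weight lam)
        = (\<Sum>lam\<in>bounded_parts (Suc m) (n - c). part_weight (c # lam))"
      by (subst sum.reindex) (auto simp: inj_on_def)
    also have "\<dots> = (- 1) ^ m * (\<Sum>lam\<in>bounded_parts (Suc m) (n - c). part_weight lam)"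
      unfolding sum_distrib_left by (rule sum.cong) (simp_all add: part_weight_def c_def power_add)
    finally show ?thesis using False by simp
  qed
  moreover have "weight_series (Suc m) * (1 - fps_const ((- 1) ^ m) * fps_X ^ c)
      = weight_series (Suc m) - fps_const ((- 1) ^ m) * (fps_X ^ c * weight_series (Suc m))"
    by (simp add: algebra_simps)
  ultimately show "fps_nth (weight_series (Suc m) * (1 - fps_const ((- 1) ^ m) * fps_X ^ (2 * m + 1))) n
      = fps_nth (weight_series m) n"
    unfolding c_def[symmetric]
    by (simp only: fps_sub_nth fps_mult_left_const_nth fps_X_power_mult_nth) (simp add: weight_series_def)
qed

text \<open>The parts \<open>4 * N + 1\<close> and \<open>4 * N + 3\<close> carry the signs + and -,
  so two steps of \<open>weight_series_Suc\<close> produce one factor of the truncated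
  product.\<close>

lemma weight_series_eq: "weight_series (2 * N) * G_denom_trunc N = 1"
proof (induction N)
  case 0
  have "bounded_parts 0 n = (if n = 0 then {[]} else {})" for n
    by (auto simp: bounded_parts_def odd_partitions_def)
  then show ?case by (auto simp: weight_series_def G_denom_trunc_def part_weight_def fps_eq_iff)
next
  case (Suc N)
  have e: "2 * (2 * N) + 1 = 4 * N + 1" "2 * Suc (2 * N) + 1 = 4 * N + 3" by simp_all
  have c: "fps_const ((- 1 :: real) ^ (2 * N)) = 1" "fps_const ((- 1 :: real) ^ Suc (2 * N)) = - 1"
    by (simp_all flip: fps_const_neg)
  have 1: "weight_series (Suc (2 * N)) * (1 - fps_X ^ (4 * N + 1)) = weight_series (2 * N)"
    using weight_series_Suc[of "2 * N"] by (simp only: e c mult_1_left)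
  have 2: "weight_series (Suc (Suc (2 * N))) * (1 + fps_X ^ (4 * N + 3)) = weight_series (Suc (2 * N))"
    using weight_series_Suc[of "Suc (2 * N)"] by (simp only: e c mult_minus1 diff_minus_eq_add)
  have "weight_series (2 * Suc N) * G_denom_trunc (Suc N)
      = weight_series (Suc (Suc (2 * N))) * (1 + fps_X ^ (4 * N + 3)) * (1 - fps_X ^ (4 * N + 1)) * G_denom_trunc N"
    unfolding G_denom_trunc_def prod.lessThan_Suc mult_Suc_right add_2_eq_Suc by (simp only: mult_ac)
  then show ?case unfolding 2 1 Suc.IH .
qed

lemma a_eq_weight_sum: "a n = (\<Sum>lam\<in>odd_partitions n. part_weight lam)"
proof -
  have "weight_series (2 * Suc n) = inverse (G_denom_trunc (Suc n))"
    by (rule sym, rule fps_inverse_unique) (simp only: mult.commute[of "G_denom_trunc _"] weight_series_eq)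
  then have "a n = fps_nth (weight_series (2 * Suc n)) n" using a_eq_trunc[of n "Suc n"] by simp
  moreover have "bounded_parts (2 * Suc n) n = odd_partitions n"
    using member_le_sum_list by (fastforce simp: bounded_parts_def odd_partitions_def)
  ultimately show ?thesis by (simp add: weight_series_def)
qed

text \<open>Weight and parity of the index differ by a sign that depends on \<open>n\<close> only
  and so factors out of the sum over partitions.\<close>

lemma count_diff: "real_of_int (int (e_count n) - int (o_count n)) = - ((- 1) ^ (n - n div 2)) * a n"
proof -
  have fin: "finite (odd_partitions n)" by (rule finite_odd_partitions)
  have "real_of_int (int (e_count n) - int (o_count n))
      = (\<Sum>lam\<in>odd_partitions n. if even (partition_index lam) then 1 else - 1)"
    using fin by (simp add: e_count_def o_count_def sum.If_cases Int_def)
  also have "\<dots> = (\<Sum>lam\<in>odd_partitions n. - ((- 1) ^ (n - n div 2)) * part_weight lam)"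
  proof (rule sum.cong)
    fix lam assume "lam \<in> odd_partitions n"
    then have "sum_list lam = n" by (simp add: odd_partitions_def)
    then have "even (partition_index lam) \<longleftrightarrow> odd (n - n div 2 + (\<Sum>b\<leftarrow>lam. b div 2))"
      using partition_index_parity[of lam] by simp
    moreover have "(- 1) ^ (n - n div 2) * part_weight lam = (- 1) ^ (n - n div 2 + (\<Sum>b\<leftarrow>lam. b div 2))"
      by (simp only: part_weight_def power_add)
    ultimately show "(if even (partition_index lam) then 1 else - 1) = - ((- 1) ^ (n - n div 2)) * part_weight lam"
      by (simp add: minus_one_power_iff)
  qed simp
  finally show ?thesis by (simp only: a_eq_weight_sum sum_distrib_left)
qed

lemma abs_count_diff: "real_of_int \<bar>int (e_count n) - int (o_count n)\<bar> = \<bar>a n\<bar>"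
proof -
  have "real_of_int \<bar>int (e_count n) - int (o_count n)\<bar> = \<bar>real_of_int (int (e_count n) - int (o_count n))\<bar>" by simp
  also have "\<dots> = \<bar>a n\<bar>" unfolding count_diff by (simp add: abs_mult power_abs)
  finally show ?thesis .
qed

section \<open>Coefficients up to 5000\<close>

text \<open>Integers are kept as radix 4 two's complement numerals, \<open>Dz = 0\<close> and \<open>Dm = - 1\<close> being the two possible
  leading ends, so that the simplifier needs one rewriting step per digit and never case-splits.\<close>

definition Dz :: int where "Dz = 0"
definition Dm :: int where "Dm = - 1"
definition D0 :: "int \<Rightarrow> int" where "D0 x = 4 * x + 0"
definition D1 :: "int \<Rightarrow> int" where "D1 x = 4 * x + 1"
definition D2 :: "int \<Rightarrow> int" where "D2 x = 4 * x + 2"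
definition D3 :: "int \<Rightarrow> int" where "D3 x = 4 * x + 3"
definition zadd :: "int \<Rightarrow> int \<Rightarrow> int" where "zadd x y = x + y"
text \<open>Carry and borrow are kept in the function symbol, here and in \<open>zsbb\<close>. The
  digitwise complement \<open>zcpl\<close> is what negation reduces to above the lowest nonzero
  digit.\<close>

definition zadc :: "int \<Rightarrow> int \<Rightarrow> int" where "zadc x y = x + y + 1"
definition zsub :: "int \<Rightarrow> int \<Rightarrow> int" where "zsub x y = x - y"
definition zsbb :: "int \<Rightarrow> int \<Rightarrow> int" where "zsbb x y = x - y - 1"
definition zinc :: "int \<Rightarrow> int" where "zinc x = x + 1"
definition zdec :: "int \<Rightarrow> int" where "zdec x = x - 1"
definition zneg :: "int \<Rightarrow> int" where "zneg x = - x"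
definition zcpl :: "int \<Rightarrow> int" where "zcpl x = - x - 1"
definition znonneg :: "int \<Rightarrow> bool" where "znonneg x \<longleftrightarrow> 0 \<le> x"

lemma digit_rules:
  "zinc (D0 x) = D1 x" "zdec (D0 x) = D3 (zdec x)" "zcpl (D0 x) = D3 (zcpl x)" "zneg (D0 x) = D0 (zneg x)"
  "znonneg (D0 x) = znonneg x" "zinc (D1 x) = D2 x" "zdec (D1 x) = D0 x" "zcpl (D1 x) = D2 (zcpl x)"
  "zneg (D1 x) = D3 (zcpl x)" "znonneg (D1 x) = znonneg x" "zinc (D2 x) = D3 x" "zdec (D2 x) = D1 x"
  "zcpl (D2 x) = D1 (zcpl x)" "zneg (D2 x) = D2 (zcpl x)" "znonneg (D2 x) = znonneg x"
  "zinc (D3 x) = D0 (zinc x)" "zdec (D3 x) = D2 x" "zcpl (D3 x) = D0 (zcpl x)" "zneg (D3 x) = D1 (zcpl x)"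
  "znonneg (D3 x) = znonneg x" "zinc Dz = D1 Dz" "zinc Dm = Dz" "zdec Dz = Dm" "zdec Dm = D2 Dm" "zcpl Dz = Dm"
  "zcpl Dm = Dz" "zneg Dz = Dz" "zneg Dm = D1 Dz" "znonneg Dz = True" "znonneg Dm = False" "zadd Dz x = x"
  "zadd x Dz = x" "zadd Dm x = zdec x" "zadd x Dm = zdec x" "zadc Dz x = zinc x" "zadc x Dz = zinc x"
  "zadc Dm x = x" "zadc x Dm = x" "zsub x Dz = x" "zsub Dz x = zneg x" "zsub Dm x = zcpl x" "zsub x Dm = zinc x"
  "zsbb x Dz = zdec x" "zsbb Dz x = zcpl x" "zsbb Dm x = zdec (zcpl x)" "zsbb x Dm = x"
  "zadd (D0 x) (D0 y) = D0 (zadd x y)" "zadc (D0 x) (D0 y) = D1 (zadd x y)" "zsub (D0 x) (D0 y) = D0 (zsub x y)"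
  "zsbb (D0 x) (D0 y) = D3 (zsbb x y)" "zadd (D0 x) (D1 y) = D1 (zadd x y)" "zadc (D0 x) (D1 y) = D2 (zadd x y)"
  "zsub (D0 x) (D1 y) = D3 (zsbb x y)" "zsbb (D0 x) (D1 y) = D2 (zsbb x y)" "zadd (D0 x) (D2 y) = D2 (zadd x y)"
  "zadc (D0 x) (D2 y) = D3 (zadd x y)" "zsub (D0 x) (D2 y) = D2 (zsbb x y)" "zsbb (D0 x) (D2 y) = D1 (zsbb x y)"
  "zadd (D0 x) (D3 y) = D3 (zadd x y)" "zadc (D0 x) (D3 y) = D0 (zadc x y)" "zsub (D0 x) (D3 y) = D1 (zsbb x y)"
  "zsbb (D0 x) (D3 y) = D0 (zsbb x y)" "zadd (D1 x) (D0 y) = D1 (zadd x y)" "zadc (D1 x) (D0 y) = D2 (zadd x y)"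
  "zsub (D1 x) (D0 y) = D1 (zsub x y)" "zsbb (D1 x) (D0 y) = D0 (zsub x y)" "zadd (D1 x) (D1 y) = D2 (zadd x y)"
  "zadc (D1 x) (D1 y) = D3 (zadd x y)" "zsub (D1 x) (D1 y) = D0 (zsub x y)" "zsbb (D1 x) (D1 y) = D3 (zsbb x y)"
  "zadd (D1 x) (D2 y) = D3 (zadd x y)" "zadc (D1 x) (D2 y) = D0 (zadc x y)" "zsub (D1 x) (D2 y) = D3 (zsbb x y)"
  "zsbb (D1 x) (D2 y) = D2 (zsbb x y)" "zadd (D1 x) (D3 y) = D0 (zadc x y)" "zadc (D1 x) (D3 y) = D1 (zadc x y)"
  "zsub (D1 x) (D3 y) = D2 (zsbb x y)" "zsbb (D1 x) (D3 y) = D1 (zsbb x y)" "zadd (D2 x) (D0 y) = D2 (zadd x y)"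
  "zadc (D2 x) (D0 y) = D3 (zadd x y)" "zsub (D2 x) (D0 y) = D2 (zsub x y)" "zsbb (D2 x) (D0 y) = D1 (zsub x y)"
  "zadd (D2 x) (D1 y) = D3 (zadd x y)" "zadc (D2 x) (D1 y) = D0 (zadc x y)" "zsub (D2 x) (D1 y) = D1 (zsub x y)"
  "zsbb (D2 x) (D1 y) = D0 (zsub x y)" "zadd (D2 x) (D2 y) = D0 (zadc x y)" "zadc (D2 x) (D2 y) = D1 (zadc x y)"
  "zsub (D2 x) (D2 y) = D0 (zsub x y)" "zsbb (D2 x) (D2 y) = D3 (zsbb x y)" "zadd (D2 x) (D3 y) = D1 (zadc x y)"
  "zadc (D2 x) (D3 y) = D2 (zadc x y)" "zsub (D2 x) (D3 y) = D3 (zsbb x y)" "zsbb (D2 x) (D3 y) = D2 (zsbb x y)"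
  "zadd (D3 x) (D0 y) = D3 (zadd x y)" "zadc (D3 x) (D0 y) = D0 (zadc x y)" "zsub (D3 x) (D0 y) = D3 (zsub x y)"
  "zsbb (D3 x) (D0 y) = D2 (zsub x y)" "zadd (D3 x) (D1 y) = D0 (zadc x y)" "zadc (D3 x) (D1 y) = D1 (zadc x y)"
  "zsub (D3 x) (D1 y) = D2 (zsub x y)" "zsbb (D3 x) (D1 y) = D1 (zsub x y)" "zadd (D3 x) (D2 y) = D1 (zadc x y)"
  "zadc (D3 x) (D2 y) = D2 (zadc x y)" "zsub (D3 x) (D2 y) = D1 (zsub x y)" "zsbb (D3 x) (D2 y) = D0 (zsub x y)"
  "zadd (D3 x) (D3 y) = D2 (zadc x y)" "zadc (D3 x) (D3 y) = D3 (zadc x y)" "zsub (D3 x) (D3 y) = D0 (zsub x y)"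
  "zsbb (D3 x) (D3 y) = D3 (zsbb x y)"
  by (auto simp: Dz_def Dm_def D0_def D1_def D2_def D3_def
      zadd_def zadc_def zsub_def zsbb_def zinc_def zdec_def zneg_def zcpl_def znonneg_def)

text \<open>\<open>dv f q r xs\<close> solves \<open>y\<^sub>i = f x\<^sub>i y\<^sub>i\<^sub>-\<^sub>m\<close>, the last \<open>m\<close> values being held in the queue with front \<open>q\<close> and
  reversed back \<open>r\<close>: with \<open>f\<close> addition or subtraction it divides by \<open>1 \<mp> X ^ m\<close>.\<close>

function dv :: "(int \<Rightarrow> int \<Rightarrow> int) \<Rightarrow> int list \<Rightarrow> int list \<Rightarrow> int list \<Rightarrow> int list" where
  "dv f q r [] = []"
| "dv f (p # q) r (x # xs) = f x p # dv f q (f x p # r) xs"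
| "dv f [] r (x # xs) = (if r = [] then [] else dv f (rev r) [] (x # xs))"
  by pat_completeness auto
text \<open>Reversing the back of the queue consumes no input, but it makes the front
  nonempty.\<close>

termination by (relation "measures [\<lambda>(f,q,r,xs). length xs, \<lambda>(f,q,r,xs). if q = [] then 1 else 0]") auto

text \<open>Reversal with an accumulator costs one rewriting step per entry.\<close>

fun rv :: "int list \<Rightarrow> int list \<Rightarrow> int list" where
  "rv [] ys = ys"
| "rv (x # xs) ys = rv xs (x # ys)"

lemma rv_eq: "rv xs ys = rev xs @ ys"
  by (induction xs ys rule: rv.induct) auto

definition "dp = dv zadd"
text \<open>Each new value goes both to the output and into the queue. As an argument of
  \<open>dph\<close> it is normalised once, before the unfolding duplicates it. Handling four
  entries at a time saves rewriting steps.\<close>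

definition dph where "dph z1 z2 z3 z4 q r xs = z1 # z2 # z3 # z4 # dp q (z4 # z3 # z2 # z1 # r) xs"
definition dph1 where "dph1 z q r xs = z # dp q (z # r) xs"

lemma dp_rules:
  "dp q r [] = []"
  "dp (p1 # p2 # p3 # p4 # q) r (x1 # x2 # x3 # x4 # xs) = dph (zadd x1 p1) (zadd x2 p2) (zadd x3 p3) (zadd x4 p4) q r xs"
  "dp (p1 # p2 # p3 # p4 # q) r [x1] = [zadd x1 p1]"
  "dp (p1 # p2 # p3 # p4 # q) r [x1, x2] = [zadd x1 p1, zadd x2 p2]"
  "dp (p1 # p2 # p3 # p4 # q) r [x1, x2, x3] = [zadd x1 p1, zadd x2 p2, zadd x3 p3]"
  "dp [p1] r (x # xs) = dph1 (zadd x p1) [] r xs"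
  "dp [p1, p2] r (x # xs) = dph1 (zadd x p1) [p2] r xs"
  "dp [p1, p2, p3] r (x # xs) = dph1 (zadd x p1) [p2, p3] r xs"
  "dp [] (y # r) (x # xs) = dp (rv (y # r) []) [] (x # xs)"
  by (simp_all add: dp_def dph_def dph1_def rv_eq)

definition "dm = dv zsub"
definition dmh where "dmh z1 z2 z3 z4 q r xs = z1 # z2 # z3 # z4 # dm q (z4 # z3 # z2 # z1 # r) xs"
definition dmh1 where "dmh1 z q r xs = z # dm q (z # r) xs"

lemma dm_rules:
  "dm q r [] = []"
  "dm (p1 # p2 # p3 # p4 # q) r (x1 # x2 # x3 # x4 # xs) = dmh (zsub x1 p1) (zsub x2 p2) (zsub x3 p3) (zsub x4 p4) q r xs"
  "dm (p1 # p2 # p3 # p4 # q) r [x1] = [zsub x1 p1]"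
  "dm (p1 # p2 # p3 # p4 # q) r [x1, x2] = [zsub x1 p1, zsub x2 p2]"
  "dm (p1 # p2 # p3 # p4 # q) r [x1, x2, x3] = [zsub x1 p1, zsub x2 p2, zsub x3 p3]"
  "dm [p1] r (x # xs) = dmh1 (zsub x p1) [] r xs"
  "dm [p1, p2] r (x # xs) = dmh1 (zsub x p1) [p2] r xs"
  "dm [p1, p2, p3] r (x # xs) = dmh1 (zsub x p1) [p2, p3] r xs"
  "dm [] (y # r) (x # xs) = dm (rv (y # r) []) [] (x # xs)"
  by (simp_all add: dm_def dmh_def dmh1_def rv_eq)

fun zeros :: "nat \<Rightarrow> int list" where
  "zeros 0 = []"
| "zeros (Suc n) = Dz # zeros n"

fun zeros2 :: "nat \<Rightarrow> int list" where
  "zeros2 0 = []"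
| "zeros2 (Suc n) = Dz # Dz # zeros2 n"

fun zeros4 :: "nat \<Rightarrow> int list \<Rightarrow> int list" where
  "zeros4 0 T = T"
| "zeros4 (Suc n) T = Dz # Dz # Dz # Dz # zeros4 n T"

text \<open>Consecutive terms of Cauchy's sum have the ratio
  \<open>X ^ (4 * k + 1) / ((1 - y ^ (k + 1)) * (1 - X * y ^ k))\<close>. Two levels are done per
  step because the signs depend on the parity of \<open>k\<close>: for even \<open>k\<close> the
  divisors are \<open>1 + X ^ (2 * k + 2)\<close> and \<open>1 - X ^ (2 * k + 1)\<close>, for odd
  \<open>k\<close> both signs are reversed. A leading 1 followed by \<open>4 * k\<close> zeros adds
  1 after the shift.\<close>

fun horner :: "nat \<Rightarrow> int list \<Rightarrow> int list" where
  "horner 0 T = T"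
| "horner (Suc 0) T = T"
| "horner (Suc (Suc n)) T = horner n (D1 Dz # zeros4 n (dp (Dz # zeros2 n) [] (dm (Dz # Dz # zeros2 n) []
     (D1 Dz # zeros4 (Suc n) (dm (Dz # zeros2 (Suc n)) [] (dp (Dz # Dz # zeros2 (Suc n)) [] T))))))"

fun all_nonneg :: "int list \<Rightarrow> bool" where
  "all_nonneg [] = True"
| "all_nonneg (x # xs) = (znonneg x \<and> all_nonneg xs)"

lemma all_nonneg_nth: "all_nonneg xs \<Longrightarrow> i < length xs \<Longrightarrow> xs ! i \<ge> 0"
  by (induction xs arbitrary: i) (auto simp: znonneg_def nth_Cons split: nat.splits)

lemma zeros_eq: "zeros n = replicate n 0" "zeros2 n = replicate (2 * n) 0" "zeros4 n T = replicate (4 * n) 0 @ T"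
proof -
  have "replicate (2 * Suc n) (0::int) = 0 # 0 # replicate (2 * n) 0"
    "replicate (4 * Suc n) (0::int) = 0 # 0 # 0 # 0 # replicate (4 * n) 0" for n
    by (simp_all add: numeral_eq_Suc)
  note r = this
  show "zeros n = replicate n 0" by (induction n) (auto simp: Dz_def)
  show "zeros2 n = replicate (2 * n) 0" by (induction n) (simp, simp only: zeros2.simps Dz_def r)
  show "zeros4 n T = replicate (4 * n) 0 @ T" by (induction n) (simp, simp only: zeros4.simps Dz_def r append.simps)
qed

lemma dv_length: "q \<noteq> [] \<or> r \<noteq> [] \<Longrightarrow> length (dv f q r xs) = length xs"
  by (induction f q r xs rule: dv.induct) auto

text \<open>The value fed back at position \<open>i\<close> is entry \<open>i\<close> of the queue
  followed by the output itself. With \<open>m\<close> zeros in the queue this is the output delayed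
  by \<open>m\<close>.\<close>

lemma dv_nth:
  assumes "q \<noteq> [] \<or> r \<noteq> []" "i < length xs"
  shows "dv f q r xs ! i = f (xs ! i) ((q @ rev r @ dv f q r xs) ! i)"
  using assms
proof (induction f q r xs arbitrary: i rule: dv.induct)
  case (2 f p q r x xs)
  then show ?case by (cases i) auto
next
  case (3 f r x xs)
  then show ?case by (auto split: if_splits)
qed auto

definition agrees :: "int list \<Rightarrow> real fps \<Rightarrow> bool" where
  "agrees xs F \<longleftrightarrow> (\<forall>i < length xs. of_int (xs ! i) = fps_nth F i)"

lemma agrees_dv:
  assumes m: "m > 0" and F: "agrees xs F" and op: "\<And>x y. f x y = x + c * y"
  shows "agrees (dv f (replicate m 0) [] xs) (F * inverse (1 - fps_const (of_int c) * fps_X ^ m))"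
proof -
  define D :: "real fps" where "D = 1 - fps_const (of_int c) * fps_X ^ m"
  have D0: "fps_nth D 0 = 1" using m by (simp add: D_def)
  define Y where "Y = F * inverse D"
  have "Y * D = F" using D0 by (simp add: Y_def mult.assoc inverse_mult_eq_1)
  then have Yeq: "Y = F + fps_const (of_int c) * (fps_X ^ m * Y)" by (simp add: D_def algebra_simps)
  have Y: "fps_nth Y i = fps_nth F i + of_int c * (if i < m then 0 else fps_nth Y (i - m))" for i
    by (subst Yeq) (simp only: fps_X_power_mult_nth fps_add_nth fps_mult_left_const_nth)
  define ys where "ys = dv f (replicate m 0) [] xs"
  have len: "length ys = length xs" using m by (simp add: ys_def dv_length)
  have nth: "ys ! i = xs ! i + c * (if i < m then 0 else ys ! (i - m))" if "i < length xs" for i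
  proof -
    have "ys ! i = f (xs ! i) ((replicate m 0 @ rev [] @ ys) ! i)"
      unfolding ys_def using m that by (intro dv_nth) auto
    then show ?thesis by (simp add: op nth_append)
  qed
  have "of_int (ys ! i) = fps_nth Y i" if "i < length xs" for i
    using that
  proof (induction i rule: less_induct)
    case (less i)
    then show ?case using F nth[of i] Y[of i] m by (auto simp: agrees_def)
  qed
  then show ?thesis using len by (simp add: agrees_def ys_def Y_def D_def)
qed

lemma agrees_dp: "agrees xs F \<Longrightarrow> m > 0 \<Longrightarrow> agrees (dp (replicate m 0) [] xs) (F * inverse (1 - fps_X ^ m))"
  using agrees_dv[of m xs F zadd 1] by (simp add: dp_def zadd_def)

lemma agrees_dm: "agrees xs F \<Longrightarrow> m > 0 \<Longrightarrow> agrees (dm (replicate m 0) [] xs) (F * inverse (1 + fps_X ^ m))"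
  using agrees_dv[of m xs F zsub "-1"] by (simp add: dm_def zsub_def flip: fps_const_neg)

lemma agrees_shift: "agrees xs F \<Longrightarrow> agrees (D1 Dz # zeros4 n xs) (1 + fps_X ^ (4 * n + 1) * F)"
  unfolding agrees_def zeros_eq
proof (intro allI impI)
  fix i assume F: "\<forall>i<length xs. of_int (xs ! i) = fps_nth F i" and i: "i < length (D1 Dz # replicate (4 * n) 0 @ xs)"
  show "of_int ((D1 Dz # replicate (4 * n) 0 @ xs) ! i) = fps_nth (1 + fps_X ^ (4 * n + 1) * F) i"
    unfolding fps_add_nth fps_X_power_mult_nth
    using F i by (cases i) (auto simp: D1_def Dz_def nth_append)
qed

definition yq :: "real fps" where "yq = - (fps_X ^ 2)"

text \<open>The part of Cauchy's sum from term \<open>n\<close> to term \<open>n + d\<close>,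
  divided by term \<open>n\<close>; see \<open>Hfr_sum\<close>.\<close>

fun Hfr :: "nat \<Rightarrow> nat \<Rightarrow> real fps" where
  "Hfr 0 n = 1"
| "Hfr (Suc d) n = 1 + fps_X ^ (4 * n + 1) * (Hfr d (Suc n) * inverse (1 - yq ^ (n + 1)) * inverse (1 - fps_X * yq ^ n))"

lemma yq_power: "yq ^ n = (if even n then fps_X ^ (2 * n) else - (fps_X ^ (2 * n)))"
  by (simp add: yq_def power_minus[of "fps_X ^ 2"] flip: power_mult)

lemma X_yq_power: "fps_X * yq ^ n = (if even n then fps_X ^ (2 * n + 1) else - (fps_X ^ (2 * n + 1)))"
  by (simp add: yq_power)

lemma horner_correct:
  assumes "even n" "agrees T (Hfr d n)"
  shows "agrees (horner n T) (Hfr (d + n) 0)"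
  using assms
proof (induction n arbitrary: T d rule: less_induct)
  case (less n)
  show ?case
  proof (cases "n = 0")
    case True
    then show ?thesis using less.prems by simp
  next
    case False
    then have "n \<ge> 2" using less.prems(1) by presburger
    define m where "m = n - 2"
    have n: "n = Suc (Suc m)" using \<open>n \<ge> 2\<close> by (simp add: m_def)
    have m: "even m" using less.prems(1) n by simp
    define T1 where "T1 = D1 Dz # zeros4 (Suc m) (dm (Dz # zeros2 (Suc m)) [] (dp (Dz # Dz # zeros2 (Suc m)) [] T))"
    define T2 where "T2 = D1 Dz # zeros4 m (dp (Dz # zeros2 m) [] (dm (Dz # Dz # zeros2 m) [] T1))"
    have z: "Dz # zeros2 k = replicate (2 * k + 1) 0" "Dz # Dz # zeros2 k = replicate (2 * k + 2) 0" for k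
      by (simp_all add: zeros_eq Dz_def)
    have "agrees T1 (1 + fps_X ^ (4 * Suc m + 1) * (Hfr d n * inverse (1 - fps_X ^ (2 * Suc m + 2)) * inverse (1 + fps_X ^ (2 * Suc m + 1))))"
      unfolding T1_def z(2) unfolding z(1) by (intro agrees_shift agrees_dm agrees_dp less.prems(2)) auto
    moreover have "1 - yq ^ (Suc m + 1) = 1 - fps_X ^ (2 * Suc m + 2)" "1 - fps_X * yq ^ Suc m = 1 + fps_X ^ (2 * Suc m + 1)"
      unfolding X_yq_power unfolding yq_power using m by simp_all
    ultimately have T1: "agrees T1 (Hfr (Suc d) (Suc m))" by (simp only: Hfr.simps n)
    have "agrees T2 (1 + fps_X ^ (4 * m + 1) * (Hfr (Suc d) (Suc m) * inverse (1 + fps_X ^ (2 * m + 2)) * inverse (1 - fps_X ^ (2 * m + 1))))"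
      unfolding T2_def z(2) unfolding z(1) by (intro agrees_shift agrees_dm agrees_dp T1) auto
    moreover have "1 - yq ^ (m + 1) = 1 + fps_X ^ (2 * m + 2)" "1 - fps_X * yq ^ m = 1 - fps_X ^ (2 * m + 1)"
      unfolding X_yq_power unfolding yq_power using m by simp_all
    ultimately have T2: "agrees T2 (Hfr (Suc (Suc d)) m)" by (simp only: Hfr.simps)
    have "agrees (horner m T2) (Hfr (Suc (Suc d) + m) 0)" using n m T2 by (intro less.IH) auto
    then show ?thesis by (simp add: n T1_def T2_def)
  qed
qed

text \<open>\<open>agrees\<close> compares only as many coefficients as the list has entries, so the
  length is the precision reached. Level \<open>k\<close> adds \<open>4 * k + 1\<close> entries, and
  these numbers add up to \<open>2 * n\<^sup>2 - n\<close> over \<open>k < n\<close>.\<close>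

lemma horner_length: "even n \<Longrightarrow> length (horner n T) + n = length T + 2 * n\<^sup>2"
proof (induction n T rule: horner.induct)
  case (3 n T)
  then show ?case by (simp add: zeros_eq dp_def dm_def dv_length power2_eq_square)
qed auto

section \<open>Cauchy's identity by telescoping\<close>

definition Pk :: "nat \<Rightarrow> real fps" where "Pk k = (\<Prod>i<k. 1 - yq ^ Suc i)"
definition Qk :: "nat \<Rightarrow> nat \<Rightarrow> real fps" where "Qk j k = (\<Prod>i<k. 1 - fps_X * yq ^ (j + i))"
text \<open>The summand of Cauchy's identity for \<open>1 / (z; y)\<close> at
  \<open>z = X * y ^ j\<close>. The start \<open>j\<close> is kept general because the proof moves
  \<open>z\<close> to \<open>z * y\<close> repeatedly.\<close>

definition trm :: "nat \<Rightarrow> nat \<Rightarrow> real fps" where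
  "trm j k = (fps_X * yq ^ j) ^ k * yq ^ (k * (k - 1)) * inverse (Pk k) * inverse (Qk j k)"

lemma yq_nth_0: "fps_nth (yq ^ Suc n) 0 = 0" "fps_nth (fps_X * yq ^ n) 0 = 0"
  by (simp_all add: yq_def)

lemma inverse_one_minus: "inverse (1 - f) * (1 - f) = 1" "(1 - f) * inverse (1 - f) = 1" if "fps_nth f 0 = 0" for f :: "real fps"
  using that by (simp_all add: inverse_mult_eq_1 inverse_mult_eq_1')

lemma inverse_Pk_Suc: "inverse (Pk (Suc k)) = inverse (Pk k) * inverse (1 - yq ^ Suc k)"
  by (simp add: Pk_def fps_inverse_mult del: power_Suc)

lemma inverse_Qk_Suc: "inverse (Qk j (Suc k)) = inverse (Qk j k) * inverse (1 - fps_X * yq ^ (j + k))"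
  by (simp add: Qk_def fps_inverse_mult)

lemma inverse_Qk_Suc': "inverse (Qk j (Suc k)) = inverse (1 - fps_X * yq ^ j) * inverse (Qk (Suc j) k)"
  unfolding Qk_def prod.lessThan_Suc_shift by (simp add: fps_inverse_mult)

lemma trm_Suc: "trm j (Suc k) = trm j k * (fps_X * yq ^ j * yq ^ (2 * k)) * inverse (1 - yq ^ Suc k) * inverse (1 - fps_X * yq ^ (j + k))"
proof -
  have "Suc k * (Suc k - 1) = k * (k - 1) + 2 * k" by (cases k) auto
  then have "yq ^ (Suc k * (Suc k - 1)) = yq ^ (k * (k - 1)) * yq ^ (2 * k)" by (metis power_add)
  then show ?thesis unfolding trm_def inverse_Pk_Suc inverse_Qk_Suc by (simp add: mult_ac)
qed

lemma trm_0: "trm j 0 = 1" by (simp add: trm_def Pk_def Qk_def)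

lemma trm_shift:
  "trm (Suc j) k * inverse (1 - fps_X * yq ^ j) = trm j k * yq ^ k * inverse (1 - fps_X * yq ^ (j + k))"
proof -
  have e1: "inverse (1 - fps_X * yq ^ j) * inverse (Qk (Suc j) k) = inverse (Qk j k) * inverse (1 - fps_X * yq ^ (j + k))"
    using inverse_Qk_Suc inverse_Qk_Suc' by metis
  have e2: "(fps_X * yq ^ Suc j) ^ k = (fps_X * yq ^ j) ^ k * yq ^ k" by (simp add: power_mult_distrib mult_ac)
  have "trm (Suc j) k * inverse (1 - fps_X * yq ^ j)
      = ((fps_X * yq ^ Suc j) ^ k * yq ^ (k * (k - 1)) * inverse (Pk k)) * (inverse (1 - fps_X * yq ^ j) * inverse (Qk (Suc j) k))"
    by (simp only: trm_def mult_ac)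
  also have "\<dots> = trm j k * yq ^ k * inverse (1 - fps_X * yq ^ (j + k))"
    unfolding e1 e2 trm_def by (simp only: mult_ac)
  finally show ?thesis .
qed

text \<open>This is the functional equation F(z y) = (1 - z) F(z) of the full sum F, in a finite
  form that keeps the boundary term of the truncation. The induction splits
  \<open>inverse (1 - z * y ^ K)\<close> into 1 and a remainder; the remainder is the next boundary
  term.\<close>

lemma trm_sum:
  "(\<Sum>k<K. trm (Suc j) k) * inverse (1 - fps_X * yq ^ j) = (\<Sum>k<K. trm j k) + trm j K * (1 - yq ^ K)"
proof (induction K)
  case 0
  then show ?case by simp
next
  case (Suc K)
  define I where "I = inverse (1 - fps_X * yq ^ (j + K))"
  have I: "I = 1 + fps_X * yq ^ (j + K) * I"
    using inverse_one_minus(2)[OF yq_nth_0(2), of "j + K"] by (simp add: I_def algebra_simps)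
  have "trm j (Suc K) * (1 - yq ^ Suc K) = trm j K * (fps_X * yq ^ j * yq ^ (2 * K)) * (inverse (1 - yq ^ Suc K) * (1 - yq ^ Suc K)) * I"
    unfolding trm_Suc I_def by (simp only: mult_ac)
  also have "\<dots> = trm j K * (fps_X * yq ^ j * yq ^ (2 * K)) * I" by (simp only: inverse_one_minus[OF yq_nth_0(1)] mult_1_right)
  also have "fps_X * yq ^ j * yq ^ (2 * K) = yq ^ K * (fps_X * yq ^ (j + K))" by (simp only: power_add mult_2) (simp only: mult_ac)
  finally have 1: "trm j (Suc K) * (1 - yq ^ Suc K) = trm j K * yq ^ K * (fps_X * yq ^ (j + K) * I)" by (simp only: mult_ac)
  have "(\<Sum>k<Suc K. trm (Suc j) k) * inverse (1 - fps_X * yq ^ j) = (\<Sum>k<K. trm j k) + trm j K * (1 - yq ^ K) + trm j K * yq ^ K * I"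
    by (simp only: sum.lessThan_Suc distrib_right Suc.IH trm_shift I_def)
  also have "trm j K * yq ^ K * I = trm j K * yq ^ K * (1 + fps_X * yq ^ (j + K) * I)" using I by simp
  also have "\<dots> = trm j K * yq ^ K + trm j (Suc K) * (1 - yq ^ Suc K)" unfolding 1 by (simp add: algebra_simps)
  finally show ?case by (simp add: algebra_simps del: power_Suc)
qed

definition fps_low :: "nat \<Rightarrow> real fps \<Rightarrow> bool" where "fps_low d f \<longleftrightarrow> (\<forall>i<d. fps_nth f i = 0)"

lemma fps_low_mult: "fps_low d f \<Longrightarrow> fps_low d (f * g)"
  unfolding fps_low_def fps_mult_nth by (auto intro!: sum.neutral)

lemma fps_low_add: "fps_low d f \<Longrightarrow> fps_low d g \<Longrightarrow> fps_low d (f + g)" and fps_low_minus: "fps_low d f \<Longrightarrow> fps_low d (- f)"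
  by (auto simp: fps_low_def)

lemma fps_low_mono: "fps_low d f \<Longrightarrow> e \<le> d \<Longrightarrow> fps_low e f" by (auto simp: fps_low_def)

lemma fps_low_X_power: "fps_low d (fps_X ^ d)" by (simp add: fps_low_def fps_X_power_nth)

lemma fps_low_trm: "fps_low (k * (2 * j + 1) + 2 * (k * (k - 1))) (trm j k)"
proof -
  have "(fps_X * yq ^ j) ^ k * yq ^ (k * (k - 1)) = fps_X ^ (k * (2 * j + 1) + 2 * (k * (k - 1))) * (-1) ^ (j * k + k * (k - 1))"
    by (simp add: yq_def power_minus[of "fps_X ^ 2"] power_add power_mult_distrib mult_ac flip: power_mult)
  then show ?thesis unfolding trm_def by (simp only: mult.assoc) (intro fps_low_mult fps_low_X_power)
qed

text \<open>Iterating \<open>trm_sum\<close> leaves one boundary term \<open>trm j K\<close> for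
  each \<open>j < N\<close>. Their orders increase with \<open>j\<close>, so the least one is
  \<open>K + 2 * K * (K - 1) = K * (2 * K - 1)\<close>, attained at \<open>j = 0\<close>.\<close>

lemma partial_sum_shift:
  "fps_low (K * (2 * K - 1)) ((\<Sum>k<K. trm 0 k) - (\<Sum>k<K. trm N k) * inverse (Qk 0 N))"
proof (induction N)
  case 0
  then show ?case by (simp add: Qk_def fps_low_def)
next
  case (Suc N)
  have "(\<Sum>k<K. trm N k) * inverse (Qk 0 N) = (\<Sum>k<K. trm (Suc N) k) * inverse (1 - fps_X * yq ^ N) * inverse (Qk 0 N) - trm N K * (1 - yq ^ K) * inverse (Qk 0 N)"
    unfolding trm_sum by (simp add: algebra_simps)
  also have "(\<Sum>k<K. trm (Suc N) k) * inverse (1 - fps_X * yq ^ N) * inverse (Qk 0 N) = (\<Sum>k<K. trm (Suc N) k) * inverse (Qk 0 (Suc N))"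
    unfolding inverse_Qk_Suc by (simp add: mult_ac)
  finally have e: "(\<Sum>k<K. trm 0 k) - (\<Sum>k<K. trm (Suc N) k) * inverse (Qk 0 (Suc N)) =
     ((\<Sum>k<K. trm 0 k) - (\<Sum>k<K. trm N k) * inverse (Qk 0 N)) + - (trm N K * ((1 - yq ^ K) * inverse (Qk 0 N)))"
    by (simp add: algebra_simps)
  have "K * (2 * K - 1) \<le> K * (2 * N + 1) + 2 * (K * (K - 1))" by (cases K) (auto simp: algebra_simps)
  then show ?case unfolding e
    by (intro fps_low_add Suc.IH fps_low_minus fps_low_mult fps_low_mono[OF fps_low_trm])
qed

lemma Hfr_sum: "trm 0 n * Hfr d n = (\<Sum>k=n..n + d. trm 0 k)"
proof (induction d arbitrary: n)
  case 0
  then show ?case by simp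
next
  case (Suc d)
  have "fps_X * yq ^ 0 * yq ^ (2 * n) = fps_X ^ (4 * n + 1)" by (simp add: yq_power)
  then have "trm 0 (Suc n) = trm 0 n * (fps_X ^ (4 * n + 1) * inverse (1 - yq ^ (n + 1)) * inverse (1 - fps_X * yq ^ n))"
    unfolding trm_Suc by (simp only: mult.assoc add_0 Suc_eq_plus1)
  then have "trm 0 (Suc n) * Hfr d (Suc n) = trm 0 n * (fps_X ^ (4 * n + 1) * (Hfr d (Suc n) * inverse (1 - yq ^ (n + 1)) * inverse (1 - fps_X * yq ^ n)))"
    by (simp only: mult_ac)
  then have "trm 0 n * Hfr (Suc d) n = trm 0 n + trm 0 (Suc n) * Hfr d (Suc n)"
    by (simp only: Hfr.simps distrib_left mult_1_right)
  also have "\<dots> = trm 0 n + (\<Sum>k=Suc n..n + Suc d. trm 0 k)" unfolding Suc.IH by simp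
  also have "\<dots> = (\<Sum>k=n..n + Suc d. trm 0 k)" by (simp add: sum.atLeast_Suc_atMost)
  finally show ?case .
qed

lemma Qk_eq: "Qk 0 (2 * N) = G_denom_trunc N"
proof (induction N)
  case (Suc N)
  have "Qk 0 (2 * Suc N) = Qk 0 (2 * N) * ((1 - fps_X * yq ^ (2 * N)) * (1 - fps_X * yq ^ (2 * N + 1)))"
    by (simp add: Qk_def)
  moreover have "1 - fps_X * yq ^ (2 * N) = 1 - fps_X ^ (4 * N + 1)" "1 - fps_X * yq ^ (2 * N + 1) = 1 + fps_X ^ (4 * N + 3)"
  proof -
    have "2 * (2 * N) + 1 = 4 * N + 1" "2 * (2 * N + 1) + 1 = 4 * N + 3" by simp_all
    then show "1 - fps_X * yq ^ (2 * N) = 1 - fps_X ^ (4 * N + 1)" "1 - fps_X * yq ^ (2 * N + 1) = 1 + fps_X ^ (4 * N + 3)"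
      unfolding X_yq_power by (simp_all only: even_mult_iff even_add even_numeral odd_one simp_thms if_True if_False diff_minus_eq_add)
  qed
  ultimately show ?case unfolding Suc.IH by (simp only: G_denom_trunc_def prod.lessThan_Suc)
qed (simp add: Qk_def G_denom_trunc_def)

text \<open>After a large shift every term except the initial 1 has order above \<open>n\<close>, so
  the partial sum equals the inverse of the finite product up to coefficient \<open>n\<close>. The
  order of the first omitted term decides how many coefficients are correct.\<close>

lemma a_eq_Hfr:
  assumes "n < Suc d * (2 * d + 1)"
  shows "a n = fps_nth (Hfr d 0) n"
proof -
  define K N where "K = Suc d" and "N = Suc n"
  have low: "fps_low (Suc n) ((\<Sum>k<K. trm 0 k) - (\<Sum>k<K. trm (2 * N) k) * inverse (Qk 0 (2 * N)))"
    using assms by (intro fps_low_mono[OF partial_sum_shift]) (simp add: K_def)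
  have "fps_low (Suc n) ((\<Sum>k<K. trm (2 * N) k) - 1)"
  proof -
    have "(\<Sum>k<K. trm (2 * N) k) - 1 = (\<Sum>k<d. trm (2 * N) (Suc k))"
      unfolding K_def sum.lessThan_Suc_shift trm_0 by simp
    moreover have "fps_low (Suc n) (\<Sum>k<e. trm (2 * N) (Suc k))" for e
    proof (induction e)
      case (Suc e)
      have "fps_low (Suc n) (trm (2 * N) (Suc e))" by (rule fps_low_mono[OF fps_low_trm]) (simp add: N_def)
      with Suc show ?case by (simp add: fps_low_add)
    qed (simp add: fps_low_def)
    ultimately show ?thesis by simp
  qed
  from fps_low_add[OF low fps_low_mult[OF this, of "inverse (Qk 0 (2 * N))"]]
  have "fps_low (Suc n) ((\<Sum>k<K. trm 0 k) - inverse (Qk 0 (2 * N)))" by (simp add: algebra_simps)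
  then have "fps_nth (\<Sum>k<K. trm 0 k) n = fps_nth (inverse (G_denom_trunc N)) n" by (simp add: fps_low_def Qk_eq)
  also have "\<dots> = a n" by (rule a_eq_trunc[symmetric]) (simp add: N_def)
  also have "(\<Sum>k<K. trm 0 k) = Hfr d 0"
    using Hfr_sum[of 0 d] by (simp add: trm_0 K_def atLeast0AtMost lessThan_Suc_atMost)
  finally show ?thesis by simp
qed

text \<open>The start is the innermost series 1 to 50 places, and 50 levels extend it to
  \<open>50 + 2 * 50\<^sup>2 - 50 = 5000\<close> places.\<close>

lemma horner_nonneg: "all_nonneg (horner 50 (D1 Dz # zeros 49))"
  unfolding numeral_eq_Suc pred_numeral_simps BitM.simps
  by (simp only: digit_rules dp_rules dph_def dph1_def dm_rules dmh_def dmh1_def zeros.simps zeros2.simps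
      zeros4.simps rv.simps horner.simps all_nonneg.simps simp_thms)

lemma a_nonneg_small:
  assumes "n < 5000"
  shows "a n \<ge> 0"
proof -
  have "agrees (D1 Dz # zeros 49) (Hfr 0 50)"
    unfolding agrees_def zeros_eq by (auto simp: D1_def Dz_def nth_Cons split: nat.splits)
  then have "agrees (horner 50 (D1 Dz # zeros 49)) (Hfr (0 + 50) 0)" by (intro horner_correct) auto
  moreover have len: "length (horner 50 (D1 Dz # zeros 49)) = 5000"
    using horner_length[of 50 "D1 Dz # zeros 49"] by (simp add: zeros_eq)
  ultimately have "fps_nth (Hfr 50 0) n = of_int (horner 50 (D1 Dz # zeros 49) ! n)"
    using assms by (simp add: agrees_def)
  moreover have "horner 50 (D1 Dz # zeros 49) ! n \<ge> 0"
    using all_nonneg_nth[OF horner_nonneg] assms len by simp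
  \<comment> \<open>The first omitted term has order 51 * 101 = 5151.\<close>
  moreover have "a n = fps_nth (Hfr 50 0) n" using assms by (intro a_eq_Hfr) simp
  ultimately show ?thesis by simp
qed

section \<open>Asymptotics of the logarithm of the generating function\<close>

text \<open>The dilogarithm; its summand at \<open>m = 0\<close> is 0. It enters as the
  antiderivative of \<open>Ln (1 - \<omega> * exp (- z))\<close>.\<close>

definition dilog :: "complex \<Rightarrow> complex" where
  "dilog w = (\<Sum>m. w ^ m / of_nat m ^ 2)"

lemma summable_inverse_squares_norm: "summable (\<lambda>m. 1 / real m ^ 2)"
  using inverse_power_summable[of 2, where ?'a = real] by (simp add: inverse_eq_divide)

lemma norm_dilog_term:
  fixes w :: complex
  assumes "norm w \<le> 1"
  shows "norm (w ^ m / of_nat m ^ 2) \<le> 1 / real m ^ 2"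
  using assms power_le_one[of "norm w" m]
  by (simp add: norm_divide norm_power divide_right_mono)

lemma dilog_sums:
  assumes "norm w \<le> 1"
  shows "(\<lambda>m. w ^ m / of_nat m ^ 2) sums dilog w"
  unfolding dilog_def
  by (rule summable_sums, rule summable_comparison_test'[OF summable_inverse_squares_norm])
     (use norm_dilog_term[OF assms] in auto)

lemma continuous_on_dilog: "continuous_on (cball 0 1) dilog"
proof -
  have "uniform_limit (cball 0 1) (\<lambda>n w. \<Sum>m<n. w ^ m / of_nat m ^ 2) (\<lambda>w. \<Sum>m. w ^ m / of_nat m ^ 2 :: complex) sequentially"
    by (rule Weierstrass_m_test[OF _ summable_inverse_squares_norm]) (use norm_dilog_term in auto)
  moreover have "continuous_on (cball 0 1) (\<lambda>w::complex. \<Sum>m<n. w ^ m / of_nat m ^ 2)" for n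
    unfolding divide_inverse
    by (intro continuous_on_sum continuous_on_mult_right continuous_on_power continuous_on_id)
  ultimately show ?thesis unfolding dilog_def[abs_def]
    by (intro uniform_limit_theorem[rotated]) (auto intro!: always_eventually)
qed

lemma has_derivative_dilog:
  assumes w: "norm w < 1" "w \<noteq> 0"
  shows "(dilog has_field_derivative (- Ln (1 - w) / w)) (at w)"
proof -
  define c :: "nat \<Rightarrow> complex" where "c m = 1 / of_nat m ^ 2" for m
  have d: "dilog = (\<lambda>w. \<Sum>m. c m * w ^ m)" by (simp add: dilog_def[abs_def] c_def)
  have "(dilog has_field_derivative (\<Sum>m. diffs c m * w ^ m)) (at w)"
    unfolding d
  proof (rule termdiffs_strong'[where K = 1])
    fix z :: complex assume "norm z < 1"
    then show "summable (\<lambda>m. c m * z ^ m)"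
      using sums_summable[OF dilog_sums[of z]] by (simp add: c_def)
  qed (use w in auto)
  moreover have "(\<Sum>m. diffs c m * w ^ m) = - Ln (1 - w) / w"
  proof -
    have "(\<lambda>m. w ^ Suc m / of_nat (Suc m)) sums (- Ln (1 - w))"
      using minus_Ln_sums[OF w(1)] by (subst sums_Suc_iff) simp
    from sums_divide[OF this, of w] have "(\<lambda>m. w ^ m / of_nat (Suc m)) sums (- Ln (1 - w) / w)"
      using w by simp
    moreover have "diffs c m * w ^ m = w ^ m / of_nat (Suc m)" for m
      by (simp add: diffs_def c_def power2_eq_square del: of_nat_Suc)
    ultimately show ?thesis by (simp add: sums_iff)
  qed
  ultimately show ?thesis by simp
qed

section \<open>The midpoint rule along a ray\<close>

context
  fixes \<omega> :: complex
  assumes \<omega>: "norm \<omega> = 1"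
begin

text \<open>A function with its first three derivatives, indexed in the form that
  \<open>complex_Taylor\<close> takes. The logarithm of a product is a sum of values of
  \<open>Pd 1\<close> at equidistant points of a ray, so the midpoint rule compares it with a
  difference of values of \<open>Pd 0\<close>.\<close>

fun Pd :: "nat \<Rightarrow> complex \<Rightarrow> complex" where
  "Pd 0 z = dilog (\<omega> * exp (- z))"
| "Pd (Suc 0) z = Ln (1 - \<omega> * exp (- z))"
| "Pd (Suc (Suc 0)) z = \<omega> * exp (- z) / (1 - \<omega> * exp (- z))"
| "Pd (Suc (Suc (Suc n))) z = - (\<omega> * exp (- z) / (1 - \<omega> * exp (- z)) ^ 2)"

lemma norm_omega_exp: "norm (\<omega> * exp (- z)) = exp (- Re z)"
  using \<omega> by (simp add: norm_mult)

lemma Pd_deriv: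
  assumes "Re z > 0" "i \<le> 2"
  shows "(Pd i has_field_derivative Pd (Suc i) z) (at z within S)"
proof -
  have n: "norm (\<omega> * exp (- z)) < 1" using assms by (simp add: norm_omega_exp)
  have nz: "\<omega> * exp (- z) \<noteq> 0" using \<omega> by auto
  have ne: "1 - \<omega> * exp (- z) \<noteq> 0" using n by auto
  have "1 - \<omega> * exp (- z) \<notin> \<real>\<^sub>\<le>\<^sub>0"
  proof
    assume "1 - \<omega> * exp (- z) \<in> \<real>\<^sub>\<le>\<^sub>0"
    then have "Re (1 - \<omega> * exp (- z)) \<le> 0" by (auto simp: complex_nonpos_Reals_iff)
    then show False using n complex_Re_le_cmod[of "\<omega> * exp (- z)"] by (simp del: times_complex.sel)
  qed
  note this [simp]
  consider "i = 0" | "i = Suc 0" | "i = Suc (Suc 0)" using assms(2) by force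
  then show ?thesis
  proof cases
    case 1
    have "((\<lambda>z. dilog (\<omega> * exp (- z))) has_field_derivative
       (- Ln (1 - \<omega> * exp (- z)) / (\<omega> * exp (- z))) * (- (\<omega> * exp (- z)))) (at z within S)"
      by (rule DERIV_chain2[OF has_derivative_dilog]) (use n nz in \<open>auto intro!: derivative_eq_intros\<close>)
    moreover have "(- Ln (1 - \<omega> * exp (- z)) / (\<omega> * exp (- z))) * (- (\<omega> * exp (- z))) = Ln (1 - \<omega> * exp (- z))"
      using nz by simp
    ultimately have "((\<lambda>z. dilog (\<omega> * exp (- z))) has_field_derivative Ln (1 - \<omega> * exp (- z))) (at z within S)"
      by simp
    then show ?thesis using 1 by (simp add: fun_eq_iff[symmetric] Pd.simps[abs_def])
  next
    case 2
    have "((\<lambda>z. Ln (1 - \<omega> * exp (- z))) has_field_derivative (\<omega> * exp (- z) / (1 - \<omega> * exp (- z)))) (at z within S)"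
      by (auto intro!: derivative_eq_intros simp: divide_simps ne)
    then show ?thesis using 2 by (simp add: Pd.simps[abs_def])
  next
    case 3
    have "((\<lambda>z. \<omega> * exp (- z) / (1 - \<omega> * exp (- z))) has_field_derivative
       (- (\<omega> * exp (- z) / (1 - \<omega> * exp (- z)) ^ 2))) (at z within S)"
      using ne by (auto intro!: derivative_eq_intros simp: power2_eq_square divide_simps) (auto simp: algebra_simps)
    then show ?thesis using 3 by (simp add: Pd.simps[abs_def])
  qed
qed

text \<open>The parameter \<open>D\<close> measures how far the ray keeps away from the singularity
  at 1; it enters the bounds of the second and third derivative linearly and quadratically.\<close>

lemma norm_one_minus_ge:
  assumes "Re (\<omega> * exp (- z)) \<le> 1 - 1 / D" "D \<ge> 1"
  shows "norm (1 - \<omega> * exp (- z)) \<ge> 1 / D"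
  using assms complex_Re_le_cmod[of "1 - \<omega> * exp (- z)"] by (simp del: times_complex.sel)

lemma Pd2_bound:
  assumes "Re (\<omega> * exp (- z)) \<le> 1 - 1 / D" "D \<ge> 1"
  shows "norm (Pd (Suc (Suc 0)) z) \<le> D * exp (- Re z)"
proof -
  have "norm (Pd (Suc (Suc 0)) z) = exp (- Re z) / norm (1 - \<omega> * exp (- z))"
    by (simp add: norm_divide norm_omega_exp)
  also have "\<dots> \<le> exp (- Re z) / (1 / D)"
    using norm_one_minus_ge[OF assms] less_le_trans[OF _ norm_one_minus_ge[OF assms], of 0] assms(2)
    by (intro divide_left_mono mult_pos_pos) auto
  finally show ?thesis by (simp add: mult_ac)
qed

lemma Pd3_bound:
  assumes "Re (\<omega> * exp (- z)) \<le> 1 - 1 / D" "D \<ge> 1"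
  shows "norm (Pd (Suc (Suc (Suc 0))) z) \<le> D ^ 2 * exp (- Re z)"
proof -
  have "norm (Pd (Suc (Suc (Suc 0))) z) = exp (- Re z) / norm (1 - \<omega> * exp (- z)) ^ 2"
    by (simp add: norm_divide norm_power norm_omega_exp)
  also have "\<dots> \<le> exp (- Re z) / (1 / D) ^ 2"
    using norm_one_minus_ge[OF assms] less_le_trans[OF _ norm_one_minus_ge[OF assms], of 0] assms(2)
    by (intro divide_left_mono mult_pos_pos power_mono zero_less_power) auto
  finally show ?thesis by (simp add: power_divide mult_ac)
qed

text \<open>Taylor expansion of second order at the midpoint: the even terms cancel in the
  difference of the two ends, and each end leaves a remainder of half the stated bound. The
  derivative bound is needed only on the segment, which is convex.\<close>

lemma midpoint_cell:
  assumes z0: "Re (z - \<tau>) > 0" and tau: "Re \<tau> > 0" and D: "D \<ge> 1"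
    and ray: "\<And>x. x \<in> {-1..1} \<Longrightarrow> Re (\<omega> * exp (- (z + of_real x * \<tau>))) \<le> 1 - 1 / D"
  shows "norm (Pd 0 (z + \<tau>) - Pd 0 (z - \<tau>) - 2 * \<tau> * Pd 1 z) \<le> D ^ 2 * exp (- Re (z - \<tau>)) * norm \<tau> ^ 3"
proof -
  define S where "S = (\<lambda>x. z + of_real x * \<tau>) ` {-1..1}"
  define B where "B = D ^ 2 * exp (- Re (z - \<tau>))"
  have conv: "convex S"
  proof -
    have "S = (+) z ` ((\<lambda>x. x *\<^sub>R \<tau>) ` {-1..1})" unfolding S_def image_image by (simp add: scaleR_conv_of_real)
    moreover have "convex ((\<lambda>x. x *\<^sub>R \<tau>) ` {-1..1::real})"
      by (intro convex_linear_image bounded_linear.linear bounded_linear_scaleR_left convex_real_interval)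
    ultimately show ?thesis using convex_translation by blast
  qed
  have S: "Re w \<ge> Re (z - \<tau>)" "Re (\<omega> * exp (- w)) \<le> 1 - 1 / D" if "w \<in> S" for w
  proof -
    from that obtain x where x: "x \<in> {-1..1}" "w = z + of_real x * \<tau>" by (auto simp: S_def)
    then show "Re (\<omega> * exp (- w)) \<le> 1 - 1 / D" using ray by blast
    have "x * Re \<tau> \<ge> -1 * Re \<tau>" using x tau by (intro mult_right_mono) auto
    then show "Re w \<ge> Re (z - \<tau>)" using x by simp
  qed
  have B: "norm (Pd (Suc 2) w) \<le> B" if "w \<in> S" for w
  proof -
    have "norm (Pd (Suc 2) w) \<le> D ^ 2 * exp (- Re w)"
      using Pd3_bound[OF S(2)[OF that] D] by (simp add: numeral_2_eq_2)
    also have "\<dots> \<le> B" unfolding B_def using S(1)[OF that] by (intro mult_left_mono) auto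
    finally show ?thesis .
  qed
  have der: "(Pd i has_field_derivative Pd (Suc i) w) (at w within S)" if "w \<in> S" "i \<le> 2" for i w
    using S(1)[OF that(1)] z0 that by (intro Pd_deriv) auto
  have zS: "z \<in> S" "z + \<tau> \<in> S" "z - \<tau> \<in> S"
    unfolding S_def by (auto intro: image_eqI[of _ _ 0] image_eqI[of _ _ 1] image_eqI[of _ _ "-1"])
  have s: "(\<Sum>i\<le>2. Pd i z * x ^ i / fact i) = Pd 0 z + Pd 1 z * x + Pd 2 z * x ^ 2 / 2" for x
    by (simp add: numeral_2_eq_2)
  have T1: "norm (Pd 0 (z + \<tau>) - (Pd 0 z + Pd 1 z * \<tau> + Pd 2 z * \<tau> ^ 2 / 2)) \<le> B * norm \<tau> ^ 3 / 2"
    using complex_Taylor[of S 2 Pd B z "z + \<tau>", OF conv der B zS(1,2)] unfolding s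
    by (simp add: numeral_3_eq_3)
  have T2: "norm (Pd 0 (z - \<tau>) - (Pd 0 z - Pd 1 z * \<tau> + Pd 2 z * \<tau> ^ 2 / 2)) \<le> B * norm \<tau> ^ 3 / 2"
    using complex_Taylor[of S 2 Pd B z "z - \<tau>", OF conv der B zS(1,3)] unfolding s
    by (simp add: numeral_3_eq_3)
  have "Pd 0 (z + \<tau>) - Pd 0 (z - \<tau>) - 2 * \<tau> * Pd 1 z =
     (Pd 0 (z + \<tau>) - (Pd 0 z + Pd 1 z * \<tau> + Pd 2 z * \<tau> ^ 2 / 2)) - (Pd 0 (z - \<tau>) - (Pd 0 z - Pd 1 z * \<tau> + Pd 2 z * \<tau> ^ 2 / 2))"
    by (simp add: algebra_simps)
  also have "norm \<dots> \<le> B * norm \<tau> ^ 3 / 2 + B * norm \<tau> ^ 3 / 2"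
    using norm_triangle_ineq4 T1 T2 by (meson add_mono order_trans)
  also have "\<dots> = D ^ 2 * exp (- Re (z - \<tau>)) * norm \<tau> ^ 3" by (simp add: B_def)
  finally show ?thesis .
qed

text \<open>The cell errors decay by the factor \<open>exp (- 2 * Re \<tau>)\<close> from one cell
  to the next, so they sum to a bound independent of \<open>K\<close>. The start \<open>z0\<close>
  lies strictly inside the half plane because \<open>Pd 0\<close> is differentiated only
  there.\<close>

lemma midpoint_rule:
  assumes z0: "Re z0 > 0" and tau: "Re \<tau> > 0" and D: "D \<ge> 1"
    and ray: "\<And>x. x \<ge> 0 \<Longrightarrow> Re (\<omega> * exp (- (z0 + of_real x * \<tau>))) \<le> 1 - 1 / D"
  shows "norm (Pd 0 (z0 + of_nat (2 * K) * \<tau>) - Pd 0 z0 - 2 * \<tau> * (\<Sum>k<K. Pd 1 (z0 + of_nat (2*k+1) * \<tau>)))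
      \<le> D ^ 2 * norm \<tau> ^ 3 * (1 / (1 - exp (- 2 * Re \<tau>)))"
proof -
  have "norm (Pd 0 (z0 + of_nat (2 * K) * \<tau>) - Pd 0 z0 - 2 * \<tau> * (\<Sum>k<K. Pd 1 (z0 + of_nat (2*k+1) * \<tau>)))
      \<le> (\<Sum>k<K. D ^ 2 * norm \<tau> ^ 3 * exp (- 2 * Re \<tau>) ^ k)"
  proof (induction K)
    case (Suc K)
    define z where "z = z0 + of_nat (2*K+1) * \<tau>"
    have zp: "z + \<tau> = z0 + of_nat (2 * Suc K) * \<tau>" and zm: "z - \<tau> = z0 + of_nat (2 * K) * \<tau>"
      by (auto simp: z_def algebra_simps)
    have Rzm: "Re (z - \<tau>) = Re z0 + 2 * K * Re \<tau>" unfolding zm by simp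
    have cell: "norm (Pd 0 (z + \<tau>) - Pd 0 (z - \<tau>) - 2 * \<tau> * Pd 1 z) \<le> D ^ 2 * exp (- Re (z - \<tau>)) * norm \<tau> ^ 3"
    proof (rule midpoint_cell[OF _ tau D])
      show "Re (z - \<tau>) > 0" unfolding Rzm using z0 tau by (simp add: add_pos_nonneg)
      fix x :: real assume x: "x \<in> {-1..1}"
      have "z + of_real x * \<tau> = z0 + of_real (2*K+1+x) * \<tau>" by (simp add: z_def algebra_simps)
      then show "Re (\<omega> * exp (- (z + of_real x * \<tau>))) \<le> 1 - 1 / D"
        using ray[of "2*K+1+x"] x by simp
    qed
    also have "D ^ 2 * exp (- Re (z - \<tau>)) * norm \<tau> ^ 3 \<le> D ^ 2 * norm \<tau> ^ 3 * exp (- 2 * Re \<tau>) ^ K"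
    proof -
      have "exp (- Re (z - \<tau>)) \<le> exp (real K * (- 2 * Re \<tau>))"
        unfolding Rzm using z0 by (simp add: algebra_simps)
      then have "exp (- Re (z - \<tau>)) \<le> exp (- 2 * Re \<tau>) ^ K" by (simp only: exp_of_nat_mult)
      then have "(D ^ 2 * norm \<tau> ^ 3) * exp (- Re (z - \<tau>)) \<le> (D ^ 2 * norm \<tau> ^ 3) * exp (- 2 * Re \<tau>) ^ K"
        by (intro mult_left_mono) auto
      then show ?thesis by (simp add: mult_ac)
    qed
    finally have c: "norm (Pd 0 (z + \<tau>) - Pd 0 (z - \<tau>) - 2 * \<tau> * Pd 1 z) \<le> D ^ 2 * norm \<tau> ^ 3 * exp (- 2 * Re \<tau>) ^ K" .
    have "Pd 0 (z0 + of_nat (2 * Suc K) * \<tau>) - Pd 0 z0 - 2 * \<tau> * (\<Sum>k<Suc K. Pd 1 (z0 + of_nat (2*k+1) * \<tau>))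
       = (Pd 0 (z + \<tau>) - Pd 0 (z - \<tau>) - 2 * \<tau> * Pd 1 z) +
        (Pd 0 (z0 + of_nat (2 * K) * \<tau>) - Pd 0 z0 - 2 * \<tau> * (\<Sum>k<K. Pd 1 (z0 + of_nat (2*k+1) * \<tau>)))"
      unfolding zp[symmetric] zm[symmetric] sum.lessThan_Suc z_def[symmetric] by (simp add: algebra_simps)
    then show ?case
      unfolding sum.lessThan_Suc[of "\<lambda>k. D ^ 2 * norm \<tau> ^ 3 * exp (- 2 * Re \<tau>) ^ k"]
      using norm_triangle_le[OF add_mono[OF c Suc.IH]] by (simp only: add.commute)
  qed auto
  also have "\<dots> = D ^ 2 * norm \<tau> ^ 3 * (\<Sum>k<K. exp (- 2 * Re \<tau>) ^ k)" by (simp add: sum_distrib_left)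
  also have "\<dots> \<le> D ^ 2 * norm \<tau> ^ 3 * (1 / (1 - exp (- 2 * Re \<tau>)))"
  proof (intro mult_left_mono)
    have l: "exp (- 2 * Re \<tau>) < 1" using tau by simp
    have "(\<Sum>k<K. exp (- 2 * Re \<tau>) ^ k) \<le> (\<Sum>k. exp (- 2 * Re \<tau>) ^ k)"
      using l by (intro sum_le_suminf summable_geometric) auto
    also have "\<dots> = 1 / (1 - exp (- 2 * Re \<tau>))" using l by (intro suminf_geometric) auto
    finally show "(\<Sum>k<K. exp (- 2 * Re \<tau>) ^ k) \<le> 1 / (1 - exp (- 2 * Re \<tau>))" .
  qed auto
  finally show ?thesis .
qed

lemma Pd0_tendsto_0:
  assumes tau: "Re \<tau> > 0"
  shows "(\<lambda>K. Pd 0 (z0 + of_nat (2 * K) * \<tau>)) \<longlonglongrightarrow> 0"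
proof -
  have e: "(\<lambda>K. \<omega> * exp (- (z0 + of_nat (2 * K) * \<tau>))) \<longlonglongrightarrow> 0"
  proof (rule tendsto_norm_zero_cancel)
    have "norm (\<omega> * exp (- (z0 + of_nat (2 * K) * \<tau>))) = exp (- Re z0) * exp (- 2 * Re \<tau>) ^ K" for K
      unfolding norm_omega_exp by (simp add: exp_of_nat_mult[symmetric] algebra_simps flip: exp_add)
    moreover have "(\<lambda>K. exp (- Re z0) * exp (- 2 * Re \<tau>) ^ K) \<longlonglongrightarrow> 0"
      using tau by (intro tendsto_mult_right_zero LIMSEQ_power_zero) auto
    ultimately show "(\<lambda>K. norm (\<omega> * exp (- (z0 + of_nat (2 * K) * \<tau>)))) \<longlonglongrightarrow> 0" by simp
  qed
  have "isCont dilog 0"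
    using continuous_on_interior[OF continuous_on_dilog, of 0] by simp
  from isCont_tendsto_compose[OF this e] have "(\<lambda>K. dilog (\<omega> * exp (- (z0 + of_nat (2 * K) * \<tau>)))) \<longlonglongrightarrow> dilog 0" .
  moreover have "dilog 0 = 0"
  proof -
    have "(\<lambda>m. (0::complex) ^ m / of_nat m ^ 2) = (\<lambda>m. 0)" by (auto simp: fun_eq_iff power_0_left)
    then show ?thesis unfolding dilog_def by (simp only: suminf_zero)
  qed
  ultimately show ?thesis by simp
qed

text \<open>A shift to the right multiplies \<open>\<omega> * exp (- z)\<close> by a factor at most
  1. This lets a ray that starts on the boundary be approximated from inside.\<close>

lemma ray_shift:
  assumes "Re (\<omega> * exp (- z)) \<le> 1 - 1 / D" "D \<ge> 1" "e \<ge> 0"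
  shows "Re (\<omega> * exp (- (of_real e + z))) \<le> 1 - 1 / (D::real)"
proof -
  have "\<omega> * exp (- (of_real e + z)) = of_real (exp (- e)) * (\<omega> * exp (- z))"
    by (simp add: exp_add exp_diff exp_minus exp_of_real field_simps)
  then have "Re (\<omega> * exp (- (of_real e + z))) = exp (- e) * Re (\<omega> * exp (- z))"
    by (metis Re_complex_of_real Im_complex_of_real times_complex.sel(1) mult_zero_left diff_zero)
  also have "\<dots> \<le> exp (- e) * (1 - 1 / D)" using assms by (intro mult_left_mono) auto
  also have "\<dots> \<le> 1 * (1 - 1 / D)" using assms by (intro mult_right_mono) auto
  finally show ?thesis by simp
qed

lemma isCont_Pd1:
  assumes "Re (\<omega> * exp (- z)) < 1"
  shows "isCont (Pd 1) z"
proof -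
  have "1 - \<omega> * exp (- z) \<notin> \<real>\<^sub>\<le>\<^sub>0"
  proof
    assume "1 - \<omega> * exp (- z) \<in> \<real>\<^sub>\<le>\<^sub>0"
    then have "Re (1 - \<omega> * exp (- z)) \<le> 0" by (auto simp: complex_nonpos_Reals_iff)
    then show False using assms by (simp del: times_complex.sel)
  qed
  then have "isCont (\<lambda>z. Ln (1 - \<omega> * exp (- z))) z" by (intro continuous_intros)
  then show ?thesis by (simp add: Pd.simps[abs_def])
qed

lemma Pd0_tendsto_boundary:
  assumes "Re z \<ge> 0"
  shows "((\<lambda>e. Pd 0 (of_real e + z)) \<longlongrightarrow> Pd 0 z) (at_right 0)"
proof -
  have 1: "((\<lambda>e. \<omega> * exp (- (of_real e + z))) \<longlongrightarrow> \<omega> * exp (- (of_real 0 + z))) (at_right 0)"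
    by (intro tendsto_intros)
  have "((\<lambda>e. dilog (\<omega> * exp (- (of_real e + z)))) \<longlongrightarrow> dilog (\<omega> * exp (- z))) (at_right 0)"
  proof (rule continuous_on_tendsto_compose[OF continuous_on_dilog])
    show "((\<lambda>e. \<omega> * exp (- (of_real e + z))) \<longlongrightarrow> \<omega> * exp (- z)) (at_right 0)" using 1 by simp
    show "\<omega> * exp (- z) \<in> cball 0 1" using assms by (simp add: norm_omega_exp)
    show "\<forall>\<^sub>F e in at_right 0. \<omega> * exp (- (of_real e + z)) \<in> cball 0 1"
      using eventually_at_right_less[of "0::real"]
    proof eventually_elim
      case (elim e)
      have "norm (\<omega> * exp (- (of_real e + z))) \<le> 1" unfolding norm_omega_exp using assms elim by simp
      then show ?case by simp
    qed
  qed
  then show ?thesis by simp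
qed

text \<open>The ray is started at \<open>e > 0\<close>, then \<open>e\<close> tends to 0, by
  continuity of \<open>dilog\<close> on the closed disc, and finally \<open>K\<close> tends to
  infinity, where \<open>Pd 0\<close> vanishes. Odd multiples of \<tau> are exactly the midpoints of
  cells of length 2 \<tau> starting at 0.\<close>

lemma midpoint_limit:
  assumes tau: "Re \<tau> > 0" and D: "D \<ge> 1"
    and ray: "\<And>x. x \<ge> 0 \<Longrightarrow> Re (\<omega> * exp (- (of_real x * \<tau>))) \<le> 1 - 1 / D"
    and L: "(\<lambda>k. - Ln (1 - \<omega> * exp (- (of_nat (2*k+1) * \<tau>)))) sums L"
  shows "norm (2 * \<tau> * L - dilog \<omega>) \<le> D ^ 2 * norm \<tau> ^ 3 * (1 / (1 - exp (- 2 * Re \<tau>)))"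
proof -
  define B where "B = D ^ 2 * norm \<tau> ^ 3 * (1 / (1 - exp (- 2 * Re \<tau>)))"
  have fin: "norm (Pd 0 (of_nat (2 * K) * \<tau>) - Pd 0 0 - 2 * \<tau> * (\<Sum>k<K. Pd 1 (of_nat (2*k+1) * \<tau>))) \<le> B" for K
  proof (rule tendsto_upperbound)
    show "((\<lambda>e. norm (Pd 0 (of_real e + of_nat (2 * K) * \<tau>) - Pd 0 (of_real e + 0) - 2 * \<tau> * (\<Sum>k<K. Pd 1 (of_real e + of_nat (2*k+1) * \<tau>))))
       \<longlongrightarrow> norm (Pd 0 (of_nat (2 * K) * \<tau>) - Pd 0 0 - 2 * \<tau> * (\<Sum>k<K. Pd 1 (of_nat (2*k+1) * \<tau>)))) (at_right 0)"
    proof (intro tendsto_intros Pd0_tendsto_boundary)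
      fix k
      have "isCont (Pd 1) (of_nat (2*k+1) * \<tau>)"
      proof (rule isCont_Pd1)
        have "1 / D > 0" using D by simp
        then show "Re (\<omega> * exp (- (of_nat (2*k+1) * \<tau>))) < 1" using ray[of "of_nat (2*k+1)"]
          by (simp only: of_real_of_nat_eq) linarith
      qed
      then show "((\<lambda>e. Pd 1 (of_real e + of_nat (2*k+1) * \<tau>)) \<longlongrightarrow> Pd 1 (of_nat (2*k+1) * \<tau>)) (at_right 0)"
      proof (rule isCont_tendsto_compose)
        have "((\<lambda>e. of_real e + of_nat (2*k+1) * \<tau>) \<longlongrightarrow> of_real 0 + of_nat (2*k+1) * \<tau>) (at_right 0)"
          by (intro tendsto_intros)
        then show "((\<lambda>e. of_real e + of_nat (2*k+1) * \<tau>) \<longlongrightarrow> of_nat (2*k+1) * \<tau>) (at_right 0)" by simp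
      qed
    qed (use tau in auto)
    show "\<forall>\<^sub>F e in at_right 0. norm (Pd 0 (of_real e + of_nat (2 * K) * \<tau>) - Pd 0 (of_real e + 0) - 2 * \<tau> * (\<Sum>k<K. Pd 1 (of_real e + of_nat (2*k+1) * \<tau>))) \<le> B"
      using eventually_at_right_less[of "0::real"]
    proof eventually_elim
      case (elim e)
      have "norm (Pd 0 (of_real e + of_nat (2 * K) * \<tau>) - Pd 0 (of_real e) - 2 * \<tau> * (\<Sum>k<K. Pd 1 (of_real e + of_nat (2*k+1) * \<tau>))) \<le> B"
        unfolding B_def
        by (rule midpoint_rule[OF _ tau D ray_shift[OF ray D]]) (use elim in auto)
      then show ?case by simp
    qed
  qed auto
  have P1: "Pd 1 z = Ln (1 - \<omega> * exp (- z))" for z by simp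
  have "(\<lambda>K. norm (Pd 0 (0 + of_nat (2 * K) * \<tau>) - Pd 0 0 - 2 * \<tau> * (- (\<Sum>k<K. - Ln (1 - \<omega> * exp (- (of_nat (2*k+1) * \<tau>)))))))
     \<longlonglongrightarrow> norm (0 - Pd 0 0 - 2 * \<tau> * (- L))"
    using L unfolding sums_def by (intro tendsto_intros Pd0_tendsto_0 tau)
  then have "(\<lambda>K. norm (Pd 0 (of_nat (2 * K) * \<tau>) - Pd 0 0 - 2 * \<tau> * (\<Sum>k<K. Pd 1 (of_nat (2*k+1) * \<tau>))))
     \<longlonglongrightarrow> norm (0 - Pd 0 0 - 2 * \<tau> * (- L))"
    unfolding P1 by (simp only: sum_negf minus_minus add_0)
  then have "norm (0 - Pd 0 0 - 2 * \<tau> * (- L)) \<le> B"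
    by (rule tendsto_upperbound) (use fin in auto)
  moreover have "0 - Pd 0 0 - 2 * \<tau> * (- L) = 2 * \<tau> * L - dilog \<omega>" by simp
  ultimately show ?thesis unfolding B_def by simp
qed

text \<open>Taylor expansion of first order over half a cell, needed when the sample points are even
  multiples of \<tau>.\<close>

lemma dilog_near:
  assumes tau: "Re \<tau> > 0" and D: "D \<ge> 1"
    and ray: "\<And>x. x \<ge> 0 \<Longrightarrow> Re (\<omega> * exp (- (of_real x * \<tau>))) \<le> 1 - 1 / D"
  shows "norm (Pd 0 \<tau> - dilog \<omega> - \<tau> * Ln (1 - \<omega>)) \<le> D * norm \<tau> ^ 2"
proof -
  define B where "B = D * norm \<tau> ^ 2"
  have "norm (Pd 0 \<tau> - Pd 0 0 - \<tau> * Pd 1 0) \<le> B"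
  proof (rule tendsto_upperbound)
    show "((\<lambda>e. norm (Pd 0 (of_real e + \<tau>) - Pd 0 (of_real e + 0) - \<tau> * Pd 1 (of_real e)))
       \<longlongrightarrow> norm (Pd 0 \<tau> - Pd 0 0 - \<tau> * Pd 1 0)) (at_right 0)"
    proof (intro tendsto_intros Pd0_tendsto_boundary)
      have "1 / D > 0" using D by simp
      then have "Re (\<omega> * exp (- 0)) < 1" using ray[of 0] by (simp del: zero_less_divide_1_iff)
      from isCont_Pd1[OF this] show "((\<lambda>e. Pd 1 (of_real e)) \<longlongrightarrow> Pd 1 0) (at_right 0)"
      proof (rule isCont_tendsto_compose)
        have "(of_real \<longlongrightarrow> (of_real 0 :: complex)) (at_right 0)" by (intro tendsto_intros)
        then show "(of_real \<longlongrightarrow> (0 :: complex)) (at_right 0)" by simp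
      qed
    qed (use tau in auto)
    show "\<forall>\<^sub>F e in at_right 0. norm (Pd 0 (of_real e + \<tau>) - Pd 0 (of_real e + 0) - \<tau> * Pd 1 (of_real e)) \<le> B"
      using eventually_at_right_less[of "0::real"]
    proof eventually_elim
      case (elim e)
      define S where "S = (\<lambda>x. of_real e + of_real x * \<tau>) ` {0..1}"
      have conv: "convex S"
      proof -
        have "S = (+) (of_real e) ` ((\<lambda>x. x *\<^sub>R \<tau>) ` {0..1})" unfolding S_def image_image by (simp add: scaleR_conv_of_real)
        moreover have "convex ((\<lambda>x. x *\<^sub>R \<tau>) ` {0..1::real})"
          by (intro convex_linear_image bounded_linear.linear bounded_linear_scaleR_left convex_real_interval)
        ultimately show ?thesis using convex_translation by blast
      qed
      have S: "Re w > 0" "norm (Pd (Suc 1) w) \<le> D" if "w \<in> S" for w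
      proof -
        from that obtain x where x: "x \<in> {0..1}" "w = of_real e + of_real x * \<tau>" by (auto simp: S_def)
        have "x * Re \<tau> \<ge> 0" using x tau by auto
        then show w: "Re w > 0" using x elim by simp
        have "Re (\<omega> * exp (- w)) \<le> 1 - 1 / D" unfolding x(2)
          by (rule ray_shift[OF ray D]) (use x elim in auto)
        from Pd2_bound[OF this D] have "norm (Pd (Suc 1) w) \<le> D * exp (- Re w)" by simp
        also have "\<dots> \<le> D * 1" using w D by (intro mult_left_mono) auto
        finally show "norm (Pd (Suc 1) w) \<le> D" by simp
      qed
      have der: "(Pd i has_field_derivative Pd (Suc i) w) (at w within S)" if "w \<in> S" "i \<le> 1" for i w
        using S(1)[OF that(1)] that by (intro Pd_deriv) auto
      have zS: "of_real e \<in> S" "of_real e + \<tau> \<in> S"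
        unfolding S_def by (auto intro: image_eqI[of _ _ 0] image_eqI[of _ _ 1])
      have "norm (Pd 0 (of_real e + \<tau>) - (\<Sum>i\<le>1. Pd i (of_real e) * (of_real e + \<tau> - of_real e) ^ i / fact i)) \<le> D * norm (of_real e + \<tau> - of_real e) ^ Suc 1 / fact 1"
        by (rule complex_Taylor[OF conv der S(2) zS])
      moreover have "(\<Sum>i\<le>1. Pd i (of_real e) * (of_real e + \<tau> - of_real e) ^ i / fact i) = Pd 0 (of_real e) + \<tau> * Pd 1 (of_real e)"
        by simp
      ultimately show ?case unfolding B_def by (simp add: power2_eq_square algebra_simps)
    qed
  qed auto
  then show ?thesis by (simp add: B_def)
qed

text \<open>Even multiples of \<tau> are midpoints once the ray starts at \<tau>;
  \<open>dilog_near\<close> then moves the starting value back to the boundary, at the price of the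
  term with \<open>Ln (1 - \<omega>)\<close>.\<close>

lemma midpoint_limit_shifted:
  assumes tau: "Re \<tau> > 0" and D: "D \<ge> 1"
    and ray: "\<And>x. x \<ge> 0 \<Longrightarrow> Re (\<omega> * exp (- (of_real x * \<tau>))) \<le> 1 - 1 / D"
    and L: "(\<lambda>k. - Ln (1 - \<omega> * exp (- (of_nat (2*k+2) * \<tau>)))) sums L"
  shows "norm (2 * \<tau> * L - dilog \<omega> - \<tau> * Ln (1 - \<omega>)) \<le> D ^ 2 * norm \<tau> ^ 3 * (1 / (1 - exp (- 2 * Re \<tau>))) + D * norm \<tau> ^ 2"
proof -
  define B where "B = D ^ 2 * norm \<tau> ^ 3 * (1 / (1 - exp (- 2 * Re \<tau>)))"
  have fin: "norm (Pd 0 (\<tau> + of_nat (2 * K) * \<tau>) - Pd 0 \<tau> - 2 * \<tau> * (\<Sum>k<K. Pd 1 (\<tau> + of_nat (2*k+1) * \<tau>))) \<le> B" for K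
    unfolding B_def
  proof (rule midpoint_rule[OF tau tau D])
    fix x :: real assume "x \<ge> 0"
    have "\<tau> + of_real x * \<tau> = of_real (1 + x) * \<tau>" by (simp add: algebra_simps)
    then show "Re (\<omega> * exp (- (\<tau> + of_real x * \<tau>))) \<le> 1 - 1 / D"
      using ray[of "1 + x"] \<open>x \<ge> 0\<close> by simp
  qed
  have P1: "Pd 1 (\<tau> + of_nat (2*k+1) * \<tau>) = - (- Ln (1 - \<omega> * exp (- (of_nat (2*k+2) * \<tau>))))" for k
  proof -
    have "\<tau> + of_nat (2*k+1) * \<tau> = of_nat (2*k+2) * \<tau>" by (simp add: algebra_simps)
    then show ?thesis by simp
  qed
  have "(\<lambda>K. norm (Pd 0 (\<tau> + of_nat (2 * K) * \<tau>) - Pd 0 \<tau> - 2 * \<tau> * (- (\<Sum>k<K. - Ln (1 - \<omega> * exp (- (of_nat (2*k+2) * \<tau>)))))))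
     \<longlonglongrightarrow> norm (0 - Pd 0 \<tau> - 2 * \<tau> * (- L))"
    using L unfolding sums_def by (intro tendsto_intros Pd0_tendsto_0 tau)
  then have "(\<lambda>K. norm (Pd 0 (\<tau> + of_nat (2 * K) * \<tau>) - Pd 0 \<tau> - 2 * \<tau> * (\<Sum>k<K. Pd 1 (\<tau> + of_nat (2*k+1) * \<tau>))))
     \<longlonglongrightarrow> norm (0 - Pd 0 \<tau> - 2 * \<tau> * (- L))"
    unfolding P1 by (simp only: sum_negf)
  then have "norm (0 - Pd 0 \<tau> - 2 * \<tau> * (- L)) \<le> B"
    by (rule tendsto_upperbound) (use fin in auto)
  moreover have "2 * \<tau> * L - dilog \<omega> - \<tau> * Ln (1 - \<omega>) = (0 - Pd 0 \<tau> - 2 * \<tau> * (- L)) + (Pd 0 \<tau> - dilog \<omega> - \<tau> * Ln (1 - \<omega>))"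
    by (simp add: algebra_simps)
  ultimately show ?thesis
    using norm_triangle_le[OF add_mono[OF _ dilog_near[OF tau D ray]]] unfolding B_def by metis
qed

end

lemma sums_even_iff:
  fixes f :: "nat \<Rightarrow> 'a::real_normed_vector"
  shows "(\<lambda>m. if even m then f m else 0) sums x \<longleftrightarrow> (\<lambda>m. f (2 * m)) sums x"
proof -
  have "(\<lambda>m. (\<lambda>m. if even m then f m else 0) (2 * m)) sums x \<longleftrightarrow> (\<lambda>m. if even m then f m else 0) sums x"
    by (rule sums_mono_reindex) (auto simp: strict_mono_def elim!: evenE)
  then show ?thesis by simp
qed

lemma sums_odd_iff:
  fixes f :: "nat \<Rightarrow> 'a::real_normed_vector"
  shows "(\<lambda>m. if odd m then f m else 0) sums x \<longleftrightarrow> (\<lambda>m. f (2 * m + 1)) sums x"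
proof -
  have "(\<lambda>m. (\<lambda>m. if odd m then f m else 0) (2 * m + 1)) sums x \<longleftrightarrow> (\<lambda>m. if odd m then f m else 0) sums x"
    by (rule sums_mono_reindex) (auto simp: strict_mono_def elim!: oddE)
  then show ?thesis by simp
qed

lemma inverse_squares_sums_0: "(\<lambda>m. 1 / real m ^ 2) sums (pi\<^sup>2 / 6)"
  using inverse_squares_sums sums_Suc_iff[of "\<lambda>m. 1 / real m ^ 2" "pi\<^sup>2/6"] by (simp add: add.commute)

lemma even_inverse_squares_sums: "(\<lambda>m. if even m then 1 / real m ^ 2 else 0) sums (pi\<^sup>2 / 24)"
  unfolding sums_even_iff using sums_divide[OF inverse_squares_sums_0, of 4] by (simp add: power_mult_distrib mult.commute)

lemma dilog_minus_one: "dilog (-1) = of_real (- (pi\<^sup>2 / 12))"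
proof -
  have "(\<lambda>m. 2 * (if even m then 1 / real m ^ 2 else 0) - 1 / real m ^ 2) sums (2 * (pi\<^sup>2 / 24) - pi\<^sup>2 / 6)"
    by (intro sums_diff sums_mult even_inverse_squares_sums inverse_squares_sums_0)
  moreover have "2 * (if even m then 1 / real m ^ 2 else 0) - 1 / real m ^ 2 = (-1) ^ m / real m ^ 2" for m
    by (cases "even m") auto
  ultimately have "(\<lambda>m. (-1) ^ m / real m ^ 2) sums (- (pi\<^sup>2 / 12))" by simp
  from sums_of_real[OF this, where ?'a = complex] have "(\<lambda>m. (-1) ^ m / of_nat m ^ 2 :: complex) sums of_real (- (pi\<^sup>2 / 12))"
    by simp
  with dilog_sums[of "-1"] show ?thesis using sums_unique2 by fastforce
qed

text \<open>Real and imaginary part of 1 / cosh (x - i y), and below of 1 / sinh (x - i y), with the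
  squared modulus as denominator.\<close>

definition sech_re :: "real \<Rightarrow> real \<Rightarrow> real" where
  "sech_re x y = cosh x * cos y / ((sinh x)\<^sup>2 + (cos y)\<^sup>2)"
definition sech_im :: "real \<Rightarrow> real \<Rightarrow> real" where
  "sech_im x y = sinh x * sin y / ((sinh x)\<^sup>2 + (cos y)\<^sup>2)"
definition csch_re :: "real \<Rightarrow> real \<Rightarrow> real" where
  "csch_re x y = sinh x * cos y / ((sinh x)\<^sup>2 + (sin y)\<^sup>2)"
definition csch_im :: "real \<Rightarrow> real \<Rightarrow> real" where
  "csch_im x y = cosh x * sin y / ((sinh x)\<^sup>2 + (sin y)\<^sup>2)"

lemma reciprocal_Complex:
  fixes A B N :: real
  assumes "A * A + B * B = N" "N > 0"
  shows "1 / Complex (2 * A) (- 2 * B) = Complex (A / N / 2) (B / N / 2)"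
proof -
  have "Complex (2 * A) (- 2 * B) * Complex (A / N / 2) (B / N / 2) = 1"
    using assms by (simp add: complex_eq_iff flip: add_divide_distrib)
  then show ?thesis by (metis divide_eq_eq_1 eq_divide_eq mult.commute mult_zero_left one_neq_zero)
qed

lemma exp_fraction_plus:
  assumes "x > 0"
  shows "exp (Complex (-x) y) / (1 + exp (Complex (-x) y) ^ 2) = Complex (sech_re x y / 2) (sech_im x y / 2)"
proof -
  define E where "E = exp (Complex (-x) y)"
  define F where "F = exp (Complex x (-y))"
  have EF: "E * F = 1" 
  proof -
    have "Complex (-x) y + Complex x (-y) = 0" by (simp add: complex_eq_iff)
    then show ?thesis unfolding E_def F_def by (simp flip: exp_add)
  qed
  have E0: "E \<noteq> 0" by (simp add: E_def)
  have sh: "sinh x > 0" using assms by simp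
  have sum: "E + F = Complex (2 * cosh x * cos y) (- 2 * sinh x * sin y)"
    by (simp add: E_def F_def exp_eq_polar complex_eq_iff cosh_field_def sinh_field_def algebra_simps)
  have nz: "(sinh x)\<^sup>2 + (cos y)\<^sup>2 > 0" using sh by (simp add: add_pos_nonneg)
  have "E / (1 + E ^ 2) = 1 / (E + F)"
  proof -
    have "1 + E ^ 2 = E * (E + F)" using EF by (simp add: algebra_simps power2_eq_square)
    then show ?thesis using E0 by simp
  qed
  also have "\<dots> = Complex (sech_re x y / 2) (sech_im x y / 2)"
  proof -
    have "cosh x * cos y * (cosh x * cos y) + sinh x * sin y * (sinh x * sin y) = (cosh x)\<^sup>2 * (cos y)\<^sup>2 + (sinh x)\<^sup>2 * (sin y)\<^sup>2"
      by (simp add: power2_eq_square)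
    also have "\<dots> = (1 + (sinh x)\<^sup>2) * (cos y)\<^sup>2 + (sinh x)\<^sup>2 * (1 - (cos y)\<^sup>2)"
      by (simp add: cosh_square_eq sin_squared_eq add.commute)
    also have "\<dots> = (sinh x)\<^sup>2 + (cos y)\<^sup>2" by (simp add: algebra_simps)
    finally show ?thesis
      unfolding sum sech_re_def sech_im_def using reciprocal_Complex nz by (simp add: mult.assoc)
  qed
  finally show ?thesis by (simp add: E_def)
qed

lemma exp_fraction_minus:
  assumes "x > 0"
  shows "exp (Complex (-x) y) / (1 - exp (Complex (-x) y) ^ 2) = Complex (csch_re x y / 2) (csch_im x y / 2)"
proof -
  define E where "E = exp (Complex (-x) y)"
  define F where "F = exp (Complex x (-y))"
  have EF: "E * F = 1" 
  proof -
    have "Complex (-x) y + Complex x (-y) = 0" by (simp add: complex_eq_iff)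
    then show ?thesis unfolding E_def F_def by (simp flip: exp_add)
  qed
  have E0: "E \<noteq> 0" by (simp add: E_def)
  have sh: "sinh x > 0" using assms by simp
  have sum: "F - E = Complex (2 * sinh x * cos y) (- 2 * cosh x * sin y)"
    by (simp add: E_def F_def exp_eq_polar complex_eq_iff cosh_field_def sinh_field_def algebra_simps)
  have nz: "(sinh x)\<^sup>2 + (sin y)\<^sup>2 > 0" using sh by (simp add: add_pos_nonneg)
  have "E / (1 - E ^ 2) = 1 / (F - E)"
  proof -
    have "1 - E ^ 2 = E * (F - E)" using EF by (simp add: algebra_simps power2_eq_square)
    then show ?thesis using E0 by simp
  qed
  also have "\<dots> = Complex (csch_re x y / 2) (csch_im x y / 2)"
  proof -
    have "sinh x * cos y * (sinh x * cos y) + cosh x * sin y * (cosh x * sin y) = (sinh x)\<^sup>2 * (cos y)\<^sup>2 + (cosh x)\<^sup>2 * (sin y)\<^sup>2"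
      by (simp add: power2_eq_square)
    also have "\<dots> = (sinh x)\<^sup>2 * (1 - (sin y)\<^sup>2) + (1 + (sinh x)\<^sup>2) * (sin y)\<^sup>2"
      by (simp add: cosh_square_eq cos_squared_eq add.commute)
    also have "\<dots> = (sinh x)\<^sup>2 + (sin y)\<^sup>2" by (simp add: algebra_simps)
    finally show ?thesis
      unfolding sum csch_re_def csch_im_def using reciprocal_Complex nz by (simp add: mult.assoc)
  qed
  finally show ?thesis by (simp add: E_def)
qed

section \<open>Even and odd part of the logarithm\<close>

definition Lo :: "complex \<Rightarrow> complex" where
  "Lo q = (\<Sum>m. if odd m then q ^ m / (of_nat m * (1 + (q ^ m)\<^sup>2)) else 0)"
definition Le :: "complex \<Rightarrow> complex" where
  "Le q = (\<Sum>m. if even m then q ^ m / (of_nat m * (1 - (q ^ m)\<^sup>2)) else 0)"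

lemma Lq_term:
  fixes q :: complex
  shows "q ^ m / (of_nat m * (1 - (- (q\<^sup>2)) ^ m)) =
   (if odd m then q ^ m / (of_nat m * (1 + (q ^ m)\<^sup>2)) else q ^ m / (of_nat m * (1 - (q ^ m)\<^sup>2)))"
proof -
  have "(- (q\<^sup>2)) ^ m = (- 1) ^ m * (q ^ m)\<^sup>2"
    by (simp add: power_minus[of "q\<^sup>2"] mult.commute flip: power_mult)
  then show ?thesis by auto
qed

lemma summable_Lq_parts:
  fixes q :: complex
  assumes "norm q < 1"
  shows "summable (\<lambda>m. if P m then q ^ m / (of_nat m * (1 - (- (q\<^sup>2)) ^ m)) else 0)"
proof (rule summable_comparison_test')
  have p: "norm (- (q\<^sup>2)) < 1" using assms by (simp add: norm_power power_less_one_iff)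
  show "summable (\<lambda>m. norm q ^ m / (1 - norm (- (q\<^sup>2))))"
    using assms by (intro summable_divide summable_geometric) auto
  show "norm (if P m then q ^ m / (of_nat m * (1 - (- (q\<^sup>2)) ^ m)) else 0) \<le> norm q ^ m / (1 - norm (- (q\<^sup>2)))" for m
    using qlog_term_bound[OF p, of q m] p by auto
qed

lemma Lo_sums:
  assumes "norm q < 1"
  shows "(\<lambda>m. if odd m then q ^ m / (of_nat m * (1 + (q ^ m)\<^sup>2)) else 0) sums Lo q"
proof -
  have "(\<lambda>m. if odd m then q ^ m / (of_nat m * (1 + (q ^ m)\<^sup>2)) else 0) =
     (\<lambda>m. if odd m then q ^ m / (of_nat m * (1 - (- (q\<^sup>2)) ^ m)) else 0)"
    by (rule ext) (simp only: Lq_term split: if_splits, simp)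
  then show ?thesis unfolding Lo_def using summable_sums[OF summable_Lq_parts[OF assms]] by simp
qed

lemma Le_sums:
  assumes "norm q < 1"
  shows "(\<lambda>m. if even m then q ^ m / (of_nat m * (1 - (q ^ m)\<^sup>2)) else 0) sums Le q"
proof -
  have "(\<lambda>m. if even m then q ^ m / (of_nat m * (1 - (q ^ m)\<^sup>2)) else 0) =
     (\<lambda>m. if even m then q ^ m / (of_nat m * (1 - (- (q\<^sup>2)) ^ m)) else 0)"
    by (rule ext) (simp only: Lq_term split: if_splits, simp)
  then show ?thesis unfolding Le_def using summable_sums[OF summable_Lq_parts[OF assms]] by simp
qed

lemma Lq_split:
  assumes "norm q < 1"
  shows "Lq q = Le q + Lo q"
proof -
  have p: "norm (- (q\<^sup>2)) < 1" using assms by (simp add: norm_power power_less_one_iff)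
  have "(\<lambda>m. q ^ m / (of_nat m * (1 - (- (q\<^sup>2)) ^ m))) sums Lq q"
    unfolding Lq_def by (rule qlog_sums[OF assms p])
  moreover have "(\<lambda>m. (if even m then q ^ m / (of_nat m * (1 - (q ^ m)\<^sup>2)) else 0) +
     (if odd m then q ^ m / (of_nat m * (1 + (q ^ m)\<^sup>2)) else 0)) sums (Le q + Lo q)"
    by (intro sums_add Le_sums Lo_sums assms)
  moreover have "(if even m then q ^ m / (of_nat m * (1 - (q ^ m)\<^sup>2)) else 0) +
     (if odd m then q ^ m / (of_nat m * (1 + (q ^ m)\<^sup>2)) else 0) = q ^ m / (of_nat m * (1 - (- (q\<^sup>2)) ^ m))" for m
    by (simp only: Lq_term split: if_splits, simp)
  ultimately show ?thesis using sums_unique2 by fastforce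
qed

lemma Le_uminus: "Le (- q) = Le q" and Lo_uminus: "Lo (- q) = - Lo q" if "norm q < 1"
proof -
  show "Le (- q) = Le q" unfolding Le_def by (intro suminf_cong) simp
  have "(\<lambda>m. - (if odd m then q ^ m / (of_nat m * (1 + (q ^ m)\<^sup>2)) else 0)) sums (- Lo q)"
    by (intro sums_minus Lo_sums that)
  moreover have "- (if odd m then q ^ m / (of_nat m * (1 + (q ^ m)\<^sup>2)) else 0) =
     (if odd m then (- q) ^ m / (of_nat m * (1 + ((- q) ^ m)\<^sup>2)) else 0)" for m by simp
  ultimately show "Lo (- q) = - Lo q" unfolding Lo_def by (simp add: sums_iff)
qed

text \<open>By \<open>z / (1 - z\<^sup>2) = z / (1 - z) - z\<^sup>2 / (1 - z\<^sup>2)\<close> the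
  series of \<open>2 * Le q\<close> is that of \<open>qlog x x\<close> minus twice its even-indexed
  part, for \<open>x = q\<^sup>2\<close>, which is \<open>- qlog (- x) x\<close>. So the even part
  is again the logarithm of a product, and the midpoint rule applies to it.\<close>

lemma Le_Ln_sums:
  assumes q: "norm q < 1"
  shows "(\<lambda>k. - Ln (1 + q ^ (2*k+2))) sums (- 2 * Le q)"
proof -
  define x where "x = q\<^sup>2"
  have x: "norm x < 1" using q by (simp add: x_def norm_power power_less_one_iff)
  define X where "X l = x ^ l / (1 - x ^ l)" for l
  have A: "(\<lambda>l. X l / of_nat l) sums qlog x x"
    using qlog_sums[OF x x] by (simp add: X_def field_simps)
  have A': "(\<lambda>l. (- 1) ^ l * (X l / of_nat l)) sums qlog (- x) x"
  proof -
    have "(- x) ^ l / (of_nat l * (1 - x ^ l)) = (- 1) ^ l * (X l / of_nat l)" for l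
      unfolding X_def by (subst power_minus) (simp add: field_simps)
    then show ?thesis using qlog_sums[of "-x" x] x by simp
  qed
  have "(\<lambda>l. (X l / of_nat l + (- 1) ^ l * (X l / of_nat l)) / 2) sums ((qlog x x + qlog (- x) x) / 2)"
    by (intro sums_divide sums_add A A')
  moreover have "(X l / of_nat l + (- 1) ^ l * (X l / of_nat l)) / 2 = (if even l then X l / of_nat l else 0)" for l
    by (cases "even l") auto
  ultimately have "(\<lambda>l. if even l then X l / of_nat l else 0) sums ((qlog x x + qlog (- x) x) / 2)" by simp
  then have E: "(\<lambda>l. X (2 * l) / of_nat (2 * l)) sums ((qlog x x + qlog (- x) x) / 2)"
    unfolding sums_even_iff .
  have "(\<lambda>l. X l / of_nat l - 2 * (X (2 * l) / of_nat (2 * l))) sums (qlog x x - 2 * ((qlog x x + qlog (- x) x) / 2))"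
    by (intro sums_diff sums_mult A E)
  moreover have "X l / of_nat l - 2 * (X (2 * l) / of_nat (2 * l)) = x ^ l / (of_nat l * (1 - (x ^ l)\<^sup>2))" for l
  proof (cases "l = 0")
    case False
    have n: "norm (x ^ l) < 1" using x False by (simp add: norm_power power_less_one_iff)
    have 1: "1 - x ^ l \<noteq> 0" using n by auto
    have "norm ((x ^ l)\<^sup>2) < 1" using n by (simp add: norm_power power_less_one_iff)
    then have 2: "1 - (x ^ l)\<^sup>2 \<noteq> 0" by auto
    have "x ^ (2 * l) = (x ^ l)\<^sup>2" by (simp add: mult.commute flip: power_mult)
    moreover have "z / (1 - z) - z\<^sup>2 / (1 - z\<^sup>2) = z / (1 - z\<^sup>2)" if "1 - z \<noteq> 0" "1 - z\<^sup>2 \<noteq> 0" for z :: complex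
    proof -
      have "z\<^sup>2 \<noteq> 1" using that by auto
      have f: "1 - z\<^sup>2 = (1 - z) * (1 + z)" by (simp add: algebra_simps power2_eq_square)
      then have "1 + z \<noteq> 0" using that by auto
      then show ?thesis unfolding f using that by (simp add: divide_simps) (simp add: algebra_simps power2_eq_square)
    qed
    from this[OF 1 2] have "X l - X (2 * l) = x ^ l / (1 - (x ^ l)\<^sup>2)"
      unfolding X_def \<open>x ^ (2 * l) = (x ^ l)\<^sup>2\<close> .
    moreover have "X l / of_nat l - 2 * (X (2 * l) / of_nat (2 * l)) = (X l - X (2 * l)) / of_nat l"
      using False by (simp add: field_simps)
    ultimately show ?thesis by (simp add: mult.commute)
  qed (simp add: X_def)
  ultimately have "(\<lambda>l. x ^ l / (of_nat l * (1 - (x ^ l)\<^sup>2))) sums (- qlog (- x) x)" by (simp add: field_simps)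
  moreover have "(\<lambda>m. 2 * (q ^ (2 * m) / (of_nat (2 * m) * (1 - (q ^ (2 * m))\<^sup>2)))) sums (2 * Le q)"
    using Le_sums[OF q] unfolding sums_even_iff by (rule sums_mult)
  moreover have "2 * (q ^ (2 * m) / (of_nat (2 * m) * (1 - (q ^ (2 * m))\<^sup>2))) = x ^ m / (of_nat m * (1 - (x ^ m)\<^sup>2))" for m
  proof -
    have "2 * (A / (of_nat (2 * m) * B)) = A / (of_nat m * B)" for A B :: complex
      by (cases "m = 0") (simp_all add: divide_simps)
    then show ?thesis by (simp add: x_def flip: power_mult)
  qed
  ultimately have "2 * Le q = - qlog (- x) x" using sums_unique2 by fastforce
  then have "- 2 * Le q = qlog (- x) x" by simp
  moreover have "(\<lambda>k. - Ln (1 - (- x) * x ^ k)) sums qlog (- x) x"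
    by (rule qlog_Ln_sums) (use x in auto)
  moreover have "1 - (- x) * x ^ k = 1 + q ^ (2*k+2)" for k
    by (simp add: x_def power2_eq_square flip: power_mult power_mult_distrib) (simp add: power_mult power2_eq_square power_mult_distrib power_add)
  ultimately show ?thesis by simp
qed

section \<open>Termwise bounds near \<theta> = 0\<close>

lemma sinh_ge_self: "x \<le> sinh x" if "x \<ge> 0" for x :: real
  using real_le_x_sinh[OF that] by (simp add: sinh_field_def exp_minus)

lemma one_minus_cos_le: "1 - cos y \<le> y\<^sup>2 / 2" for y :: real
proof -
  have "\<bar>sin (y / 2)\<bar> \<le> \<bar>y / 2\<bar>" by (rule abs_sin_x_le_abs_x)
  then have "(sin (y / 2))\<^sup>2 \<le> (y / 2)\<^sup>2" by (rule abs_le_square_iff[THEN iffD1])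
  moreover have "cos y = 1 - 2 * (sin (y / 2))\<^sup>2" using cos_double_sin[of "y / 2"] by simp
  ultimately show ?thesis by (simp add: power_divide)
qed

lemma inverse_cosh_le: "1 / cosh x \<le> 2 * exp (- x)" for x :: real
proof -
  have "exp x \<le> 2 * cosh x" by (simp add: cosh_field_def)
  then have "1 / (2 * cosh x) \<le> 1 / exp x" by (intro divide_left_mono) (auto intro!: mult_pos_pos)
  then show ?thesis by (simp add: exp_minus field_simps)
qed

lemma fraction_diff_inverse:
  fixes h c N :: real
  assumes "h > 0" "N > 0"
  shows "h * c / N - 1 / h = (h\<^sup>2 * c - N) / (h * N)"
  using assms by (simp add: field_simps power2_eq_square)

text \<open>With c = cos y and s = sinh x, subtracting the value at \<open>y = 0\<close> leaves the
  numerator (1 - c) (c - s^2). The first factor is at most y^2 / 2, and 2 s c is at most s^2 +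
  c^2.\<close>

lemma sech_re_upper:
  assumes x: "x > 0"
  shows "sech_re x y \<le> 1 / cosh x + y\<^sup>2 / (4 * x * cosh x)"
proof (cases "cos y \<le> 0")
  case True
  have "sech_re x y \<le> 0" unfolding sech_re_def using True
    by (intro divide_nonpos_nonneg mult_nonneg_nonpos) auto
  moreover have "0 \<le> 1 / cosh x + y\<^sup>2 / (4 * x * cosh x)" using x by auto
  ultimately show ?thesis by linarith
next
  case False
  define c s h where "c = cos y" and "s = sinh x" and "h = cosh x"
  have c: "0 < c" "c \<le> 1" using False by (auto simp: c_def)
  have s: "x \<le> s" "0 < s" using sinh_ge_self[of x] x by (auto simp: s_def)
  have h: "h > 0" "h\<^sup>2 = 1 + s\<^sup>2" by (auto simp: h_def s_def cosh_square_eq)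
  have N: "s\<^sup>2 + c\<^sup>2 > 0" using s by (simp add: add_pos_nonneg)
  have "h * c / (s\<^sup>2 + c\<^sup>2) - 1 / h = (h\<^sup>2 * c - (s\<^sup>2 + c\<^sup>2)) / (h * (s\<^sup>2 + c\<^sup>2))"
    by (rule fraction_diff_inverse[OF h(1) N])
  also have "h\<^sup>2 * c - (s\<^sup>2 + c\<^sup>2) = (1 - c) * (c - s\<^sup>2)" unfolding h(2) by (simp add: algebra_simps power2_eq_square)
  also have "(1 - c) * (c - s\<^sup>2) / (h * (s\<^sup>2 + c\<^sup>2)) \<le> (1 - c) * c / (h * (s\<^sup>2 + c\<^sup>2))"
    using c N h by (intro divide_right_mono mult_left_mono) auto
  also have "\<dots> = (1 - c) / h * (c / (s\<^sup>2 + c\<^sup>2))" by simp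
  also have "\<dots> \<le> (y\<^sup>2 / 2) / h * (1 / (2 * x))"
  proof (intro mult_mono divide_right_mono)
    show "1 - c \<le> y\<^sup>2 / 2" unfolding c_def by (rule one_minus_cos_le)
    have "2 * x * c \<le> 2 * s * c" using s c by simp
    also have "\<dots> \<le> s\<^sup>2 + c\<^sup>2" by (rule sum_squares_bound)
    finally show "c / (s\<^sup>2 + c\<^sup>2) \<le> 1 / (2 * x)" using N x by (simp add: field_simps)
  qed (use c h N in auto)
  also have "\<dots> = y\<^sup>2 / (4 * x * h)" by simp
  finally show ?thesis unfolding sech_re_def c_def s_def h_def by simp
qed

text \<open>For nonnegative cosine the numerator of \<open>sech_re_upper\<close> is used again. A
  negative cosine forces \<open>y \<ge> pi / 2\<close>, hence \<open>x \<ge> 1/2\<close>, and then a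
  crude bound is enough.\<close>

lemma sech_re_lower:
  assumes x: "x > 0" and y: "0 \<le> y" "y \<le> 3 * x"
  shows "1 / cosh x - (5/4) * y\<^sup>2 / cosh x \<le> sech_re x y"
proof -
  define c s h where "c = cos y" and "s = sinh x" and "h = cosh x"
  have s: "x \<le> s" "0 < s" using sinh_ge_self[of x] x by (auto simp: s_def)
  have h: "h > 0" "h\<^sup>2 = 1 + s\<^sup>2" by (auto simp: h_def s_def cosh_square_eq)
  have N: "s\<^sup>2 + c\<^sup>2 > 0" using s by (simp add: add_pos_nonneg)
  have c1: "c \<le> 1" "-1 \<le> c" by (auto simp: c_def)
  have "1 / h - h * c / (s\<^sup>2 + c\<^sup>2) \<le> (5/4) * y\<^sup>2 / h"
  proof (cases "c \<ge> 0")
    case True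
    have "1 / h - h * c / (s\<^sup>2 + c\<^sup>2) = - ((h\<^sup>2 * c - (s\<^sup>2 + c\<^sup>2)) / (h * (s\<^sup>2 + c\<^sup>2)))"
      using fraction_diff_inverse[OF h(1) N, of c] by linarith
    also have "\<dots> = (s\<^sup>2 + c\<^sup>2 - h\<^sup>2 * c) / (h * (s\<^sup>2 + c\<^sup>2))"
      by (simp add: minus_divide_left del: minus_divide_right)
    also have "s\<^sup>2 + c\<^sup>2 - h\<^sup>2 * c = (1 - c) * (s\<^sup>2 - c)" unfolding h(2) by (simp add: algebra_simps power2_eq_square)
    also have "(1 - c) * (s\<^sup>2 - c) / (h * (s\<^sup>2 + c\<^sup>2)) \<le> (1 - c) * (s\<^sup>2 + c\<^sup>2) / (h * (s\<^sup>2 + c\<^sup>2))"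
    proof (intro divide_right_mono mult_left_mono)
      show "s\<^sup>2 - c \<le> s\<^sup>2 + c\<^sup>2" using True zero_le_power2[of c] by linarith
    qed (use c1 h N in auto)
    also have "\<dots> = (1 - c) / h" using s by (intro nonzero_mult_divide_mult_cancel_right) simp
    also have "\<dots> \<le> (y\<^sup>2 / 2) / h" using h one_minus_cos_le[of y] by (intro divide_right_mono) (auto simp: c_def)
    also have "\<dots> \<le> (5/4) * y\<^sup>2 / h" using h by (intro divide_right_mono) auto
    finally show ?thesis .
  next
    case False
    have y2: "y \<ge> pi / 2"
    proof (rule ccontr)
      assume "\<not> pi / 2 \<le> y"
      then have "cos y \<ge> 0" using y by (intro cos_ge_zero) auto
      then show False using False by (simp add: c_def)
    qed
    then have y3: "y \<ge> 157/100" using pi_approx by simp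
    then have x2: "x \<ge> 1/2" using y by linarith
    have "- c / (s\<^sup>2 + c\<^sup>2) \<le> 1"
    proof -
      have "- c * 1 \<le> - c * (2 * s)" using s x2 False by (intro mult_left_mono) auto
      also have "\<dots> \<le> s\<^sup>2 + c\<^sup>2" using sum_squares_bound[of s "-c"] by (simp add: mult_ac)
      finally show ?thesis using N by (simp add: field_simps)
    qed
    moreover have "h\<^sup>2 * (- c / (s\<^sup>2 + c\<^sup>2)) = - c / (s\<^sup>2 + c\<^sup>2) + s\<^sup>2 * (- c) / (s\<^sup>2 + c\<^sup>2)"
      unfolding h(2) by (simp add: distrib_right add_divide_distrib)
    moreover have "s\<^sup>2 * (- c) / (s\<^sup>2 + c\<^sup>2) \<le> 1"
    proof -
      have "s\<^sup>2 * (- c) \<le> s\<^sup>2 * 1" using c1 by (intro mult_left_mono) auto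
      then have "s\<^sup>2 * (- c) \<le> s\<^sup>2 + c\<^sup>2" using zero_le_power2[of c] by linarith
      then show ?thesis using N by (simp add: field_simps)
    qed
    ultimately have "h\<^sup>2 * (- c / (s\<^sup>2 + c\<^sup>2)) \<le> 2" by linarith
    then have "1 + h\<^sup>2 * (- c / (s\<^sup>2 + c\<^sup>2)) \<le> 3" by linarith
    \<comment> \<open>This case fixes the factor 5/4: 5/4 * 1.57^2 is about 3.08.\<close>
    also have "3 \<le> (5/4) * y\<^sup>2"
      using mult_mono[OF y3 y3] y by (simp add: power2_eq_square)
    finally have "(1 + h\<^sup>2 * (- c / (s\<^sup>2 + c\<^sup>2))) / h \<le> (5/4) * y\<^sup>2 / h" using h by (intro divide_right_mono) auto
    moreover have "(1 + h\<^sup>2 * (- c / (s\<^sup>2 + c\<^sup>2))) / h = 1 / h - h * c / (s\<^sup>2 + c\<^sup>2)"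
      using h by (simp add: field_simps power2_eq_square)
    ultimately show ?thesis by simp
  qed
  then show ?thesis unfolding sech_re_def c_def s_def h_def by simp
qed

lemma sech_im_bound:
  assumes x: "x > 0" and y: "0 \<le> y" "y \<le> x / 2"
  shows "\<bar>sech_im x y\<bar> \<le> (4/3) * y / cosh x"
proof -
  define s h where "s = sinh x" and "h = cosh x"
  have s: "x \<le> s" "0 < s" using sinh_ge_self[of x] x by (auto simp: s_def)
  have h: "h > 0" "h\<^sup>2 = 1 + s\<^sup>2" "s \<le> h" by (auto simp: h_def s_def cosh_square_eq sinh_le_cosh_real)
  have siny: "\<bar>sin y\<bar> \<le> y" using abs_sin_x_le_abs_x[of y] y by simp
  have "(sin y)\<^sup>2 \<le> y\<^sup>2" using siny y by (metis abs_le_square_iff abs_of_nonneg)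
  also have "\<dots> \<le> (h / 2)\<^sup>2" using y s h by (intro power_mono) auto
  finally have "(sin y)\<^sup>2 \<le> h\<^sup>2 / 4" by (simp add: power_divide)
  moreover have "s\<^sup>2 + (cos y)\<^sup>2 = h\<^sup>2 - (sin y)\<^sup>2" by (simp add: h(2) cos_squared_eq)
  ultimately have N: "s\<^sup>2 + (cos y)\<^sup>2 \<ge> (3/4) * h\<^sup>2" by simp
  have Np: "(3/4) * h\<^sup>2 > 0" using h(1) by simp
  have "\<bar>sech_im x y\<bar> = s * \<bar>sin y\<bar> / (s\<^sup>2 + (cos y)\<^sup>2)"
    unfolding sech_im_def s_def[symmetric] using s by (simp add: abs_mult abs_divide)
  also have "\<dots> \<le> h * y / ((3/4) * h\<^sup>2)"
    using siny s h N Np y by (intro frac_le mult_mono) auto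
  also have "\<dots> = (4/3) * y / h" using h(1) by (simp add: field_simps power2_eq_square)
  finally show ?thesis by (simp add: h_def)
qed

lemma odd_exp_sums:
  fixes t :: real
  assumes "t > 0"
  shows "(\<lambda>m. if odd m then exp (- (real m * t)) else 0) sums (1 / (2 * sinh t))"
  unfolding sums_odd_iff
proof -
  have l: "norm (exp (- 2 * t)) < 1" using assms by simp
  have "(\<lambda>k. exp (- t) * exp (- 2 * t) ^ k) sums (exp (- t) * (1 / (1 - exp (- 2 * t))))"
    by (intro sums_mult geometric_sums l)
  moreover have "exp (- t) * exp (- 2 * t) ^ k = exp (- (real (2 * k + 1) * t))" for k
    by (simp add: exp_of_nat_mult[symmetric] algebra_simps flip: exp_add)
  moreover have "exp (- t) * (1 / (1 - exp (- 2 * t))) = 1 / (2 * sinh t)"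
  proof -
    have "exp (- 2 * t) = exp (- t) * exp (- t)" by (simp flip: exp_add)
    then have "1 - exp (- 2 * t) = exp (- t) * (exp t - exp (- t))"
      by (simp add: right_diff_distrib flip: exp_add)
    moreover have "exp t - exp (- t) = 2 * sinh t" by (simp add: sinh_field_def)
    ultimately show ?thesis by simp
  qed
  ultimately show "(\<lambda>m. exp (- (real (2 * m + 1) * t))) sums (1 / (2 * sinh t))" by simp
qed

lemma weighted_exp_sums:
  fixes t :: real
  assumes "t > 0"
  obtains S where "(\<lambda>m. real m * exp (- (real m * t))) sums S" "S \<le> 1 / t\<^sup>2"
proof
  define x where "x = exp (- t)"
  have x: "0 < x" "x < 1" using assms by (auto simp: x_def)
  have "(\<lambda>m. x * (of_nat (Suc m) * x ^ m)) sums (x * (1 / (1 - x)\<^sup>2))"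
    using x by (intro sums_mult geometric_deriv_sums) auto
  then have "(\<lambda>m. real (Suc m) * x ^ Suc m) sums (x / (1 - x)\<^sup>2)" by (simp add: mult_ac)
  then have "(\<lambda>m. real m * x ^ m) sums (x / (1 - x)\<^sup>2)" by (subst (asm) sums_Suc_iff) simp
  moreover have "x ^ m = exp (- (real m * t))" for m
    unfolding x_def by (simp add: exp_of_nat_mult[symmetric])
  ultimately show "(\<lambda>m. real m * exp (- (real m * t))) sums (x / (1 - x)\<^sup>2)" by simp
  have "x = exp (- t / 2) * exp (- t / 2)" by (simp add: x_def flip: exp_add)
  moreover have "1 - x = exp (- t / 2) * (2 * sinh (t / 2))"
  proof -
    have "exp (- t / 2) * exp (t / 2) = 1" by (simp flip: exp_add)
    moreover have "2 * sinh (t / 2) = exp (t / 2) - exp (- t / 2)" by (simp add: sinh_field_def)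
    ultimately show ?thesis using \<open>x = exp (- t / 2) * exp (- t / 2)\<close> by (simp add: right_diff_distrib)
  qed
  ultimately have "x / (1 - x)\<^sup>2 = 1 / (2 * sinh (t / 2))\<^sup>2" by (simp add: power_mult_distrib power2_eq_square)
  also have "\<dots> \<le> 1 / t\<^sup>2"
    using sinh_ge_self[of "t / 2"] assms by (intro divide_left_mono power_mono mult_pos_pos) auto
  finally show "x / (1 - x)\<^sup>2 \<le> 1 / t\<^sup>2" .
qed

definition qt :: "real \<Rightarrow> real \<Rightarrow> complex" where
  "qt t \<theta> = exp (Complex (- t) \<theta>)"

lemma norm_qt: "norm (qt t \<theta>) = exp (- t)" by (simp add: qt_def)

lemma qt_power: "qt t \<theta> ^ m = exp (Complex (- (real m * t)) (real m * \<theta>))"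
proof -
  have "of_nat m * Complex (- t) \<theta> = Complex (- (real m * t)) (real m * \<theta>)" by (simp add: complex_eq_iff)
  then show ?thesis unfolding qt_def by (metis exp_of_nat_mult)
qed

lemma qt_eq: "qt t \<theta> = of_real (exp (- t)) * cis \<theta>"
  by (simp add: qt_def exp_eq_polar)

lemma Lo_term:
  assumes "t > 0" "odd m"
  shows "qt t \<theta> ^ m / (of_nat m * (1 + (qt t \<theta> ^ m)\<^sup>2)) =
    Complex (sech_re (real m * t) (real m * \<theta>) / (2 * real m)) (sech_im (real m * t) (real m * \<theta>) / (2 * real m))"
proof -
  have m: "m > 0" using assms by (auto elim: oddE)
  have "qt t \<theta> ^ m / (of_nat m * (1 + (qt t \<theta> ^ m)\<^sup>2)) = (qt t \<theta> ^ m / (1 + (qt t \<theta> ^ m)\<^sup>2)) / of_nat m" by simp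
  also have "qt t \<theta> ^ m / (1 + (qt t \<theta> ^ m)\<^sup>2) = Complex (sech_re (real m * t) (real m * \<theta>) / 2) (sech_im (real m * t) (real m * \<theta>) / 2)"
    unfolding qt_power using assms m by (intro exp_fraction_plus) auto
  finally show ?thesis by (simp add: complex_eq_iff)
qed

lemma Le_term:
  assumes "t > 0" "m > 0"
  shows "qt t \<theta> ^ m / (of_nat m * (1 - (qt t \<theta> ^ m)\<^sup>2)) =
    Complex (csch_re (real m * t) (real m * \<theta>) / (2 * real m)) (csch_im (real m * t) (real m * \<theta>) / (2 * real m))"
proof -
  have "qt t \<theta> ^ m / (of_nat m * (1 - (qt t \<theta> ^ m)\<^sup>2)) = (qt t \<theta> ^ m / (1 - (qt t \<theta> ^ m)\<^sup>2)) / of_nat m" by simp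
  also have "qt t \<theta> ^ m / (1 - (qt t \<theta> ^ m)\<^sup>2) = Complex (csch_re (real m * t) (real m * \<theta>) / 2) (csch_im (real m * t) (real m * \<theta>) / 2)"
    unfolding qt_power using assms by (intro exp_fraction_minus) auto
  finally show ?thesis by (simp add: complex_eq_iff)
qed

lemma Lo_Re_sums:
  assumes "t > 0"
  shows "(\<lambda>m. if odd m then sech_re (real m * t) (real m * \<theta>) / (2 * real m) else 0) sums Re (Lo (qt t \<theta>))"
proof -
  have "norm (qt t \<theta>) < 1" using assms by (simp add: norm_qt)
  from sums_Re[OF Lo_sums[OF this]] show ?thesis
    by (rule sums_cong[THEN iffD1, rotated]) (simp add: Lo_term[OF assms])
qed

lemma Lo_Im_sums:
  assumes "t > 0"
  shows "(\<lambda>m. if odd m then sech_im (real m * t) (real m * \<theta>) / (2 * real m) else 0) sums Im (Lo (qt t \<theta>))"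
proof -
  have "norm (qt t \<theta>) < 1" using assms by (simp add: norm_qt)
  from sums_Im[OF Lo_sums[OF this]] show ?thesis
    by (rule sums_cong[THEN iffD1, rotated]) (simp add: Lo_term[OF assms])
qed

lemma Le_Re_sums:
  assumes "t > 0"
  shows "(\<lambda>m. if even m then csch_re (real m * t) (real m * \<theta>) / (2 * real m) else 0) sums Re (Le (qt t \<theta>))"
proof -
  have "norm (qt t \<theta>) < 1" using assms by (simp add: norm_qt)
  from sums_Re[OF Le_sums[OF this]] show ?thesis
  proof (rule sums_cong[THEN iffD1, rotated])
    fix m show "Re (if even m then qt t \<theta> ^ m / (of_nat m * (1 - (qt t \<theta> ^ m)\<^sup>2)) else 0) = (if even m then csch_re (real m * t) (real m * \<theta>) / (2 * real m) else 0)"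
      by (cases "m = 0") (simp_all add: Le_term[OF assms])
  qed
qed

definition Lo0 :: "real \<Rightarrow> real" where "Lo0 t = Re (Lo (qt t 0))"

lemma sech_re_0: "sech_re x 0 = 1 / cosh x"
  by (simp add: sech_re_def flip: cosh_square_eq) (simp add: power2_eq_square)

text \<open>The hyperbolic cosine cuts the odd harmonic series off near \<open>m = 1 / t\<close>;
  this is the source of the logarithmic growth of \<open>Lo0\<close>.\<close>

lemma Lo0_sums:
  assumes "t > 0"
  shows "(\<lambda>m. if odd m then 1 / (2 * real m * cosh (real m * t)) else 0) sums Lo0 t"
  using Lo_Re_sums[OF assms, of 0] by (simp add: Lo0_def sech_re_0 mult_ac cong: if_cong)

text \<open>At the angle \<open>u * t\<close> the correction of term \<open>m\<close> is
  proportional to \<open>u\<^sup>2 * t / cosh (m * t)\<close>, and the sum over odd \<open>m\<close>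
  is bounded independently of \<open>t\<close>.\<close>

lemma Lo_Re_upper:
  assumes t: "t > 0"
  shows "Re (Lo (qt t (u * t))) \<le> Lo0 t + u\<^sup>2 / 8"
proof -
  have "Re (Lo (qt t (u * t))) \<le> Lo0 t + u\<^sup>2 * t / 4 * (1 / (2 * sinh t))"
  proof (rule sums_le[OF _ Lo_Re_sums[OF t] sums_add[OF Lo0_sums[OF t] sums_mult[OF odd_exp_sums[OF t]]]])
    fix m
    show "(if odd m then sech_re (real m * t) (real m * (u * t)) / (2 * real m) else 0)
      \<le> (if odd m then 1 / (2 * real m * cosh (real m * t)) else 0) + u\<^sup>2 * t / 4 * (if odd m then exp (- (real m * t)) else 0)"
    proof (cases "odd m")
      case True
      then have m: "m > 0" by (auto elim: oddE)
      define x where "x = real m * t"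
      have x: "x > 0" using m t by (simp add: x_def)
      have "sech_re x (u * x) / (2 * real m) \<le> (1 / cosh x + (u * x)\<^sup>2 / (4 * x * cosh x)) / (2 * real m)"
        using m by (intro divide_right_mono sech_re_upper x) auto
      also have "\<dots> = 1 / (2 * real m * cosh x) + u\<^sup>2 * t / 8 * (1 / cosh x)"
        using m t by (simp add: x_def field_simps power2_eq_square)
      also have "\<dots> \<le> 1 / (2 * real m * cosh x) + u\<^sup>2 * t / 8 * (2 * exp (- x))"
        using t by (intro add_left_mono mult_left_mono inverse_cosh_le) auto
      finally show ?thesis using True by (simp add: x_def mult_ac)
    qed auto
  qed
  also have "u\<^sup>2 * t / 4 * (1 / (2 * sinh t)) \<le> u\<^sup>2 * t / 4 * (1 / (2 * t))"
    using t sinh_ge_self[of t] by (intro mult_left_mono divide_left_mono mult_pos_pos) auto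
  finally show ?thesis using t by simp
qed

text \<open>The loss in term \<open>m\<close> is of order \<open>(u * m * t)\<^sup>2 / m\<close>
  times a decaying exponential, so \<open>weighted_exp_sums\<close> cancels the powers of
  \<open>t\<close>.\<close>

lemma Lo_Re_lower:
  assumes t: "t > 0" and u: "0 \<le> u" "u \<le> 3"
  shows "Lo0 t - (5/4) * u\<^sup>2 \<le> Re (Lo (qt t (u * t)))"
proof -
  obtain S where S: "(\<lambda>m. real m * exp (- (real m * t))) sums S" "S \<le> 1 / t\<^sup>2"
    using weighted_exp_sums[OF t] .
  have "Lo0 t - (5/4) * u\<^sup>2 * t\<^sup>2 * S \<le> Re (Lo (qt t (u * t)))"
  proof (rule sums_le[OF _ sums_diff[OF Lo0_sums[OF t] sums_mult[OF S(1)]] Lo_Re_sums[OF t]])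
    fix m
    show "(if odd m then 1 / (2 * real m * cosh (real m * t)) else 0) - (5/4) * u\<^sup>2 * t\<^sup>2 * (real m * exp (- (real m * t)))
      \<le> (if odd m then sech_re (real m * t) (real m * (u * t)) / (2 * real m) else 0)"
    proof (cases "odd m")
      case True
      then have m: "m > 0" by (auto elim: oddE)
      define x where "x = real m * t"
      have x: "x > 0" using m t by (simp add: x_def)
      have "(5/4) * (u * x)\<^sup>2 * (1 / cosh x) \<le> (5/4) * (u * x)\<^sup>2 * (2 * exp (- x))"
        by (intro mult_left_mono inverse_cosh_le) auto
      then have "(1 / cosh x - (5/4) * (u * x)\<^sup>2 * (2 * exp (- x))) / (2 * real m) \<le> (1 / cosh x - (5/4) * (u * x)\<^sup>2 / cosh x) / (2 * real m)"
        by (intro divide_right_mono) auto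
      also have "\<dots> \<le> sech_re x (u * x) / (2 * real m)"
        using m x u by (intro divide_right_mono sech_re_lower) (auto simp: mult_right_mono)
      finally have "(1 / cosh x - (5/4) * (u * x)\<^sup>2 * (2 * exp (- x))) / (2 * real m) \<le> sech_re x (u * x) / (2 * real m)" .
      moreover have "(1 / cosh x - (5/4) * (u * x)\<^sup>2 * (2 * exp (- x))) / (2 * real m) =
         1 / (2 * real m * cosh x) - (5/4) * u\<^sup>2 * t\<^sup>2 * (real m * exp (- x))"
        using m by (simp add: x_def field_simps power2_eq_square)
      ultimately show ?thesis using True by (simp add: x_def mult_ac)
    qed (use u in auto)
  qed
  moreover have "(5/4) * u\<^sup>2 * t\<^sup>2 * S \<le> (5/4) * u\<^sup>2 * t\<^sup>2 * (1 / t\<^sup>2)" using S by (intro mult_left_mono) auto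
  moreover have "(5/4) * u\<^sup>2 * t\<^sup>2 * (1 / t\<^sup>2) = (5/4) * u\<^sup>2" using t by simp
  ultimately show ?thesis by linarith
qed

lemma Lo_Im_bound:
  assumes t: "t > 0" and u: "0 \<le> u" "u \<le> 1/2"
  shows "\<bar>Im (Lo (qt t (u * t)))\<bar> \<le> (2/3) * u"
proof -
  have "norm (Im (Lo (qt t (u * t)))) \<le> (4/3) * u * t * (1 / (2 * sinh t))"
  proof (rule norm_sums_le[OF Lo_Im_sums[OF t] sums_mult[OF odd_exp_sums[OF t]]])
    fix m
    show "norm (if odd m then sech_im (real m * t) (real m * (u * t)) / (2 * real m) else 0)
      \<le> (4/3) * u * t * (if odd m then exp (- (real m * t)) else 0)"
    proof (cases "odd m")
      case True
      then have m: "m > 0" by (auto elim: oddE)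
      define x where "x = real m * t"
      have x: "x > 0" using m t by (simp add: x_def)
      have "\<bar>sech_im x (u * x)\<bar> / (2 * real m) \<le> ((4/3) * (u * x) / cosh x) / (2 * real m)"
        using x u m mult_right_mono[OF u(2), of x] by (intro divide_right_mono sech_im_bound) auto
      also have "\<dots> = (2/3) * u * t * (1 / cosh x)" using m by (simp add: x_def field_simps)
      also have "\<dots> \<le> (2/3) * u * t * (2 * exp (- x))" using u t by (intro mult_left_mono inverse_cosh_le) auto
      finally show ?thesis using True by (simp add: x_def mult_ac abs_divide)
    qed auto
  qed
  also have "(4/3) * u * t * (1 / (2 * sinh t)) \<le> (4/3) * u * t * (1 / (2 * t))"
    using t u sinh_ge_self[of t] by (intro mult_left_mono divide_left_mono mult_pos_pos) auto
  finally show ?thesis using t by simp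
qed

section \<open>Termwise bounds uniform in the angle\<close>

lemma sinh_le_mult_cosh: "sinh x \<le> x * cosh x" if "x \<ge> 0" for x :: real
proof -
  have "(\<lambda>x. x * cosh x - sinh x) 0 \<le> (\<lambda>x. x * cosh x - sinh x) x"
  proof (rule DERIV_nonneg_imp_nondecreasing[OF that])
    fix y :: real assume "0 \<le> y" "y \<le> x"
    then show "\<exists>d. ((\<lambda>x. x * cosh x - sinh x) has_real_derivative d) (at y) \<and> 0 \<le> d"
      by (intro exI[of _ "y * sinh y"]) (auto intro!: derivative_eq_intros)
  qed
  then show ?thesis by simp
qed

lemma mult_cosh_le: "x * cosh x \<le> sinh x * (1 + x\<^sup>2 / 3)" if "x \<ge> 0" for x :: real
proof -
  have "(\<lambda>x. sinh x * (1 + x\<^sup>2 / 3) - x * cosh x) 0 \<le> (\<lambda>x. sinh x * (1 + x\<^sup>2 / 3) - x * cosh x) x"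
  proof (rule DERIV_nonneg_imp_nondecreasing[OF that])
    fix y :: real assume y: "0 \<le> y" "y \<le> x"
    have "((\<lambda>x. sinh x * (1 + x\<^sup>2 / 3) - x * cosh x) has_real_derivative y / 3 * (y * cosh y - sinh y)) (at y)"
      by (auto intro!: derivative_eq_intros simp: field_simps power2_eq_square)
    moreover have "y / 3 * (y * cosh y - sinh y) \<ge> 0" using sinh_le_mult_cosh[of y] y by auto
    ultimately show "\<exists>d. ((\<lambda>x. sinh x * (1 + x\<^sup>2 / 3) - x * cosh x) has_real_derivative d) (at y) \<and> 0 \<le> d" by blast
  qed
  then show ?thesis by simp
qed

lemma sech_re_nonpos: "cos y \<le> 0 \<Longrightarrow> sech_re x y \<le> 0"
  unfolding sech_re_def by (intro divide_nonpos_nonneg mult_nonneg_nonpos) auto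

lemma csch_re_nonpos: "cos y \<le> 0 \<Longrightarrow> x \<ge> 0 \<Longrightarrow> csch_re x y \<le> 0"
  unfolding csch_re_def by (intro divide_nonpos_nonneg mult_nonneg_nonpos) auto

text \<open>The inequality
  \<open>2 * sinh x * cos y \<le> (sinh x)\<^sup>2 + (cos y)\<^sup>2\<close> leaves half of coth x.
  Odd terms thus cost at most about half of what even terms may cost, see
  \<open>csch_re_le\<close>.\<close>

lemma sech_re_le_half:
  assumes x: "x > 0"
  shows "sech_re x y \<le> 1 / (2 * x) + x / 6"
proof (cases "cos y \<le> 0")
  case True
  have "0 \<le> 1 / x" "0 \<le> 1 / (2 * x)" "0 \<le> x / 6" using x by auto
  then show ?thesis using sech_re_nonpos[OF True, of x] x by linarith
next
  case False
  have s: "sinh x > 0" using x by simp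
  have "2 * sinh x * cos y \<le> (sinh x)\<^sup>2 + (cos y)\<^sup>2" by (rule sum_squares_bound)
  then have "cosh x * cos y / ((sinh x)\<^sup>2 + (cos y)\<^sup>2) \<le> cosh x * cos y / (2 * sinh x * cos y)"
    using False s by (intro divide_left_mono mult_nonneg_nonneg mult_pos_pos) (auto simp: add_pos_nonneg)
  also have "\<dots> = cosh x / (2 * sinh x)" using False by simp
  also have "\<dots> \<le> 1 / (2 * x) + x / 6"
  proof -
    have "cosh x / sinh x \<le> (1 + x\<^sup>2 / 3) / x"
      using mult_cosh_le[of x] x s by (simp add: divide_simps mult_ac)
    moreover have "(1 + x\<^sup>2 / 3) / x = 1 / x + x / 3" using x by (simp add: field_simps power2_eq_square)
    moreover have "cosh x / (2 * sinh x) = (cosh x / sinh x) / 2" "1 / (2 * x) = (1 / x) / 2" by simp_all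
    ultimately show ?thesis by linarith
  qed
  finally show ?thesis by (simp add: sech_re_def)
qed

lemma sinh_ge_double: "2 * x \<le> sinh x" if "x \<ge> 3" for x :: real
proof -
  have "1 + x / 2 + (x / 2)\<^sup>2 / 2 \<le> exp (x / 2)" using that by (intro exp_lower_Taylor_quadratic) auto
  then have "(1 + x / 2 + (x / 2)\<^sup>2 / 2)\<^sup>2 \<le> (exp (x / 2))\<^sup>2"
    using that by (intro power_mono) auto
  also have "(exp (x / 2))\<^sup>2 = exp x" by (simp add: power2_eq_square flip: exp_add)
  finally have e: "(1 + x / 2 + (x / 2)\<^sup>2 / 2)\<^sup>2 \<le> exp x" .
  have x2: "3 * x \<le> x\<^sup>2" using that by (simp add: power2_eq_square mult_right_mono)
  have x3: "9 * x \<le> x ^ 3"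
  proof -
    have "3 * (3 * x) \<le> x * x\<^sup>2" using that x2 by (intro mult_mono) auto
    then show ?thesis by (simp add: power3_eq_cube power2_eq_square)
  qed
  have x4: "27 * x \<le> x ^ 4"
  proof -
    have "3 * (9 * x) \<le> x * x ^ 3" using that x3 by (intro mult_mono) auto
    then show ?thesis by (simp add: power_numeral_reduce)
  qed
  have "(1 + x / 2 + (x / 2)\<^sup>2 / 2)\<^sup>2 = 1 + x + x\<^sup>2 / 2 + x ^ 3 / 8 + x ^ 4 / 64"
    by (simp add: field_simps power2_eq_square power_numeral_reduce)
  then have 1: "1 + 4 * x \<le> exp x" using e x2 x3 x4 that by linarith
  have 2: "exp (- x) \<le> 1" using that by simp
  have 3: "2 * sinh x = exp x - exp (- x)" by (simp add: sinh_field_def)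
  have "(1 + 4 * x) - 1 \<le> exp x - exp (- x)" by (rule diff_mono[OF 1 2])
  then show ?thesis using 3 by simp
qed

lemma sech_re_le_large:
  assumes x: "x \<ge> 3"
  shows "sech_re x y \<le> 1 / (2 * x)"
proof (cases "cos y \<le> 0")
  case True
  have "0 \<le> 1 / x" "0 \<le> 1 / (2 * x)" "0 \<le> x / 6" using x by auto
  then show ?thesis using sech_re_nonpos[OF True, of x] x by linarith
next
  case False
  define c s h where "c = cos y" and "s = sinh x" and "h = cosh x"
  have c: "0 < c" "c \<le> 1" using False by (auto simp: c_def)
  have s: "2 * x \<le> s" "s \<ge> 1" using sinh_ge_double[OF x] x by (auto simp: s_def)
  have h: "h > 0" "h\<^sup>2 = 1 + s\<^sup>2" "s \<le> h" by (auto simp: h_def s_def cosh_square_eq sinh_le_cosh_real)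
  have N: "s\<^sup>2 + c\<^sup>2 > 0" using s by (simp add: add_pos_nonneg)
  have "h * c / (s\<^sup>2 + c\<^sup>2) - 1 / h = (h\<^sup>2 * c - (s\<^sup>2 + c\<^sup>2)) / (h * (s\<^sup>2 + c\<^sup>2))"
    by (rule fraction_diff_inverse[OF h(1) N])
  also have "h\<^sup>2 * c - (s\<^sup>2 + c\<^sup>2) = (1 - c) * (c - s\<^sup>2)" unfolding h(2) by (simp add: algebra_simps power2_eq_square)
  also have "(1 - c) * (c - s\<^sup>2) / (h * (s\<^sup>2 + c\<^sup>2)) \<le> 0"
  proof (intro divide_nonpos_nonneg mult_nonneg_nonpos)
    have "1 \<le> s\<^sup>2" using s by (simp add: one_le_power)
    then show "c - s\<^sup>2 \<le> 0" using c by linarith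
  qed (use c h N in auto)
  finally have "h * c / (s\<^sup>2 + c\<^sup>2) \<le> 1 / h" by simp
  also have "\<dots> \<le> 1 / (2 * x)" using s h x by (intro divide_left_mono mult_pos_pos) auto
  finally show ?thesis by (simp add: sech_re_def c_def s_def h_def)
qed

lemma exp_three_halves: "exp (3/2) \<le> (9/2 :: real)"
proof -
  have "(exp (3/2) :: real)\<^sup>2 = exp 1 ^ 3"
    using exp_double[of "3/2 :: real"] exp_of_nat_mult[of 3 "1::real"] by simp
  also have "\<dots> \<le> (272/100) ^ 3" using e_less_272 by (intro power_mono) auto
  also have "\<dots> \<le> (9/2)\<^sup>2" by (simp add: power_numeral_reduce)
  finally show ?thesis by (rule power2_le_imp_le) auto
qed

text \<open>The linear excess of \<open>sech_re_le_half\<close> would not be summable after division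
  by \<open>m\<close>, while for \<open>x \<ge> 3\<close> there is no excess at all. Below 3 the
  factor \<open>exp (- x / 2)\<close> is at least 2/9, and 1/6 times 9/2 gives 3/4.\<close>

lemma sech_re_excess:
  assumes x: "x > 0"
  shows "sech_re x y \<le> 1 / (2 * x) + 3/4 * x * exp (- x / 2)"
proof (cases "x \<ge> 3")
  case True
  have "0 \<le> 3/4 * x * exp (- x / 2)" using x by simp
  then show ?thesis using sech_re_le_large[OF True, of y] by linarith
next
  case False
  have "1 \<le> 9/2 * exp (- x / 2)"
  proof -
    have "exp (x / 2) \<le> exp (3/2)" using False by simp
    then have "exp (x / 2) \<le> 9/2" using exp_three_halves by linarith
    then have "exp (x / 2) * exp (- x / 2) \<le> 9/2 * exp (- x / 2)" by (intro mult_right_mono) auto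
    then show ?thesis by (simp flip: exp_add)
  qed
  then have "x / 6 * 1 \<le> x / 6 * (9/2 * exp (- x / 2))" using x by (intro mult_left_mono) auto
  then show ?thesis using sech_re_le_half[OF x, of y] by simp
qed

lemma csch_re_le:
  assumes x: "x > 0"
  shows "csch_re x y \<le> 1 / x"
proof (cases "cos y \<le> 0")
  case True
  have "0 \<le> 1 / x" "0 \<le> 1 / (2 * x)" "0 \<le> x / 6" using x by auto
  then show ?thesis using csch_re_nonpos[OF True, of x] x by linarith
next
  case False
  have s: "sinh x > 0" "x \<le> sinh x" using x sinh_ge_self[of x] by auto
  have "sinh x * cos y / ((sinh x)\<^sup>2 + (sin y)\<^sup>2) \<le> sinh x * 1 / ((sinh x)\<^sup>2)"
    using s by (intro frac_le mult_left_mono) auto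
  also have "\<dots> = 1 / sinh x" by (simp add: power2_eq_square)
  also have "\<dots> \<le> 1 / x" using s x by (intro divide_left_mono) auto
  finally show ?thesis by (simp add: csch_re_def)
qed

lemma csch_re_le_sin:
  assumes "x > 0" "sin y \<noteq> 0"
  shows "csch_re x y \<le> sinh x / (sin y)\<^sup>2"
proof (cases "cos y \<le> 0")
  case True
  have "0 \<le> sinh x / (sin y)\<^sup>2" using assms by simp
  then show ?thesis using csch_re_nonpos[OF True, of x] assms by linarith
next
  case False
  have "sinh x * cos y / ((sinh x)\<^sup>2 + (sin y)\<^sup>2) \<le> sinh x * 1 / ((sin y)\<^sup>2)"
    using assms by (intro frac_le mult_left_mono) auto
  then show ?thesis by (simp add: csch_re_def)
qed

lemma sech_re_le_cos:
  assumes "cos y > 0"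
  shows "sech_re x y \<le> cosh x / cos y"
proof -
  have "cosh x * cos y / ((sinh x)\<^sup>2 + (cos y)\<^sup>2) \<le> cosh x * cos y / ((cos y)\<^sup>2)"
    using assms by (intro divide_left_mono mult_pos_pos) (auto simp: add_nonneg_pos)
  also have "\<dots> = cosh x / cos y" using assms by (simp add: power2_eq_square)
  finally show ?thesis by (simp add: sech_re_def)
qed

lemma odd_inverse_squares_sums: "(\<lambda>m. if odd m then 1 / real m ^ 2 else 0) sums (pi\<^sup>2 / 8)"
proof -
  have "(\<lambda>m. 1 / real m ^ 2 - (if even m then 1 / real m ^ 2 else 0)) sums (pi\<^sup>2 / 6 - pi\<^sup>2 / 24)"
    by (intro sums_diff inverse_squares_sums_0 even_inverse_squares_sums)
  moreover have "1 / real m ^ 2 - (if even m then 1 / real m ^ 2 else 0) = (if odd m then 1 / real m ^ 2 else 0)" for m by simp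
  ultimately show ?thesis by simp
qed

lemma Lq_Re_sums:
  assumes t: "t > 0"
  shows "(\<lambda>m. (if odd m then sech_re (real m * t) (real m * \<theta>) else csch_re (real m * t) (real m * \<theta>)) / (2 * real m)) sums Re (Lq (qt t \<theta>))"
proof -
  have "norm (qt t \<theta>) < 1" using t by (simp add: norm_qt)
  then have "Re (Lq (qt t \<theta>)) = Re (Le (qt t \<theta>)) + Re (Lo (qt t \<theta>))" by (simp add: Lq_split)
  moreover have "(\<lambda>m. (if even m then csch_re (real m * t) (real m * \<theta>) / (2 * real m) else 0) +
     (if odd m then sech_re (real m * t) (real m * \<theta>) / (2 * real m) else 0)) sums (Re (Le (qt t \<theta>)) + Re (Lo (qt t \<theta>)))"
    by (intro sums_add Le_Re_sums Lo_Re_sums t)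
  moreover have "(if even m then csch_re (real m * t) (real m * \<theta>) / (2 * real m) else 0) +
     (if odd m then sech_re (real m * t) (real m * \<theta>) / (2 * real m) else 0) = (if odd m then sech_re (real m * t) (real m * \<theta>) else csch_re (real m * t) (real m * \<theta>)) / (2 * real m)" for m
    by simp
  ultimately show ?thesis by simp
qed

text \<open>Terms beyond the fourth are replaced by their uniform bounds. In total these are
  \<open>5 * pi\<^sup>2 / 96 / t\<close>, from pi^2 / 32 for odd and pi^2 / 48 for even indices;
  removing the first four leaves about 0.0801 / t. The 3/8 comes from the excess of the odd
  terms.\<close>

lemma Lq_Re_tail:
  assumes t: "t > 0"
  shows "Re (Lq (qt t \<theta>)) \<le> sech_re t \<theta> / 2 + csch_re (2 * t) (2 * \<theta>) / 4 + sech_re (3 * t) (3 * \<theta>) / 6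
     + csch_re (4 * t) (4 * \<theta>) / 8 + (801/10000) / t + 3/8"
proof -
  define f where "f m = (if odd m then sech_re (real m * t) (real m * \<theta>) else csch_re (real m * t) (real m * \<theta>)) / (2 * real m)" for m
  define g where "g m = (1 / (4 * t)) * (if odd m then 1 / real m ^ 2 else 0) + (1 / (2 * t)) * (if even m then 1 / real m ^ 2 else 0)
     + 3/8 * t * (if odd m then exp (- (real m * (t / 2))) else 0)" for m
  have f: "f sums Re (Lq (qt t \<theta>))" unfolding f_def[abs_def] by (rule Lq_Re_sums[OF t])
  define S where "S = (1 / (4 * t)) * (pi\<^sup>2 / 8) + (1 / (2 * t)) * (pi\<^sup>2 / 24) + 3/8 * t * (1 / (2 * sinh (t / 2)))"
  have g: "g sums S" unfolding g_def[abs_def] S_def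
    by (intro sums_add sums_mult odd_inverse_squares_sums even_inverse_squares_sums odd_exp_sums) (use t in auto)
  have fg: "f m \<le> g m" if "m > 0" for m
  proof (cases "odd m")
    case True
    have x: "real m * t > 0" using that t by simp
    have "f m \<le> (1 / (2 * (real m * t)) + 3/4 * (real m * t) * exp (- (real m * t) / 2)) / (2 * real m)"
      unfolding f_def using True divide_right_mono[OF sech_re_excess[OF x, of "real m * \<theta>"], of "2 * real m"] by simp
    also have "\<dots> = g m" using that True t by (simp add: g_def field_simps power2_eq_square)
    finally show ?thesis .
  next
    case False
    have x: "real m * t > 0" using that t by simp
    have "f m \<le> (1 / (real m * t)) / (2 * real m)"
      unfolding f_def using False divide_right_mono[OF csch_re_le[OF x, of "real m * \<theta>"], of "2 * real m"] by simp
    also have "\<dots> = g m" using that False t by (simp add: g_def field_simps power2_eq_square)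
    finally show ?thesis .
  qed
  have "(\<lambda>m. f (m + 5)) sums (Re (Lq (qt t \<theta>)) - (\<Sum>i<5. f i))" by (rule sums_split_initial_segment[OF f])
  moreover have "(\<lambda>m. g (m + 5)) sums (S - (\<Sum>i<5. g i))" by (rule sums_split_initial_segment[OF g])
  ultimately have le: "Re (Lq (qt t \<theta>)) - (\<Sum>i<5. f i) \<le> S - (\<Sum>i<5. g i)"
    by (rule sums_le[rotated]) (use fg in auto)
  have F: "(\<Sum>i<5. f i) = sech_re t \<theta> / 2 + csch_re (2 * t) (2 * \<theta>) / 4 + sech_re (3 * t) (3 * \<theta>) / 6 + csch_re (4 * t) (4 * \<theta>) / 8"
  proof -
    have "(\<Sum>i<5. f i) = f 0 + f 1 + f 2 + f 3 + f 4" by (simp add: numeral_eq_Suc)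
    then show ?thesis by (simp add: f_def)
  qed
  have G: "(\<Sum>i<5. g i) \<ge> (1 / (4 * t)) * (10 / 9) + (1 / (2 * t)) * (5 / 16)"
  proof -
    have g0: "g 0 = 0" by (simp add: g_def)
    have g2: "g 2 = (1 / (2 * t)) * (1 / 4)" "g 4 = (1 / (2 * t)) * (1 / 16)" by (simp_all add: g_def)
    have g1: "g 1 \<ge> (1 / (4 * t))" "g 3 \<ge> (1 / (4 * t)) * (1 / 9)" using t by (simp_all add: g_def)
    have "(\<Sum>i<5. g i) = g 0 + g 1 + g 2 + g 3 + g 4" by (simp add: numeral_eq_Suc)
    moreover have "(1 / (4 * t)) * (10 / 9) + (1 / (2 * t)) * (5 / 16) = 0 + 1 / (4 * t) + (1 / (2 * t)) * (1 / 4) + (1 / (4 * t)) * (1 / 9) + (1 / (2 * t)) * (1 / 16)"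
      using t by (simp add: field_simps)
    ultimately show ?thesis using g0 g1 g2 by argo
  qed
  have S: "S \<le> (5 * pi\<^sup>2 / 96) / t + 3/8"
  proof -
    have "3/8 * t * (1 / (2 * sinh (t / 2))) \<le> 3/8 * t * (1 / t)"
      using sinh_ge_self[of "t/2"] t by (intro mult_left_mono divide_left_mono) auto
    then show ?thesis using t by (simp add: S_def field_simps)
  qed
  have "5 * pi\<^sup>2 / 96 \<le> 801/10000 + (1/4 * (10/9) + 1/2 * (5/16))"
  proof -
    have "pi\<^sup>2 \<le> (31416/10000)\<^sup>2" using pi_approx by (intro power_mono) auto
    then show ?thesis by (simp add: power2_eq_square)
  qed
  then have "(5 * pi\<^sup>2 / 96) / t \<le> (801/10000 + (1/4 * (10/9) + 1/2 * (5/16))) / t" using t by (intro divide_right_mono) auto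
  also have "\<dots> = (801/10000) / t + ((1 / (4 * t)) * (10 / 9) + (1 / (2 * t)) * (5 / 16))" using t by (simp add: field_simps)
  finally show ?thesis using le F G S by argo
qed

lemma sin_ge_cubic: "y - y ^ 3 / 6 \<le> sin y" if "y \<ge> 0" for y :: real
proof -
  have "(\<lambda>y. sin y - y + y ^ 3 / 6) 0 \<le> (\<lambda>y. sin y - y + y ^ 3 / 6) y"
  proof (rule DERIV_nonneg_imp_nondecreasing[OF that])
    fix x :: real
    have "((\<lambda>y. sin y - y + y ^ 3 / 6) has_real_derivative (cos x - 1 + x\<^sup>2 / 2)) (at x)"
      by (auto intro!: derivative_eq_intros)
    moreover have "cos x - 1 + x\<^sup>2 / 2 \<ge> 0" using one_minus_cos_le[of x] by argo
    ultimately show "\<exists>d. ((\<lambda>y. sin y - y + y ^ 3 / 6) has_real_derivative d) (at x) \<and> 0 \<le> d" by blast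
  qed
  then show ?thesis by simp
qed

lemma square_le_scaled: "0 \<le> x \<Longrightarrow> x \<le> k \<Longrightarrow> x\<^sup>2 \<le> k * x" for x k :: real
  by (simp add: power2_eq_square mult_right_mono)

lemma cos_le_zero:
  fixes y :: real
  assumes "pi / 2 \<le> y" "y \<le> 3 * pi / 2"
  shows "cos y \<le> 0"
proof -
  have "cos (y - pi) \<ge> 0" using assms by (intro cos_ge_zero) auto
  then show ?thesis by simp
qed

lemma csch_re_reflect: "csch_re x (2 * pi - y) = csch_re x y"
  by (simp add: csch_re_def sin_diff cos_diff)

lemma csch_re_periodic: "csch_re x (2 * pi + y) = csch_re x y"
  by (simp add: csch_re_def sin_add cos_add)

lemma sin_ge_scaled:
  fixes y :: real
  assumes "0 \<le> y" "y \<le> 21/100"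
  shows "99/100 * y \<le> sin y"
proof -
  have "y * y \<le> 21/100 * (21/100)" using assms by (intro mult_mono) auto
  then have "y * (y * y) \<le> y * (6/100)" using assms by (intro mult_left_mono) auto
  then have "y ^ 3 / 6 \<le> 1/100 * y" by (simp add: power3_eq_cube mult_ac)
  then show ?thesis using sin_ge_cubic[OF assms(1)] by argo
qed

lemma sinh_le_scaled:
  fixes x :: real
  assumes "0 \<le> x" "x \<le> 3/100"
  shows "sinh x \<le> 102/100 * x"
proof -
  have "exp x \<le> 1 + x + x\<^sup>2" using assms by (intro exp_bound) auto
  moreover have "1 + (- x) \<le> exp (- x)" by (rule exp_ge_add_one_self)
  moreover have "2 * sinh x = exp x - exp (- x)" by (simp add: sinh_field_def)
  moreover have "x\<^sup>2 \<le> 3/100 * x" using assms by (intro square_le_scaled)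
  ultimately show ?thesis using assms by argo
qed

lemma cosh_le_scaled:
  fixes x :: real
  assumes "0 \<le> x" "x \<le> 1/100"
  shows "cosh x \<le> 101/100"
proof -
  have "exp x \<le> 1 + x + x\<^sup>2" using assms by (intro exp_bound) auto
  moreover have "exp (- x) \<le> 1" using assms by simp
  moreover have "2 * cosh x = exp x + exp (- x)" by (simp add: cosh_field_def)
  moreover have "x\<^sup>2 \<le> 1/100 * x" using assms by (intro square_le_scaled)
  ultimately show ?thesis using assms by argo
qed

lemma csch_re_small:
  assumes x: "0 < x" "x \<le> 3/100" and k: "k > 0" and s: "k * x \<le> \<bar>sin y\<bar>"
  shows "csch_re x y \<le> (102/100 / k\<^sup>2) / x"
proof -
  have kx: "k * x > 0" using x k by simp
  then have "sin y \<noteq> 0" using s by auto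
  then have "csch_re x y \<le> sinh x / (sin y)\<^sup>2" using x by (intro csch_re_le_sin) auto
  also have "\<dots> \<le> (102/100 * x) / (k * x)\<^sup>2"
  proof (intro frac_le sinh_le_scaled)
    show "(k * x)\<^sup>2 \<le> (sin y)\<^sup>2" using s kx power_mono[of "k * x" "\<bar>sin y\<bar>" 2] by simp
  qed (use x kx k in auto)
  also have "\<dots> = (102/100 / k\<^sup>2) / x" using x k by (simp add: field_simps power2_eq_square)
  finally show ?thesis .
qed

lemma sech3_bound:
  assumes "0 < t" "t \<le> 1/100"
  shows "sech_re (3 * t) (3 * \<theta>) / 6 \<le> (278/10000) / t + 1/1000"
proof -
  define A where "A = 1 / (2 * (3 * t))"
  have "sech_re (3 * t) (3 * \<theta>) \<le> A + 3 * t / 6" unfolding A_def using assms by (intro sech_re_le_half) auto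
  moreover have "A / 6 \<le> (278/10000) / t" using assms by (simp add: A_def divide_simps)
  ultimately show ?thesis using assms by argo
qed

section \<open>Arcs away from 0, pi / 2 and pi\<close>

context
  fixes t :: real
  assumes t: "0 < t" "t \<le> 642/100000"
begin

text \<open>The number 642/100000 is an upper bound of pi / sqrt (48 * 5000), the largest t that
  occurs. Additive constants are traded for small multiples of 1 / t in this way.\<close>

lemma const_le: "1 \<le> (642/100000) / t"
  using t by (simp add: divide_simps)

lemma mid_A_aux:
  assumes th: "3 * t \<le> \<theta>" "\<theta> \<le> pi / 4"
  shows "csch_re (2 * t) (2 * \<theta>) / 4 \<le> (15/1000) / t" "csch_re (4 * t) (4 * \<theta>) / 8 \<le> (4/1000) / t"
proof -
  have "297/100 * (2 * t) \<le> sin (2 * (3 * t))" using sin_ge_scaled[of "6 * t"] t by simp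
  also have "\<dots> \<le> sin (2 * \<theta>)" using th t by (intro sin_monotone_2pi_le) (auto simp: mult_left_mono)
  finally have "csch_re (2 * t) (2 * \<theta>) \<le> (102/100 / (297/100)\<^sup>2) / (2 * t)"
    using t by (intro csch_re_small) auto
  also have "\<dots> = (102/100 / (297/100)\<^sup>2 / 2) / t" by simp
  also have "\<dots> \<le> (4 * (15/1000)) / t" using t by (intro divide_right_mono) (auto simp: power2_eq_square)
  finally show "csch_re (2 * t) (2 * \<theta>) / 4 \<le> (15/1000) / t" by simp
  show "csch_re (4 * t) (4 * \<theta>) / 8 \<le> (4/1000) / t"
  proof (cases "4 * \<theta> \<le> pi / 2")
    case True
    have "297/100 * (4 * t) \<le> sin (4 * (3 * t))" using sin_ge_scaled[of "12 * t"] t by simp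
    also have "\<dots> \<le> sin (4 * \<theta>)" using th t True by (intro sin_monotone_2pi_le) (auto simp: mult_left_mono)
    finally have "csch_re (4 * t) (4 * \<theta>) \<le> (102/100 / (297/100)\<^sup>2) / (4 * t)"
      using t by (intro csch_re_small) auto
    also have "\<dots> = (102/100 / (297/100)\<^sup>2 / 4) / t" by simp
    also have "\<dots> \<le> (8 * (4/1000)) / t" using t by (intro divide_right_mono) (auto simp: power2_eq_square)
    finally show ?thesis by simp
  next
    case False
    have "cos (4 * \<theta>) \<le> 0" using False th by (intro cos_le_zero) auto
    then have "csch_re (4 * t) (4 * \<theta>) \<le> 0" using t by (intro csch_re_nonpos) auto
    moreover have "0 \<le> (4/1000) / t" using t by simp
    ultimately show ?thesis by argo
  qed
qed

text \<open>Here the cosine of \<theta> is bounded below, so the first term is only a constant.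
  Terms two and four are small because the sine is at least nearly three times the real argument
  until the cosine turns negative.\<close>

lemma mid_A:
  assumes th: "3 * t \<le> \<theta>" "\<theta> \<le> pi / 4"
  shows "Re (Lq (qt t \<theta>)) \<le> (29/200) / t + 7/20"
proof -
  have c: "cos \<theta> \<ge> 7/10"
  proof -
    have "cos (pi / 4) \<le> cos \<theta>" using th t by (intro cos_monotone_0_pi_le) auto
    moreover have "7/5 \<le> sqrt 2" by (intro real_le_rsqrt) (simp add: power2_eq_square)
    ultimately show ?thesis by (simp add: cos_45)
  qed
  have "sech_re t \<theta> \<le> cosh t / cos \<theta>" using c by (intro sech_re_le_cos) auto
  also have "\<dots> \<le> (101/100) / (7/10)" using c t by (intro frac_le cosh_le_scaled) auto
  finally have "sech_re t \<theta> / 2 \<le> 3/4" by simp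
  then show ?thesis
    using Lq_Re_tail[OF t(1), of \<theta>] mid_A_aux[OF th] sech3_bound[of t \<theta>] t const_le by argo
qed

text \<open>Even terms are invariant under \<theta> to pi - \<theta>, the first term is now
  negative, and the third is bounded uniformly as in \<open>mid_A\<close>.\<close>

lemma mid_C:
  assumes th: "3 * pi / 4 \<le> \<theta>" "\<theta> \<le> pi - 3 * t"
  shows "Re (Lq (qt t \<theta>)) \<le> (29/200) / t + 7/20"
proof -
  define \<phi> where "\<phi> = pi - \<theta>"
  have phi: "3 * t \<le> \<phi>" "\<phi> \<le> pi / 4" using th by (auto simp: \<phi>_def)
  have e: "csch_re x (2 * \<theta>) = csch_re x (2 * \<phi>)" "csch_re x (4 * \<theta>) = csch_re x (4 * \<phi>)" for x
  proof -
    have "2 * \<theta> = 2 * pi - 2 * \<phi>" by (simp add: \<phi>_def)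
    then show "csch_re x (2 * \<theta>) = csch_re x (2 * \<phi>)" by (simp only: csch_re_reflect)
    have "4 * \<theta> = 2 * pi + (2 * pi - 4 * \<phi>)" by (simp add: \<phi>_def)
    then show "csch_re x (4 * \<theta>) = csch_re x (4 * \<phi>)" by (simp only: csch_re_reflect csch_re_periodic)
  qed
  have "cos \<theta> \<le> 0" using th t by (intro cos_le_zero) auto
  then have "sech_re t \<theta> \<le> 0" by (rule sech_re_nonpos)
  then show ?thesis
    using Lq_Re_tail[OF t(1), of \<theta>] mid_A_aux[OF phi] sech3_bound[of t \<theta>] t const_le unfolding e by argo
qed

text \<open>Terms two and three have negative cosine. The first is at most about 1 / (8 t) before
  halving, since the distance to pi / 2 is at least 8 t. This arc comes closest to the common
  constant 29/200.\<close>

lemma mid_B1: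
  assumes th: "pi / 4 \<le> \<theta>" "\<theta> \<le> pi / 2 - 8 * t"
  shows "Re (Lq (qt t \<theta>)) \<le> (29/200) / t + 7/20"
proof -
  define \<phi> where "\<phi> = pi / 2 - \<theta>"
  have phi: "8 * t \<le> \<phi>" "\<phi> \<le> pi / 4" using th by (auto simp: \<phi>_def)
  have b2: "csch_re (2 * t) (2 * \<theta>) \<le> 0"
    using th t by (intro csch_re_nonpos cos_le_zero) auto
  have b3: "sech_re (3 * t) (3 * \<theta>) \<le> 0"
    using th t by (intro sech_re_nonpos cos_le_zero) auto
  have "8 * t - (8 * t) ^ 3 / 6 \<le> sin (8 * t)" using t by (intro sin_ge_cubic) auto
  moreover have "(8 * t) ^ 3 / 6 \<le> 8 * t * (1/2000)"
  proof -
    have "t * t \<le> 642/100000 * (642/100000)" using t by (intro mult_mono) auto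
    then have "8 * t * (64 * (t * t) / 6) \<le> 8 * t * (1/2000)" using t by (intro mult_left_mono) auto
    then show ?thesis by (simp add: power3_eq_cube mult_ac)
  qed
  ultimately have s8: "8 * t * (1999/2000) \<le> sin (8 * t)" by argo
  have "cos \<theta> = sin \<phi>" by (simp add: \<phi>_def cos_sin_eq)
  moreover have "sin (8 * t) \<le> sin \<phi>" using phi t by (intro sin_monotone_2pi_le) auto
  ultimately have c: "8 * t * (1999/2000) \<le> cos \<theta>" using s8 by argo
  have "sech_re t \<theta> \<le> cosh t / cos \<theta>" using c t by (intro sech_re_le_cos) (auto intro: less_le_trans[rotated])
  also have "\<dots> \<le> (1007/1000) / (8 * t * (1999/2000))"
  proof (intro frac_le)
    have "exp t \<le> 1 + t + t\<^sup>2" using t by (intro exp_bound) auto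
    moreover have "exp (- t) \<le> 1" using t by simp
    moreover have "2 * cosh t = exp t + exp (- t)" by (simp add: cosh_field_def)
    moreover have "t\<^sup>2 \<le> 1/100 * t" using t by (intro square_le_scaled) auto
    ultimately show "cosh t \<le> 1007/1000" using t by argo
  qed (use c t in auto)
  also have "\<dots> = ((1007/1000) / (8 * (1999/2000))) / t" by simp
  also have "\<dots> \<le> (2 * (6298/100000)) / t" using t by (intro divide_right_mono) auto
  finally have b1: "sech_re t \<theta> / 2 \<le> (6298/100000) / t" by simp
  have b4: "csch_re (4 * t) (4 * \<theta>) / 8 \<le> (6/10000) / t"
  proof (cases "4 * \<phi> \<le> pi / 2")
    case True
    have "792/100 * (4 * t) \<le> sin (4 * (8 * t))" using sin_ge_scaled[of "32 * t"] t by simp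
    also have "\<dots> \<le> sin (4 * \<phi>)" using phi t True by (intro sin_monotone_2pi_le) (auto simp: mult_left_mono)
    also have "sin (4 * \<phi>) = \<bar>sin (4 * \<theta>)\<bar>"
    proof -
      have "4 * \<theta> = 2 * pi - 4 * \<phi>" by (auto simp: \<phi>_def)
      then have "sin (4 * \<theta>) = - sin (4 * \<phi>)" by (simp add: sin_diff)
      moreover have "sin (4 * \<phi>) \<ge> 0" using True phi t by (intro sin_ge_zero) auto
      ultimately show ?thesis by simp
    qed
    finally have "csch_re (4 * t) (4 * \<theta>) \<le> (102/100 / (792/100)\<^sup>2) / (4 * t)"
      using t by (intro csch_re_small) auto
    also have "\<dots> = (102/100 / (792/100)\<^sup>2 / 4) / t" by simp
    also have "\<dots> \<le> (8 * (6/10000)) / t" using t by (intro divide_right_mono) (auto simp: power2_eq_square)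
    finally show ?thesis by simp
  next
    case False
    have "cos (4 * \<theta>) = cos (4 * \<phi>)"
    proof -
      have "4 * \<theta> = 2 * pi - 4 * \<phi>" by (auto simp: \<phi>_def)
      then show ?thesis by (simp add: cos_diff)
    qed
    also have "cos (4 * \<phi>) \<le> 0" using False phi by (intro cos_le_zero) auto
    finally have "csch_re (4 * t) (4 * \<theta>) \<le> 0" using t by (intro csch_re_nonpos) auto
    moreover have "0 \<le> (6/10000) / t" using t by simp
    ultimately show ?thesis by argo
  qed
  show ?thesis
    using Lq_Re_tail[OF t(1), of \<theta>] b1 b2 b3 b4 const_le by argo
qed

lemma mid_B2:
  assumes th: "pi / 2 \<le> \<theta>" "\<theta> \<le> 3 * pi / 4"
  shows "Re (Lq (qt t \<theta>)) \<le> (29/200) / t + 7/20"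
proof -
  have b1: "sech_re t \<theta> \<le> 0" using th by (intro sech_re_nonpos cos_le_zero) auto
  have b2: "csch_re (2 * t) (2 * \<theta>) \<le> 0" using th t by (intro csch_re_nonpos cos_le_zero) auto
  have "csch_re (4 * t) (4 * \<theta>) / 8 \<le> (1 / (4 * t)) / 8" using t by (intro divide_right_mono csch_re_le) auto
  also have "(1 / (4 * t)) / 8 = (1/32) / t" by simp
  finally have "csch_re (4 * t) (4 * \<theta>) / 8 \<le> (1/32) / t" .
  then show ?thesis
    using Lq_Re_tail[OF t(1), of \<theta>] b1 b2 sech3_bound[of t \<theta>] t const_le by argo
qed

lemma mid_bound:
  assumes "\<theta> \<in> {3 * t..pi / 2 - 8 * t} \<union> {pi / 2..pi - 3 * t}"
  shows "Re (Lq (qt t \<theta>)) \<le> (29/200) / t + 7/20"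
  using assms mid_A[of \<theta>] mid_B1[of \<theta>] mid_B2[of \<theta>] mid_C[of \<theta>] by fastforce

end

section \<open>The arc near pi / 2\<close>

lemma Re_dilog_i: "Re (dilog \<i>) = - (pi\<^sup>2 / 48)"
proof -
  have s: "(\<lambda>m. Re (\<i> ^ m / of_nat m ^ 2)) sums Re (dilog \<i>)" by (intro sums_Re dilog_sums) simp
  have "Re (\<i> ^ m / of_nat m ^ 2) = (if even m then Re (\<i> ^ m / of_nat m ^ 2) else 0)" for m
  proof (cases "even m")
    case False
    then obtain k where "m = 2 * k + 1" by (auto elim: oddE)
    then have "\<i> ^ m = of_real ((-1) ^ k) * \<i>" by (simp add: power_mult)
    then have "\<i> ^ m / of_nat m ^ 2 = \<i> * of_real ((-1) ^ k / real m ^ 2)" by simp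
    then show ?thesis using False by (simp only: Re_i_times Im_complex_of_real) simp
  qed auto
  with s have "(\<lambda>m. if even m then Re (\<i> ^ m / of_nat m ^ 2) else 0) sums Re (dilog \<i>)" by simp
  then have 1: "(\<lambda>k. Re (\<i> ^ (2 * k) / of_nat (2 * k) ^ 2)) sums Re (dilog \<i>)" unfolding sums_even_iff .
  have e: "Re (\<i> ^ (2 * k) / of_nat (2 * k) ^ 2) = Re ((-1) ^ k / of_nat k ^ 2) / 4" for k
  proof -
    have "\<i> ^ (2 * k) / of_nat (2 * k) ^ 2 = of_real ((-1) ^ k / real k ^ 2 / 4)" by (simp add: power_mult power_mult_distrib)
    moreover have "(-1) ^ k / of_nat k ^ 2 = (of_real ((-1) ^ k / real k ^ 2) :: complex)" by simp
    ultimately show ?thesis by (simp only: Re_complex_of_real)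
  qed
  have "(\<lambda>k. Re ((-1) ^ k / of_nat k ^ 2) / 4) sums (Re (dilog (-1)) / 4)"
    by (intro sums_divide sums_Re dilog_sums) simp
  then have "Re (dilog \<i>) = Re (dilog (-1)) / 4" using 1 unfolding e by (rule sums_unique2[rotated])
  then show ?thesis unfolding dilog_minus_one Re_complex_of_real by simp
qed

text \<open>This is Catalan's constant 0.9159..., bounded by its alternating series stopped after
  nine terms, that is, after a positive one.\<close>

lemma Im_dilog_i: "Im (dilog \<i>) \<le> 9176/10000"
proof -
  have s: "(\<lambda>m. Im (\<i> ^ m / of_nat m ^ 2)) sums Im (dilog \<i>)" by (intro sums_Im dilog_sums) simp
  have ev: "Im (\<i> ^ m / of_nat m ^ 2) = (if odd m then Im (\<i> ^ m / of_nat m ^ 2) else 0)" for m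
  proof (cases "even m")
    case True
    then obtain k where "m = 2 * k" by (auto elim: evenE)
    then have "\<i> ^ m / of_nat m ^ 2 = of_real ((-1) ^ k / real m ^ 2)" by (simp add: power_mult)
    then show ?thesis using True by (simp only: Im_complex_of_real) simp
  qed auto
  with s have "(\<lambda>m. if odd m then Im (\<i> ^ m / of_nat m ^ 2) else 0) sums Im (dilog \<i>)" by simp
  then have 1: "(\<lambda>k. Im (\<i> ^ (2 * k + 1) / of_nat (2 * k + 1) ^ 2)) sums Im (dilog \<i>)" unfolding sums_odd_iff .
  define b where "b k = 1 / real (2 * k + 1) ^ 2" for k
  have "Im (\<i> ^ (2 * k + 1) / of_nat (2 * k + 1) ^ 2) = (-1) ^ k * b k" for k
  proof -
    have "\<i> ^ (2 * k + 1) / of_nat (2 * k + 1) ^ 2 = \<i> * of_real ((-1) ^ k * b k)"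
      by (simp add: power_mult b_def)
    then show ?thesis by (simp only: Im_i_times Re_complex_of_real)
  qed
  with 1 have 2: "(\<lambda>k. (-1) ^ k * b k) sums Im (dilog \<i>)" by simp
  have bl: "b \<longlonglongrightarrow> 0" unfolding b_def by real_asymp
  have bp: "b k \<ge> 0" for k by (simp add: b_def)
  have bm: "b (Suc k) \<le> b k" for k unfolding b_def by (intro divide_left_mono power_mono) auto
  have "(\<Sum>k. (-1) ^ k * b k) \<le> (\<Sum>i<2 * 4 + 1. (-1) ^ i * b i)"
    by (rule summable_Leibniz'(4)[OF bl bp bm])
  also have "\<dots> \<le> 9176/10000" by (simp add: b_def numeral_eq_Suc)
  finally show ?thesis using 2 by (simp add: sums_iff)
qed

lemma exp_minus_le_inverse:
  fixes y :: real
  assumes "y \<ge> 0"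
  shows "exp (- y) \<le> 1 / (1 + y + y\<^sup>2 / 2)"
proof -
  have "1 + y + y\<^sup>2 / 2 \<le> exp y" by (rule exp_lower_Taylor_quadratic[OF assms])
  then have "1 / exp y \<le> 1 / (1 + y + y\<^sup>2 / 2)" using assms by (intro divide_left_mono mult_pos_pos) (auto simp: add_pos_nonneg)
  then show ?thesis by (simp add: exp_minus field_simps)
qed

text \<open>Supplies the constant \<open>D\<close> for the ray at \<open>\<i>\<close>, as
  \<open>B = 1 - 1 / D\<close>: up to \<open>y0\<close> the sine is bounded by its argument, beyond
  \<open>y0\<close> the exponential alone is small.\<close>

lemma exp_sin_bound:
  fixes y v V y0 B :: real
  assumes y: "0 \<le> y" and v: "0 \<le> v" "v \<le> V" and y0: "0 < y0" "V * y0 / (1 + y0) \<le> B" "1 / (1 + y0 + y0\<^sup>2 / 2) \<le> B"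
  shows "exp (- y) * sin (v * y) \<le> B"
proof (cases "y \<le> y0")
  case True
  have s: "sin (v * y) \<le> V * y"
    using sin_x_le_x[of "v * y"] y v mult_right_mono[OF v(2) y] by simp
  have "exp (- y) * sin (v * y) \<le> exp (- y) * (V * y)" using s by (intro mult_left_mono) auto
  also have "\<dots> \<le> 1 / (1 + y) * (V * y)"
  proof (intro mult_right_mono)
    have "1 + y \<le> exp y" by (rule exp_ge_add_one_self)
    then have "1 / exp y \<le> 1 / (1 + y)" using y by (intro divide_left_mono mult_pos_pos) auto
    then show "exp (- y) \<le> 1 / (1 + y)" by (simp add: exp_minus field_simps)
  qed (use y v in auto)
  also have "\<dots> = V * (y / (1 + y))" by simp
  also have "\<dots> \<le> V * (y0 / (1 + y0))" using y True y0 v by (intro mult_left_mono) (auto simp: divide_simps algebra_simps)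
  also have "\<dots> \<le> B" using y0 by simp
  finally show ?thesis .
next
  case False
  have "exp (- y) * sin (v * y) \<le> exp (- y) * 1" by (intro mult_left_mono) auto
  also have "\<dots> \<le> exp (- y0)" using False by simp
  also have "\<dots> \<le> B" using exp_minus_le_inverse[of y0] y0 by simp
  finally show ?thesis .
qed

lemma one_minus_exp_ge: "2 * t * (1 - t) \<le> 1 - exp (- 2 * t)" if "t \<ge> 0" for t :: real
proof -
  have "1 + 2 * t + (2 * t)\<^sup>2 / 2 \<le> exp (2 * t)" using that by (intro exp_lower_Taylor_quadratic) auto
  then have "exp (- 2 * t) * (1 + 2 * t + 2 * t\<^sup>2) \<le> exp (- 2 * t) * exp (2 * t)" by (intro mult_left_mono) (auto simp: power_mult_distrib)
  also have "\<dots> = 1" by (simp flip: exp_add)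
  also have "1 \<le> (1 - 2 * t * (1 - t)) * (1 + 2 * t + 2 * t\<^sup>2)"
  proof -
    have "(1 - 2 * t * (1 - t)) * (1 + 2 * t + 2 * t\<^sup>2) = 1 + 4 * t ^ 4"
      by (simp add: algebra_simps power2_eq_square power_numeral_reduce)
    then show ?thesis by simp
  qed
  finally have "exp (- 2 * t) \<le> 1 - 2 * t * (1 - t)"
    by (rule mult_right_le_imp_le) (use that in \<open>auto simp: add_pos_nonneg\<close>)
  then show ?thesis by simp
qed

text \<open>Writing q as \<open>\<i> * exp (- \<tau>)\<close> makes the base
  \<open>- (q\<^sup>2)\<close> equal to \<open>exp (- 2 * \<tau>)\<close>, so the factors of the
  merged product are sampled at odd multiples of \<tau> and \<open>midpoint_limit\<close> applies
  with \<omega> = \<open>\<i>\<close>. The main term is the real part of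
  \<open>dilog \<i> / (2 * \<tau>)\<close>.\<close>

lemma quarter_arc_bound:
  assumes t: "0 < t" "t \<le> 642/100000" and v: "0 \<le> v"
    and D: "D \<ge> 1" and ray: "\<And>y. y \<ge> 0 \<Longrightarrow> exp (- y) * sin (v * y) \<le> 1 - 1 / D"
  shows "Re (Lq (qt t (pi / 2 - v * t))) \<le> ((9176/10000 * v - 2056/10000) / (2 * (1 + v\<^sup>2))) / t + D\<^sup>2 * (1 + v\<^sup>2) * t / 4 * (101/100)"
proof -
  define q where "q = qt t (pi / 2 - v * t)"
  define \<tau> where "\<tau> = Complex t (v * t)"
  have tau: "Re \<tau> > 0" using t by (simp add: \<tau>_def)
  have q: "q = \<i> * exp (- \<tau>)"
  proof -
    have "Complex (- t) (pi / 2 - v * t) = Complex 0 (pi / 2) + (- \<tau>)" by (simp add: \<tau>_def complex_eq_iff)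
    moreover have "exp (Complex 0 (pi / 2)) = \<i>" by (simp add: exp_eq_polar complex_eq_iff)
    ultimately show ?thesis by (simp only: q_def qt_def exp_add)
  qed
  have nq: "norm q < 1" using t by (simp add: q_def norm_qt)
  have p: "norm (- (q\<^sup>2)) < 1" using nq by (simp add: norm_power power_less_one_iff)
  have y: "- (q\<^sup>2) = exp (- 2 * \<tau>)" using exp_double[of "- \<tau>"] by (simp add: q power_mult_distrib)
  have qk: "q * (- (q\<^sup>2)) ^ k = \<i> * exp (- (of_nat (2 * k + 1) * \<tau>))" for k
    unfolding y unfolding q by (simp add: exp_of_nat_mult[symmetric] algebra_simps flip: exp_add)
  have L: "(\<lambda>k. - Ln (1 - \<i> * exp (- (of_nat (2 * k + 1) * \<tau>)))) sums Lq q"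
    using qlog_Ln_sums[OF nq p] unfolding qk Lq_def .
  have ray': "Re (\<i> * exp (- (of_real x * \<tau>))) \<le> 1 - 1 / D" if "x \<ge> 0" for x
  proof -
    have "Re (\<i> * exp (- (of_real x * \<tau>))) = exp (- (x * t)) * sin (v * (x * t))"
      by (simp add: \<tau>_def Im_exp mult_ac)
    also have "\<dots> \<le> 1 - 1 / D" using that t by (intro ray) auto
    finally show ?thesis .
  qed
  have "norm (2 * \<tau> * Lq q - dilog \<i>) \<le> D ^ 2 * norm \<tau> ^ 3 * (1 / (1 - exp (- 2 * Re \<tau>)))"
    by (rule midpoint_limit[OF _ tau D ray' L]) simp
  moreover have "norm (2 * \<tau> * Lq q - dilog \<i>) = norm (2 * \<tau>) * norm (Lq q - dilog \<i> / (2 * \<tau>))"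
    unfolding norm_mult[symmetric] using tau by (auto simp: algebra_simps)
  moreover have "D ^ 2 * norm \<tau> ^ 3 * W = norm (2 * \<tau>) * (D ^ 2 * norm \<tau> ^ 2 / 2 * W)" for W
    by (simp add: norm_mult power3_eq_cube power2_eq_square)
  ultimately have "norm (2 * \<tau>) * norm (Lq q - dilog \<i> / (2 * \<tau>)) \<le> norm (2 * \<tau>) * (D ^ 2 * norm \<tau> ^ 2 / 2 * (1 / (1 - exp (- 2 * Re \<tau>))))"
    by metis
  moreover have nt: "norm (2 * \<tau>) > 0" using tau by auto
  ultimately have "norm (Lq q - dilog \<i> / (2 * \<tau>)) \<le> D ^ 2 * norm \<tau> ^ 2 / 2 * (1 / (1 - exp (- 2 * Re \<tau>)))"
    using mult_le_cancel_left_pos by blast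
  also have "norm \<tau> ^ 2 = t\<^sup>2 * (1 + v\<^sup>2)" by (simp add: \<tau>_def cmod_power2 power_mult_distrib algebra_simps)
  also have "1 / (1 - exp (- 2 * Re \<tau>)) \<le> (1 / (2 * t)) * (101/100)"
  proof -
    have "2 * t * (100/101) \<le> 2 * t * (1 - t)" using t by (intro mult_left_mono) auto
    also have "\<dots> \<le> 1 - exp (- 2 * t)" using t by (intro one_minus_exp_ge) auto
    finally have "1 / (1 - exp (- 2 * t)) \<le> 1 / (2 * t * (100/101))" using t by (intro divide_left_mono mult_pos_pos) auto
    then show ?thesis by (simp add: \<tau>_def)
  qed
  then have "D ^ 2 * (t\<^sup>2 * (1 + v\<^sup>2)) / 2 * (1 / (1 - exp (- 2 * Re \<tau>))) \<le> D ^ 2 * (t\<^sup>2 * (1 + v\<^sup>2)) / 2 * ((1 / (2 * t)) * (101/100))"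
    by (intro mult_left_mono) auto
  also have "\<dots> = D\<^sup>2 * (1 + v\<^sup>2) * t / 4 * (101/100)" using t by (simp add: field_simps power2_eq_square)
  finally have err: "norm (Lq q - dilog \<i> / (2 * \<tau>)) \<le> D\<^sup>2 * (1 + v\<^sup>2) * t / 4 * (101/100)" .
  have N: "1 + v\<^sup>2 > 0" by (simp add: add_pos_nonneg)
  have "Re (dilog \<i> / (2 * \<tau>)) = ((Im (dilog \<i>) * v - pi\<^sup>2 / 48) / (2 * (1 + v\<^sup>2))) / t"
  proof -
    have "dilog \<i> / (2 * \<tau>) = dilog \<i> * Complex 1 (- v) / of_real (2 * t * (1 + v\<^sup>2))"
    proof -
      have "2 * \<tau> * Complex 1 (- v) = of_real (2 * t * (1 + v\<^sup>2))"
        by (simp add: \<tau>_def complex_eq_iff algebra_simps power2_eq_square)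
      moreover have "Complex 1 (- v) \<noteq> 0" by (simp add: complex_eq_iff)
      ultimately show ?thesis by (metis mult_divide_mult_cancel_right)
    qed
    then show ?thesis by (simp only: Re_divide_of_real) (simp add: Re_dilog_i algebra_simps)
  qed
  also have "\<dots> \<le> ((9176/10000 * v - 2056/10000) / (2 * (1 + v\<^sup>2))) / t"
  proof (intro divide_right_mono diff_mono mult_right_mono Im_dilog_i)
    have "(31415/10000)\<^sup>2 \<le> pi\<^sup>2" using pi_approx by (intro power_mono) auto
    then show "2056/10000 \<le> pi\<^sup>2 / 48" by (simp add: power2_eq_square)
  qed (use v t N in auto)
  finally have "Re (dilog \<i> / (2 * \<tau>)) \<le> ((9176/10000 * v - 2056/10000) / (2 * (1 + v\<^sup>2))) / t" .
  moreover have "Re (Lq q - dilog \<i> / (2 * \<tau>)) \<le> D\<^sup>2 * (1 + v\<^sup>2) * t / 4 * (101/100)"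
    using err complex_Re_le_cmod order_trans by blast
  ultimately show ?thesis unfolding q_def by simp
qed

context
  fixes t :: real
  assumes t: "0 < t" "t \<le> 642/100000"
begin

text \<open>This is the secondary maximum of the growth exponent, only about 10.6 percent below that
  of the peak at 0.\<close>

lemma quarter_arc_inner:
  assumes v: "0 \<le> v" "v \<le> 3"
  shows "Re (Lq (qt t (pi / 2 - v * t))) \<le> (1838/10000) / t + 27/100"
proof -
  have "Re (Lq (qt t (pi / 2 - v * t))) \<le> ((9176/10000 * v - 2056/10000) / (2 * (1 + v\<^sup>2))) / t + 4\<^sup>2 * (1 + v\<^sup>2) * t / 4 * (101/100)"
    by (rule quarter_arc_bound[OF t v(1)], simp, rule exp_sin_bound[of _ v 3 "3/10"]) (use v in \<open>auto simp: power2_eq_square\<close>)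
  moreover have "((9176/10000 * v - 2056/10000) / (2 * (1 + v\<^sup>2))) / t \<le> (1838/10000) / t"
  proof (intro divide_right_mono)
    \<comment> \<open>Completing the square; the maximum over \<open>v\<close> lies near
      1.25.\<close>
    have "0 \<le> (3676/10000) * (v - 9176/7352)\<^sup>2" by simp
    also have "\<dots> = 3676/10000 * v\<^sup>2 - 9176/10000 * v + 3676/10000 * (9176/7352)\<^sup>2" by (simp add: power2_eq_square algebra_simps)
    finally have "9176/10000 * v - 2056/10000 \<le> 1838/10000 * (2 * (1 + v\<^sup>2))" by (simp add: power2_eq_square)
    moreover have "2 * (1 + v\<^sup>2) > 0" by (simp add: add_pos_nonneg)
    ultimately show "(9176/10000 * v - 2056/10000) / (2 * (1 + v\<^sup>2)) \<le> 1838/10000"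
      using pos_divide_le_eq by blast
  qed (use t in auto)
  moreover have "4\<^sup>2 * (1 + v\<^sup>2) * t / 4 * (101/100) \<le> 27/100"
  proof -
    have "v\<^sup>2 \<le> 3\<^sup>2" using v by (intro power_mono) auto
    then have "(1 + v\<^sup>2) * t \<le> 10 * (642/100000)" using t by (intro mult_mono) auto
    moreover have "4\<^sup>2 * (1 + v\<^sup>2) * t / 4 * (101/100) = 16/4 * (101/100) * ((1 + v\<^sup>2) * t)" by simp
    ultimately show ?thesis by argo
  qed
  ultimately show ?thesis by argo
qed

lemma quarter_arc_outer:
  assumes v: "3 \<le> v" "v \<le> 8"
  shows "Re (Lq (qt t (pi / 2 - v * t))) \<le> (29/200) / t + 7/20"
proof -
  have N: "2 * (1 + v\<^sup>2) > 0" by (simp add: add_pos_nonneg)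
  have c: "1 \<le> (642/100000) / t" using t by (simp add: divide_simps)
  show ?thesis
  proof (cases "v \<le> 5")
    case True
    have "Re (Lq (qt t (pi / 2 - v * t))) \<le> ((9176/10000 * v - 2056/10000) / (2 * (1 + v\<^sup>2))) / t + 6\<^sup>2 * (1 + v\<^sup>2) * t / 4 * (101/100)"
      \<comment> \<open>With \<open>y0 = 1 / V\<close> the first condition of
        \<open>exp_sin_bound\<close> becomes \<open>V / (V + 1) \<le> B\<close>, hence
        \<open>D = V + 1\<close>; the second case below uses the same choice with
        \<open>V = 8\<close>.\<close>
      by (rule quarter_arc_bound[OF t], use v in simp, simp, rule exp_sin_bound[of _ v 5 "1/5"]) (use v True in \<open>auto simp: power2_eq_square\<close>)
    moreover have "((9176/10000 * v - 2056/10000) / (2 * (1 + v\<^sup>2))) / t \<le> (128/1000) / t"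
    proof (intro divide_right_mono)
      \<comment> \<open>The coefficients are rounded so that the quadratic to be shown nonnegative
        has the root 3.\<close>
      have "0 \<le> (v - 3) * (256/1000 * v - 149/1000)" using v by (intro mult_nonneg_nonneg) auto
      moreover have "(v - 3) * (256/1000 * v - 149/1000) = 256/1000 * v\<^sup>2 - 917/1000 * v + 447/1000" by (simp add: power2_eq_square field_simps)
      ultimately have "9176/10000 * v - 2056/10000 \<le> 128/1000 * (2 * (1 + v\<^sup>2))" using True by argo
      then show "(9176/10000 * v - 2056/10000) / (2 * (1 + v\<^sup>2)) \<le> 128/1000"
        using N pos_divide_le_eq by blast
    qed (use t in auto)
    moreover have "6\<^sup>2 * (1 + v\<^sup>2) * t / 4 * (101/100) \<le> 16/10"
    proof -
      have "v\<^sup>2 \<le> 5\<^sup>2" using v True by (intro power_mono) auto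
      then have "(1 + v\<^sup>2) * t \<le> 26 * (642/100000)" using t by (intro mult_mono) auto
      moreover have "6\<^sup>2 * (1 + v\<^sup>2) * t / 4 * (101/100) = 36/4 * (101/100) * ((1 + v\<^sup>2) * t)" by simp
      ultimately show ?thesis by argo
    qed
    ultimately show ?thesis using c by argo
  next
    case False
    have "Re (Lq (qt t (pi / 2 - v * t))) \<le> ((9176/10000 * v - 2056/10000) / (2 * (1 + v\<^sup>2))) / t + 9\<^sup>2 * (1 + v\<^sup>2) * t / 4 * (101/100)"
      by (rule quarter_arc_bound[OF t], use v in simp, simp, rule exp_sin_bound[of _ v 8 "1/8"]) (use v in \<open>auto simp: power2_eq_square\<close>)
    moreover have "((9176/10000 * v - 2056/10000) / (2 * (1 + v\<^sup>2))) / t \<le> (85/1000) / t"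
    proof (intro divide_right_mono)
      have "0 \<le> (v - 5) * (17/100 * v - 6/100)" using v False by (intro mult_nonneg_nonneg) auto
      moreover have "(v - 5) * (17/100 * v - 6/100) = 17/100 * v\<^sup>2 - 91/100 * v + 3/10" by (simp add: power2_eq_square field_simps)
      ultimately have "9176/10000 * v - 2056/10000 \<le> 85/1000 * (2 * (1 + v\<^sup>2))" using v by argo
      then show "(9176/10000 * v - 2056/10000) / (2 * (1 + v\<^sup>2)) \<le> 85/1000"
        using N pos_divide_le_eq by blast
    qed (use t in auto)
    moreover have "9\<^sup>2 * (1 + v\<^sup>2) * t / 4 * (101/100) \<le> 87/10"
    proof -
      have "v\<^sup>2 \<le> 8\<^sup>2" using v by (intro power_mono) auto
      then have "(1 + v\<^sup>2) * t \<le> 65 * (642/100000)" using t by (intro mult_mono) auto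
      moreover have "9\<^sup>2 * (1 + v\<^sup>2) * t / 4 * (101/100) = 81/4 * (101/100) * ((1 + v\<^sup>2) * t)" by simp
      ultimately show ?thesis by argo
    qed
    ultimately show ?thesis using c by argo
  qed
qed

lemma middle_bound:
  assumes "\<theta> \<in> {3 * t..pi / 2 - 3 * t} \<union> {pi / 2..pi - 3 * t}"
  shows "Re (Lq (qt t \<theta>)) \<le> (29/200) / t + 7/20"
proof (cases "\<theta> \<in> {pi / 2 - 8 * t..pi / 2 - 3 * t}")
  case True
  define v where "v = (pi / 2 - \<theta>) / t"
  have "v * t = pi / 2 - \<theta>" using t by (simp add: v_def)
  then have th: "\<theta> = pi / 2 - v * t" by simp
  have "3 \<le> v" "v \<le> 8" using True t by (auto simp: v_def divide_simps mult_ac)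
  then show ?thesis unfolding th by (rule quarter_arc_outer)
next
  case False
  then show ?thesis using assms by (intro mid_bound[OF t]) auto
qed

end

section \<open>The arcs near 0 and pi\<close>

lemma exp_cos_bound:
  fixes y u :: real
  assumes y: "0 \<le> y" and u: "0 \<le> u" "u \<le> 3"
  shows "- (exp (- y) * cos (u * y)) \<le> 1 - 1 / 3"
proof (cases "u * y \<le> pi / 2")
  case True
  then have "cos (u * y) \<ge> 0" using y u by (intro cos_ge_zero) (auto intro: order_trans[of _ 0])
  then have "exp (- y) * cos (u * y) \<ge> 0" by simp
  then show ?thesis by simp
next
  case False
  have "u * y \<le> 3 * y" using y u by (intro mult_right_mono) auto
  then have "y \<ge> 1/2" using False pi_gt3 by argo
  then have "exp (- y) \<le> exp (- (1/2))" by simp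
  also have "\<dots> \<le> 2/3" using exp_minus_le_inverse[of "1/2"] by (simp add: power2_eq_square)
  finally have e: "exp (- y) \<le> 2/3" .
  have "exp (- y) * (- cos (u * y)) \<le> exp (- y) * 1" by (intro mult_left_mono) (auto simp: minus_le_iff)
  then show ?thesis using e by simp
qed

context
  fixes t :: real
  assumes t: "0 < t" "t \<le> 642/100000"
begin

text \<open>Here \<omega> = -1 and the sample points are even multiples, so
  \<open>midpoint_limit_shifted\<close> applies to \<open>- 2 * Le\<close>. The value
  \<open>dilog (- 1) = - pi\<^sup>2 / 12\<close> gives the main term and \<open>Ln 2\<close> the
  constant; \<open>D = 3\<close> comes from \<open>exp_cos_bound\<close>.\<close>

lemma Le_asymptotic:
  assumes u: "0 \<le> u" "u \<le> 3"
  shows "norm (Le (qt t (u * t)) - (of_real (pi\<^sup>2 / 48 / t / (1 + u\<^sup>2)) * Complex 1 u - of_real (ln 2 / 4)))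
     \<le> 9 * (1 + u\<^sup>2) * t / 8 * (101/100) + 3 * (1 + u) * t / 4"
proof -
  define q where "q = qt t (u * t)"
  define \<tau> where "\<tau> = Complex t (- (u * t))"
  have tau: "Re \<tau> > 0" using t by (simp add: \<tau>_def)
  have tau0: "\<tau> \<noteq> 0" using tau by auto
  have q: "q = exp (- \<tau>)"
    unfolding q_def qt_def \<tau>_def by (rule arg_cong[of _ _ exp]) (simp add: complex_eq_iff)
  have nq: "norm q < 1" using t by (simp add: q_def norm_qt)
  have qk: "1 + q ^ (2 * k + 2) = 1 - (- 1) * exp (- (of_nat (2 * k + 2) * \<tau>))" for k
    unfolding q exp_of_nat_mult[symmetric] by simp
  have L: "(\<lambda>k. - Ln (1 - (- 1) * exp (- (of_nat (2 * k + 2) * \<tau>)))) sums (- 2 * Le q)"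
    using Le_Ln_sums[OF nq] unfolding qk .
  have ray: "Re (- 1 * exp (- (of_real x * \<tau>))) \<le> 1 - 1 / 3" if "x \<ge> 0" for x
  proof -
    have "Re (- 1 * exp (- (of_real x * \<tau>))) = - (exp (- (x * t)) * cos (u * (x * t)))"
      by (simp add: \<tau>_def Re_exp mult_ac)
    also have "\<dots> \<le> 1 - 1 / 3" using that t u by (intro exp_cos_bound) auto
    finally show ?thesis .
  qed
  have ln2: "Ln (1 - (- 1)) = of_real (ln 2)" by (simp flip: Ln_of_real)
  define W where "W = 1 / (1 - exp (- 2 * Re \<tau>))"
  have "norm (2 * \<tau> * (- 2 * Le q) - dilog (- 1) - \<tau> * Ln (1 - (- 1))) \<le> 3 ^ 2 * norm \<tau> ^ 3 * W + 3 * norm \<tau> ^ 2"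
    unfolding W_def by (rule midpoint_limit_shifted[OF _ tau _ ray L]) auto
  moreover have "2 * \<tau> * (- 2 * Le q) - dilog (- 1) - \<tau> * Ln (1 - (- 1)) = - (4 * \<tau>) * (Le q - (of_real (pi\<^sup>2 / 48) / \<tau> - of_real (ln 2 / 4)))"
    unfolding ln2 dilog_minus_one using tau0 by (simp add: field_simps)
  moreover have "3 ^ 2 * norm \<tau> ^ 3 * W + 3 * norm \<tau> ^ 2 = norm (- (4 * \<tau>)) * (9 * norm \<tau> ^ 2 * W / 4 + 3 * norm \<tau> / 4)"
    by (simp add: norm_mult power3_eq_cube power2_eq_square algebra_simps)
  ultimately have "norm (- (4 * \<tau>)) * norm (Le q - (of_real (pi\<^sup>2 / 48) / \<tau> - of_real (ln 2 / 4))) \<le> norm (- (4 * \<tau>)) * (9 * norm \<tau> ^ 2 * W / 4 + 3 * norm \<tau> / 4)"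
    by (simp only: norm_mult)
  moreover have "norm (- (4 * \<tau>)) > 0" using tau0 by simp
  ultimately have 1: "norm (Le q - (of_real (pi\<^sup>2 / 48) / \<tau> - of_real (ln 2 / 4))) \<le> 9 * norm \<tau> ^ 2 * W / 4 + 3 * norm \<tau> / 4"
    using mult_le_cancel_left_pos by blast
  have n2: "norm \<tau> ^ 2 = t\<^sup>2 * (1 + u\<^sup>2)" by (simp add: \<tau>_def cmod_power2 power_mult_distrib algebra_simps)
  have n1: "norm \<tau> \<le> t * (1 + u)"
    using cmod_le[of \<tau>] t u by (simp add: \<tau>_def algebra_simps)
  have W: "W \<le> (1 / (2 * t)) * (101/100)"
  proof -
    have "2 * t * (100/101) \<le> 2 * t * (1 - t)" using t by (intro mult_left_mono) auto
    also have "\<dots> \<le> 1 - exp (- 2 * t)" using t by (intro one_minus_exp_ge) auto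
    finally have "1 / (1 - exp (- 2 * t)) \<le> 1 / (2 * t * (100/101))" using t by (intro divide_left_mono mult_pos_pos) auto
    then show ?thesis by (simp add: \<tau>_def W_def)
  qed
  have "9 * norm \<tau> ^ 2 * W / 4 + 3 * norm \<tau> / 4 \<le> 9 * (t\<^sup>2 * (1 + u\<^sup>2)) * ((1 / (2 * t)) * (101/100)) / 4 + 3 * (t * (1 + u)) / 4"
    unfolding n2 using W n1 by (intro add_mono divide_right_mono mult_left_mono) auto
  also have "\<dots> = 9 * (1 + u\<^sup>2) * t / 8 * (101/100) + 3 * (1 + u) * t / 4"
    using t by (simp add: field_simps power2_eq_square)
  finally have 2: "norm (Le q - (of_real (pi\<^sup>2 / 48) / \<tau> - of_real (ln 2 / 4))) \<le> 9 * (1 + u\<^sup>2) * t / 8 * (101/100) + 3 * (1 + u) * t / 4"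
    using 1 by (rule order_trans[rotated])
  have "of_real (pi\<^sup>2 / 48) / \<tau> = of_real (pi\<^sup>2 / 48 / t / (1 + u\<^sup>2)) * Complex 1 u"
  proof -
    have N: "1 + u\<^sup>2 \<noteq> 0" using add_pos_nonneg[OF zero_less_one zero_le_power2[of u]] by simp
    have "\<tau> * Complex 1 u = of_real (t * (1 + u\<^sup>2))"
      by (simp add: \<tau>_def complex_eq_iff algebra_simps power2_eq_square)
    then have "\<tau> * (of_real (pi\<^sup>2 / 48 / t / (1 + u\<^sup>2)) * Complex 1 u) = of_real (pi\<^sup>2 / 48 / t / (1 + u\<^sup>2)) * of_real (t * (1 + u\<^sup>2))"
      by (metis mult.left_commute)
    also have "\<dots> = of_real (pi\<^sup>2 / 48)"
    proof -
      have "P / t / N * (t * N) = P" if "N \<noteq> 0" for P N using t that by simp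
      from this[OF N] show ?thesis by (simp only: of_real_mult[symmetric])
    qed
    finally show ?thesis using tau0 by (metis nonzero_mult_div_cancel_left)
  qed
  then show ?thesis using 2 unfolding q_def by simp
qed

definition growth where "growth = pi\<^sup>2 / 48 / t"

lemma Le_bounds:
  assumes u: "0 \<le> u" "u \<le> 3" and e: "9 * (1 + u\<^sup>2) * t / 8 * (101/100) + 3 * (1 + u) * t / 4 \<le> e"
  shows "\<bar>Re (Le (qt t (u * t))) - (growth / (1 + u\<^sup>2) - ln 2 / 4)\<bar> \<le> e"
    and "\<bar>Im (Le (qt t (u * t))) - growth / (1 + u\<^sup>2) * u\<bar> \<le> e"
proof -
  define w where "w = Le (qt t (u * t)) - (of_real (pi\<^sup>2 / 48 / t / (1 + u\<^sup>2)) * Complex 1 u - of_real (ln 2 / 4))"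
  have w: "norm w \<le> e" unfolding w_def using Le_asymptotic[OF u] e by (rule order_trans)
  have "Re w = Re (Le (qt t (u * t))) - (growth / (1 + u\<^sup>2) - ln 2 / 4)" "Im w = Im (Le (qt t (u * t))) - growth / (1 + u\<^sup>2) * u"
    by (simp_all add: w_def growth_def)
  then show "\<bar>Re (Le (qt t (u * t))) - (growth / (1 + u\<^sup>2) - ln 2 / 4)\<bar> \<le> e"
    and "\<bar>Im (Le (qt t (u * t))) - growth / (1 + u\<^sup>2) * u\<bar> \<le> e"
    using w abs_Re_le_cmod[of w] abs_Im_le_cmod[of w] by (metis order_trans)+
qed

lemma error_half:
  assumes u: "0 \<le> u" "u \<le> 1/2"
  shows "9 * (1 + u\<^sup>2) * t / 8 * (101/100) + 3 * (1 + u) * t / 4 \<le> 2/100"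
proof -
  have "u\<^sup>2 \<le> (1/2)\<^sup>2" using u by (intro power_mono) auto
  then have "(1 + u\<^sup>2) * t \<le> 5/4 * (642/100000)" using t by (intro mult_mono) (auto simp: power2_eq_square)
  moreover have "(1 + u) * t \<le> 3/2 * (642/100000)" using t u by (intro mult_mono) auto
  moreover have "9 * (1 + u\<^sup>2) * t / 8 * (101/100) = 9/8 * (101/100) * ((1 + u\<^sup>2) * t)" "3 * (1 + u) * t / 4 = 3/4 * ((1 + u) * t)" by simp_all
  ultimately show ?thesis by argo
qed

lemma error_three:
  assumes u: "0 \<le> u" "u \<le> 3"
  shows "9 * (1 + u\<^sup>2) * t / 8 * (101/100) + 3 * (1 + u) * t / 4 \<le> 1/10"
proof -
  have "u\<^sup>2 \<le> 3\<^sup>2" using u by (intro power_mono) auto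
  then have "(1 + u\<^sup>2) * t \<le> 10 * (642/100000)" using t by (intro mult_mono) (auto simp: power2_eq_square)
  moreover have "(1 + u) * t \<le> 4 * (642/100000)" using t u by (intro mult_mono) auto
  moreover have "9 * (1 + u\<^sup>2) * t / 8 * (101/100) = 9/8 * (101/100) * ((1 + u\<^sup>2) * t)" "3 * (1 + u) * t / 4 = 3/4 * ((1 + u) * t)" by simp_all
  ultimately show ?thesis by argo
qed

lemma growth_split: "growth / (1 + u\<^sup>2) = growth - growth * u\<^sup>2 / (1 + u\<^sup>2)"
proof -
  have "1 + u\<^sup>2 > 0" by (simp add: add_pos_nonneg)
  then show ?thesis by (simp add: field_simps)
qed

lemma near_zero_Re_upper:
  assumes u: "0 \<le> u" "u \<le> 3" and e: "9 * (1 + u\<^sup>2) * t / 8 * (101/100) + 3 * (1 + u) * t / 4 \<le> e"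
  shows "Re (Lq (qt t (u * t))) \<le> growth - ln 2 / 4 + Lo0 t - growth * u\<^sup>2 / (1 + u\<^sup>2) + u\<^sup>2 / 8 + e"
proof -
  have "norm (qt t (u * t)) < 1" using t by (simp add: norm_qt)
  then have "Re (Lq (qt t (u * t))) = Re (Le (qt t (u * t))) + Re (Lo (qt t (u * t)))" by (simp add: Lq_split)
  then show ?thesis using Le_bounds(1)[OF u e] Lo_Re_upper[OF t(1), of u] growth_split[of u] by argo
qed

lemma near_zero_Re_lower:
  assumes u: "0 \<le> u" "u \<le> 3" and e: "9 * (1 + u\<^sup>2) * t / 8 * (101/100) + 3 * (1 + u) * t / 4 \<le> e"
  shows "growth - ln 2 / 4 + Lo0 t - growth * u\<^sup>2 / (1 + u\<^sup>2) - 5/4 * u\<^sup>2 - e \<le> Re (Lq (qt t (u * t)))"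
proof -
  have "norm (qt t (u * t)) < 1" using t by (simp add: norm_qt)
  then have "Re (Lq (qt t (u * t))) = Re (Le (qt t (u * t))) + Re (Lo (qt t (u * t)))" by (simp add: Lq_split)
  then show ?thesis using Le_bounds(1)[OF u e] Lo_Re_lower[OF t(1) u] growth_split[of u] by argo
qed

text \<open>Only the linear part \<open>growth * u\<close> of the phase is large; it is the part
  that the factor \<open>cis (- (n * \<theta>))\<close> cancels later. What remains is cubic in
  \<open>u\<close> apart from the bounded contributions of \<open>Lo\<close> and of the
  error.\<close>

lemma near_zero_Im:
  assumes u: "0 \<le> u" "u \<le> 1/2"
  shows "\<bar>Im (Lq (qt t (u * t))) - growth * u\<bar> \<le> growth * u ^ 3 + 2/3 * u + 2/100"
proof -
  have "norm (qt t (u * t)) < 1" using t by (simp add: norm_qt)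
  then have "Im (Lq (qt t (u * t))) = Im (Le (qt t (u * t))) + Im (Lo (qt t (u * t)))" by (simp add: Lq_split)
  moreover have "\<bar>Im (Le (qt t (u * t))) - growth / (1 + u\<^sup>2) * u\<bar> \<le> 2/100"
    by (rule Le_bounds(2)[OF _ _ error_half[OF u]]) (use u in auto)
  moreover have "\<bar>Im (Lo (qt t (u * t)))\<bar> \<le> 2/3 * u" by (rule Lo_Im_bound[OF t(1) u])
  moreover have "growth / (1 + u\<^sup>2) * u = growth * u - growth * u\<^sup>2 / (1 + u\<^sup>2) * u"
    unfolding growth_split by (simp add: algebra_simps)
  moreover have "growth * u\<^sup>2 / (1 + u\<^sup>2) * u \<ge> 0" using t u by (auto simp: growth_def)
  moreover have "growth * u\<^sup>2 / (1 + u\<^sup>2) * u \<le> growth * u ^ 3"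
  proof -
    have "growth * u ^ 3 \<ge> 0" using t u by (auto simp: growth_def)
    have "growth * u ^ 3 / (1 + u\<^sup>2) \<le> growth * u ^ 3 / 1" using \<open>growth * u ^ 3 \<ge> 0\<close> by (intro divide_left_mono) (auto simp: add_pos_nonneg)
    then show ?thesis by (simp add: power3_eq_cube power2_eq_square mult_ac)
  qed
  ultimately show ?thesis by argo
qed

text \<open>The point at pi - u t is the conjugate of -q for the q at u t, so \<open>Le\<close>
  stays and \<open>Lo\<close> changes sign. An upper bound at pi thus needs the lower bound of
  \<open>Lo\<close> at 0.\<close>

lemma near_pi_Re:
  assumes u: "0 \<le> u" "u \<le> 3" and e: "9 * (1 + u\<^sup>2) * t / 8 * (101/100) + 3 * (1 + u) * t / 4 \<le> e"
  shows "Re (Lq (qt t (pi - u * t))) \<le> growth - ln 2 / 4 - Lo0 t - growth * u\<^sup>2 / (1 + u\<^sup>2) + 5/4 * u\<^sup>2 + e"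
proof -
  define q where "q = qt t (u * t)"
  have nq: "norm q < 1" using t by (simp add: q_def norm_qt)
  have "qt t (pi - u * t) = cnj (- q)"
    unfolding q_def qt_eq by (simp add: complex_eq_iff)
  then have "Lq (qt t (pi - u * t)) = cnj (Lq (- q))" using nq by (simp only: Lq_cnj norm_minus_cancel)
  also have "Lq (- q) = Le q - Lo q" using nq by (simp add: Lq_split Le_uminus Lo_uminus)
  finally have "Re (Lq (qt t (pi - u * t))) = Re (Le q) - Re (Lo q)" by simp
  then show ?thesis using Le_bounds(1)[OF u e] Lo_Re_lower[OF t(1) u] growth_split[of u] unfolding q_def by argo
qed

end

lemma inverse_cosh_ge: "1 - x\<^sup>2 / 2 \<le> 1 / cosh x" if "x \<ge> 0" for x :: real
proof -
  define S where "S = (sinh (x / 2))\<^sup>2"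
  have S0: "S \<ge> 0" by (simp add: S_def)
  have "sinh (x / 2) \<le> x / 2 * cosh (x / 2)" using that by (intro sinh_le_mult_cosh) auto
  then have "S \<le> (x / 2 * cosh (x / 2))\<^sup>2" unfolding S_def using that by (intro power_mono) auto
  also have "\<dots> = x\<^sup>2 / 4 * (1 + S)" by (simp add: S_def power_mult_distrib power_divide cosh_square_eq add.commute)
  finally have "2 * S \<le> x\<^sup>2 / 2 * (1 + S)" by simp
  also have "\<dots> \<le> x\<^sup>2 / 2 * (1 + 2 * S)" using S0 by (intro mult_left_mono) auto
  finally have "(1 - x\<^sup>2 / 2) * (1 + 2 * S) \<le> 1" by (simp add: algebra_simps)
  moreover have "cosh x = 1 + 2 * S"
    using cosh_double[of "x / 2"] by (simp add: S_def cosh_square_eq)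
  ultimately show ?thesis using S0 by (simp add: field_simps)
qed

text \<open>Fifty odd terms: without the hyperbolic cosine they give at least 1.467, and the
  correction \<open>t\<^sup>2 / 4 * 2500\<close> is below 0.026.\<close>

lemma Lo0_ge:
  assumes t: "0 < t" "t \<le> 642/100000"
  shows "144/100 \<le> Lo0 t"
proof -
  define f where "f m = (if odd m then 1 / (2 * real m * cosh (real m * t)) else 0)" for m :: nat
  have f: "f sums Lo0 t" unfolding f_def[abs_def] by (rule Lo0_sums[OF t(1)])
  have "(\<lambda>k. f (2 * k + 1)) sums Lo0 t"
    using f unfolding f_def sums_odd_iff by simp
  then have "(\<Sum>k<50. f (2 * k + 1)) \<le> Lo0 t"
    using sum_le_suminf[of "\<lambda>k. f (2 * k + 1)" "{..<50}"] by (auto simp: sums_iff f_def)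
  moreover have "f (2 * k + 1) \<ge> 1 / (2 * real (2 * k + 1)) - t\<^sup>2 / 4 * real (2 * k + 1)" for k
  proof -
    define x where "x = real (2 * k + 1)"
    have x: "x > 0" by (simp add: x_def)
    have "(1 - (x * t)\<^sup>2 / 2) / (2 * x) \<le> (1 / cosh (x * t)) / (2 * x)"
      using t x by (intro divide_right_mono inverse_cosh_ge) auto
    moreover have "(1 - (x * t)\<^sup>2 / 2) / (2 * x) = 1 / (2 * x) - t\<^sup>2 / 4 * x"
      using x by (simp add: field_simps power2_eq_square)
    moreover have "f (2 * k + 1) = (1 / cosh (x * t)) / (2 * x)" by (simp add: f_def x_def mult.commute)
    ultimately show ?thesis unfolding x_def by argo
  qed
  then have "(\<Sum>k<50. 1 / (2 * real (2 * k + 1)) - t\<^sup>2 / 4 * real (2 * k + 1)) \<le> (\<Sum>k<50. f (2 * k + 1))"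
    by (intro sum_mono)
  moreover have "(\<Sum>k<50. 1 / (2 * real (2 * k + 1)) - t\<^sup>2 / 4 * real (2 * k + 1)) = (\<Sum>k<50. 1 / (2 * real (2 * k + 1))) - t\<^sup>2 / 4 * (\<Sum>k<50. real (2 * k + 1))"
    by (simp add: sum_subtractf sum_distrib_left)
  moreover have "(\<Sum>k<(50::nat). real (2 * k + 1)) = 2500" by (simp add: numeral_eq_Suc)
  moreover have "(\<Sum>k<(50::nat). 1 / (2 * real (2 * k + 1))) \<ge> 1467/1000"
    by (simp add: numeral_eq_Suc)
  moreover have "t\<^sup>2 \<le> (642/100000)\<^sup>2" using t by (intro power_mono) auto
  ultimately show ?thesis by (simp add: power2_eq_square)
qed

section \<open>Positivity of the large coefficients\<close>

text \<open>On every arc the integrand gets a minorant with an elementary antiderivative, which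
  avoids integrals of Gaussians.\<close>

lemma integral_ge_antiderivative:
  fixes f \<psi> \<Psi> :: "real \<Rightarrow> real" and l h :: real
  assumes ab: "l \<le> h" and f: "continuous_on {l..h} f"
    and d: "\<And>x. x \<in> {l..h} \<Longrightarrow> (\<Psi> has_real_derivative \<psi> x) (at x)"
    and le: "\<And>x. x \<in> {l..h} \<Longrightarrow> \<psi> x \<le> f x"
  shows "\<Psi> h - \<Psi> l \<le> integral {l..h} f"
proof -
  have "(\<psi> has_integral (\<Psi> h - \<Psi> l)) {l..h}"
    by (intro fundamental_theorem_of_calculus ab)
       (auto intro!: DERIV_subset[OF d] simp flip: has_real_derivative_iff_has_vector_derivative)
  moreover have "(f has_integral integral {l..h} f) {l..h}"
    by (intro integrable_integral integrable_continuous_interval f)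
  ultimately show ?thesis by (rule has_integral_le) (use le in auto)
qed

lemma integral_ge_const:
  fixes f :: "real \<Rightarrow> real" and l h c :: real
  assumes "l \<le> h" "continuous_on {l..h} f" "\<And>x. x \<in> {l..h} \<Longrightarrow> c \<le> f x"
  shows "c * (h - l) \<le> integral {l..h} f"
proof -
  have "((\<lambda>x. c * x) has_real_derivative c) (at x)" for x by (auto intro!: derivative_eq_intros)
  from integral_ge_antiderivative[OF assms(1,2) this assms(3)] show ?thesis by (simp add: right_diff_distrib)
qed

text \<open>The quadratic Taylor bound at \<open>x / m\<close>, raised to the power
  \<open>m\<close>, is sharp enough for numerical bounds and evaluates by arithmetic alone.\<close>

lemma exp_minus_le_power:
  fixes x :: real
  assumes "x \<ge> 0" "m > 0"
  shows "exp (- x) \<le> 1 / (1 + x / real m + (x / real m)\<^sup>2 / 2) ^ m"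
proof -
  have "exp (- x) = exp (- (x / real m)) ^ m" using assms by (simp flip: exp_of_nat_mult)
  also have "\<dots> \<le> (1 / (1 + x / real m + (x / real m)\<^sup>2 / 2)) ^ m"
    using assms by (intro power_mono exp_minus_le_inverse) auto
  finally show ?thesis by (simp add: power_one_over)
qed

text \<open>The left side decreases for \<open>s \<ge> 1 / (2 * \<alpha>)\<close>, which is at most
  32 here, so the value at 32 bounds it; 5.657 bounds the square root of 32.\<close>

lemma sqrt_mult_exp_le:
  fixes s \<alpha> :: real
  assumes s: "s \<ge> 32" and \<alpha>: "\<alpha> \<ge> 1/64"
  shows "sqrt s * exp (- \<alpha> * s) \<le> 5657/1000 * exp (- \<alpha> * 32)"
proof -
  have "s / 32 \<le> exp ((s - 32) / 32)"
    using exp_ge_add_one_self[of "(s - 32) / 32"] by (simp add: diff_divide_distrib)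
  also have "\<dots> = (exp ((s - 32) / 64))\<^sup>2" by (simp flip: exp_double)
  finally have "s / 32 \<le> (exp ((s - 32) / 64))\<^sup>2" .
  then have "sqrt (s / 32) \<le> exp ((s - 32) / 64)" by (intro real_le_lsqrt) auto
  then have 1: "sqrt s \<le> sqrt 32 * exp ((s - 32) / 64)" by (simp add: real_sqrt_divide field_simps)
  have "sqrt 32 \<le> 5657/1000" by (intro real_le_lsqrt) (auto simp: power2_eq_square)
  then have "sqrt s \<le> 5657/1000 * exp ((s - 32) / 64)" using 1 by (meson exp_ge_zero mult_right_mono order_trans)
  then have "sqrt s * exp (- \<alpha> * s) \<le> 5657/1000 * exp ((s - 32) / 64) * exp (- \<alpha> * s)" by (intro mult_right_mono) auto
  also have "\<dots> = 5657/1000 * exp ((s - 32) / 64 + - \<alpha> * s)" by (simp only: exp_add mult.assoc)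
  also have "\<dots> \<le> 5657/1000 * exp (- \<alpha> * 32)"
  proof -
    have "(1/64) * (s - 32) \<le> \<alpha> * (s - 32)" using s \<alpha> by (intro mult_right_mono) auto
    then have "(s - 32) / 64 + - \<alpha> * s \<le> - \<alpha> * 32" by (simp add: algebra_simps)
    then show ?thesis by simp
  qed
  finally show ?thesis .
qed

text \<open>As in \<open>sqrt_mult_exp_le\<close>, with decrease from
  \<open>3 / (2 * \<alpha>)\<close> on; one factor \<open>s\<close> is absorbed by lowering \<alpha>
  by 1/32.\<close>

lemma mult_sqrt_exp_le:
  fixes s \<alpha> :: real
  assumes s: "s \<ge> 32" and \<alpha>: "\<alpha> \<ge> 3/64"
  shows "s * sqrt s * exp (- \<alpha> * s) \<le> 32 * (5657/1000) * exp (- \<alpha> * 32)"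
proof -
  have "s / 32 \<le> exp ((s - 32) / 32)"
    using exp_ge_add_one_self[of "(s - 32) / 32"] by (simp add: diff_divide_distrib)
  then have "s \<le> 32 * exp ((s - 32) / 32)" by simp
  then have "s * (sqrt s * exp (- \<alpha> * s)) \<le> (32 * exp ((s - 32) / 32)) * (sqrt s * exp (- \<alpha> * s))"
    using s by (intro mult_right_mono) auto
  also have "\<dots> = 32 * exp (- 1) * (sqrt s * exp (- (\<alpha> - 1/32) * s))"
  proof -
    have "exp ((s - 32) / 32) * exp (- \<alpha> * s) = exp (- 1) * exp (- (\<alpha> - 1/32) * s)"
      unfolding exp_add[symmetric] by (rule arg_cong[of _ _ exp]) (simp add: field_simps)
    then show ?thesis by (simp add: mult_ac)
  qed
  also have "\<dots> \<le> 32 * exp (- 1) * (5657/1000 * exp (- (\<alpha> - 1/32) * 32))"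
    using s \<alpha> by (intro mult_left_mono sqrt_mult_exp_le) auto
  also have "\<dots> = 32 * (5657/1000) * (exp (- 1) * exp (- (\<alpha> - 1/32) * 32))" by simp
  also have "exp (- 1) * exp (- (\<alpha> - 1/32) * 32) = exp (- \<alpha> * 32)"
    unfolding exp_add[symmetric] by (rule arg_cong[of _ _ exp]) (simp add: field_simps)
  finally show ?thesis by (simp add: mult_ac)
qed

text \<open>On the given range the left side is largest at \<open>u = 1/2\<close>, where it equals
  the right side. The difference has the factor \<open>u\<^sup>2 - 1/4\<close>, whose coefficient is
  at least 32 * 4 / 50 - 2 > 0.\<close>

lemma exponent_comparison:
  fixes s u K :: real
  assumes "1/2 \<le> u" "u \<le> 3" "s \<ge> 32" "K \<le> 2"
  shows "- (s * u\<^sup>2 / (1 + u\<^sup>2)) + K * u\<^sup>2 \<le> - s / 5 + K / 4"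
proof -
  have u: "1/4 \<le> u\<^sup>2" "u\<^sup>2 \<le> 9" using assms power_mono[of "1/2" u 2] power_mono[of u 3 2] by (auto simp: power2_eq_square)
  have "K * (u\<^sup>2 - 1/4) \<le> 2 * (u\<^sup>2 - 1/4)" using assms u by (intro mult_right_mono) auto
  also have "\<dots> \<le> 32 * (4 / 50) * (u\<^sup>2 - 1/4)" using u by (intro mult_right_mono) auto
  also have "\<dots> \<le> s * (4 / (5 * (1 + u\<^sup>2))) * (u\<^sup>2 - 1/4)"
    using u assms by (intro mult_right_mono mult_mono divide_left_mono) (auto simp: add_pos_nonneg)
  also have "\<dots> = s * u\<^sup>2 / (1 + u\<^sup>2) - s / 5"
  proof -
    have "1 + u\<^sup>2 > 0" using u by simp
    then show ?thesis by (simp add: field_simps)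
  qed
  finally show ?thesis by (simp add: algebra_simps)
qed

section \<open>Minorants of the integrand on the saddle point circle\<close>

context
  fixes n :: nat and t :: real
  assumes n: "n \<ge> 5000" and t_def: "t = pi / sqrt (48 * real n)"
begin

lemma t_pos: "t > 0" using n by (simp add: t_def)

lemma t_square: "t\<^sup>2 = pi\<^sup>2 / (48 * real n)" using n by (simp add: t_def power_divide)

lemma t_le: "t \<le> 642/100000"
proof (rule power2_le_imp_le)
  have "pi\<^sup>2 \<le> (31416/10000)\<^sup>2" using pi_approx by (intro power_mono) auto
  then have "pi\<^sup>2 / (48 * real n) \<le> (31416/10000)\<^sup>2 / (48 * 5000)" using n by (intro frac_le) auto
  then show "t\<^sup>2 \<le> (642/100000)\<^sup>2" unfolding t_square by (simp add: power2_eq_square)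
qed auto

private abbreviation "S \<equiv> growth t"

lemma S_def: "S = pi\<^sup>2 / 48 / t" by (rule growth_def[OF t_pos t_le])

text \<open>The radius is the saddle point, the minimum of pi^2 / (48 t) + n t, where both summands
  agree. Hence the phase n \<theta> at \<theta> = u t is S u, the linear term in
  \<open>near_zero_Im\<close>.\<close>

lemma n_t: "real n * t = S"
proof -
  have "real n * t\<^sup>2 = pi\<^sup>2 / 48" using n unfolding t_square by simp
  then show ?thesis unfolding S_def using t_pos by (simp add: field_simps power2_eq_square)
qed

text \<open>The threshold enters here: 5000 * pi^2 / 48 is about 1028, slightly above 32^2.\<close>

lemma S_ge: "S \<ge> 32"
proof (rule power2_le_imp_le)
  have "S\<^sup>2 = (real n * t) * S" by (simp add: n_t power2_eq_square)
  also have "\<dots> = real n * (pi\<^sup>2 / 48)" unfolding S_def using t_pos by simp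
  finally have S2: "S\<^sup>2 = real n * (pi\<^sup>2 / 48)" .
  have "(31415/10000)\<^sup>2 \<le> pi\<^sup>2" using pi_approx by (intro power_mono) auto
  then have "5000 * ((31415/10000)\<^sup>2 / 48) \<le> real n * (pi\<^sup>2 / 48)" using n by (intro mult_mono) auto
  then show "32\<^sup>2 \<le> S\<^sup>2" unfolding S2 by (simp add: power2_eq_square)
  show "0 \<le> S" using t_pos by (simp add: S_def)
qed

text \<open>In the variable u = \<theta> / t the peak looks like exp (- S u^2), so its width is of
  order \<open>t / \<rho>\<close>.\<close>

private definition \<rho> where "\<rho> = sqrt S"

lemma rho: "\<rho> \<ge> 565/100" "\<rho>\<^sup>2 = S" "\<rho> > 0"
proof -
  show "\<rho>\<^sup>2 = S" using S_ge by (simp add: \<rho>_def)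
  show 1: "\<rho> \<ge> 565/100" unfolding \<rho>_def using S_ge by (intro real_le_rsqrt) (auto simp: power2_eq_square)
  show "\<rho> > 0" using 1 by simp
qed

private definition f where "f \<theta> = Re (exp (Lq (of_real (exp (- t)) * cis \<theta>)) * cis (- (real n * \<theta>)))"

lemma f_cont: "continuous_on A f"
proof -
  have "continuous_on UNIV (\<lambda>\<theta>. exp (Lq (of_real (exp (- t)) * cis \<theta>)) * cis (- (real n * \<theta>)))"
    by (rule a_integral(1)) (use t_pos in auto)
  then have "continuous_on UNIV f" unfolding f_def[abs_def] by (rule continuous_on_Re)
  then show ?thesis by (rule continuous_on_subset) auto
qed

lemma f_eq: "f \<theta> = exp (Re (Lq (qt t \<theta>))) * cos (Im (Lq (qt t \<theta>)) - real n * \<theta>)"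
proof -
  have "exp (Lq (qt t \<theta>)) * cis (- (real n * \<theta>)) = exp (Lq (qt t \<theta>) + Complex 0 (- (real n * \<theta>)))"
    by (simp add: exp_add exp_eq_polar[of "Complex 0 _"])
  then show ?thesis unfolding f_def qt_eq[symmetric] by (simp add: Re_exp)
qed

lemma f_lower: "Re (Lq (qt t \<theta>)) \<le> B \<Longrightarrow> - exp B \<le> f \<theta>"
proof -
  assume B: "Re (Lq (qt t \<theta>)) \<le> B"
  have "- exp (Re (Lq (qt t \<theta>))) \<le> f \<theta>"
    unfolding f_eq using mult_left_mono[OF cos_ge_minus_one, of "exp (Re (Lq (qt t \<theta>)))"] by simp
  then show ?thesis using B by (smt (verit) exp_le_cancel_iff)
qed

text \<open>The height of the peak at \<theta> = 0, up to the error of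
  \<open>Le_asymptotic\<close>.\<close>

private definition A where "A = exp (S - ln 2 / 4 + Lo0 t)"

lemma A_pos: "A > 0" by (simp add: A_def)

text \<open>The only arc that contributes positively to the final estimate. The Gaussian is replaced
  by its minorant 1 - S u^2, and 0.915 is at most 0.948 * 0.966, for the error in the modulus and
  the cosine of the phase.\<close>

lemma piece1:
  assumes \<theta>: "\<theta> \<in> {0..(9/10) / \<rho> * t}"
  shows "A * (915/1000) * (1 - S * (\<theta> / t)\<^sup>2) \<le> f \<theta>"
proof -
  define u where "u = \<theta> / t"
  have th: "\<theta> = u * t" using t_pos by (simp add: u_def)
  have u: "0 \<le> u" "u \<le> (9/10) / \<rho>" using \<theta> t_pos by (auto simp: u_def divide_simps)
  have "(9/10) / \<rho> \<le> (9/10) / (565/100)" using rho by (intro divide_left_mono) auto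
  then have u2: "u \<le> 16/100" using u by simp
  have uu: "u\<^sup>2 \<le> 256/10000" using power_mono[OF u2 u(1), of 2] by (simp add: power2_eq_square)
  have "u * \<rho> \<le> 9/10" using u rho by (simp add: divide_simps mult_ac)
  then have ur: "(u * \<rho>)\<^sup>2 \<le> (9/10)\<^sup>2" using u rho by (intro power_mono) auto
  have eq: "(u * \<rho>)\<^sup>2 = S * u\<^sup>2" by (simp add: power_mult_distrib rho(2))
  have Su: "S * u\<^sup>2 \<le> 81/100" using ur unfolding eq by (simp add: power2_eq_square)
  have Su3: "S * u ^ 3 \<le> 81/100 * (16/100)"
  proof -
    have "S * u\<^sup>2 * u \<le> 81/100 * (16/100)" using Su u u2 S_ge by (intro mult_mono) auto
    then show ?thesis by (simp add: power3_eq_cube power2_eq_square mult_ac)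
  qed
  have e: "9 * (1 + u\<^sup>2) * t / 8 * (101/100) + 3 * (1 + u) * t / 4 \<le> 2/100"
    by (rule error_half[OF t_pos t_le]) (use u u2 in auto)
  have R: "S - ln 2 / 4 + Lo0 t - S * u\<^sup>2 / (1 + u\<^sup>2) - 5/4 * u\<^sup>2 - 2/100 \<le> Re (Lq (qt t \<theta>))"
    unfolding th by (rule near_zero_Re_lower[OF t_pos t_le _ _ e]) (use u u2 in auto)
  have "S * u\<^sup>2 / (1 + u\<^sup>2) \<le> S * u\<^sup>2 / 1" using S_ge by (intro divide_left_mono) (auto simp: add_pos_nonneg)
  then have R2: "(S - ln 2 / 4 + Lo0 t) + (- (S * u\<^sup>2)) + (- (52/1000)) \<le> Re (Lq (qt t \<theta>))" using R uu by simp
  have "A * ((1 - S * u\<^sup>2) * (948/1000)) \<le> A * (exp (- (S * u\<^sup>2)) * exp (- (52/1000)))"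
  proof (intro mult_left_mono mult_mono)
    show "1 - S * u\<^sup>2 \<le> exp (- (S * u\<^sup>2))" using exp_ge_add_one_self[of "- (S * u\<^sup>2)"] by simp
    \<comment> \<open>The exponent 0.052 collects 5/4 * 0.0256 and the error 0.02.\<close>
    show "948/1000 \<le> exp (- (52/1000) :: real)" using exp_ge_add_one_self[of "- (52/1000) :: real"] by simp
  qed (use A_pos in auto)
  also have "\<dots> = exp ((S - ln 2 / 4 + Lo0 t) + (- (S * u\<^sup>2)) + (- (52/1000)))" by (simp only: A_def exp_add mult.assoc)
  also have "\<dots> \<le> exp (Re (Lq (qt t \<theta>)))" using R2 by simp
  finally have E: "A * ((1 - S * u\<^sup>2) * (948/1000)) \<le> exp (Re (Lq (qt t \<theta>)))" .
  define \<psi> where "\<psi> = Im (Lq (qt t \<theta>)) - real n * \<theta>"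
  have "\<bar>\<psi>\<bar> \<le> S * u ^ 3 + 2/3 * u + 2/100"
  proof -
    have e: "real n * (u * t) = S * u" by (simp add: n_t[symmetric])
    show ?thesis unfolding \<psi>_def th e by (rule near_zero_Im[OF t_pos t_le]) (use u u2 in auto)
  qed
  then have "\<bar>\<psi>\<bar> \<le> 257/1000" using Su3 u2 by simp
  then have "\<psi>\<^sup>2 \<le> (257/1000)\<^sup>2" using abs_le_square_iff[of \<psi> "257/1000"] by simp
  then have C: "966/1000 \<le> cos \<psi>" using one_minus_cos_le[of \<psi>] by (simp add: power2_eq_square)
  have "A * (915/1000) * (1 - S * u\<^sup>2) \<le> A * ((1 - S * u\<^sup>2) * (948/1000)) * (966/1000)"
  proof -
    define Y where "Y = A * (1 - S * u\<^sup>2)"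
    have "Y \<ge> 0" using Su A_pos by (simp add: Y_def)
    moreover have "A * (915/1000) * (1 - S * u\<^sup>2) = 915/1000 * Y"
      "A * ((1 - S * u\<^sup>2) * (948/1000)) * (966/1000) = (948/1000) * (966/1000) * Y" by (simp_all add: Y_def)
    ultimately show ?thesis by argo
  qed
  also have "\<dots> \<le> exp (Re (Lq (qt t \<theta>))) * cos \<psi>" using E C A_pos Su by (intro mult_mono) auto
  finally show ?thesis unfolding f_eq \<psi>_def u_def .
qed

text \<open>The end point 1.85 / \<rho> is chosen so that the phase stays below 3/2 < pi / 2, which
  makes the integrand nonnegative.\<close>

lemma piece2:
  assumes \<theta>: "\<theta> \<in> {(9/10) / \<rho> * t..(185/100) / \<rho> * t}"
  shows "0 \<le> f \<theta>"
proof -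
  define u where "u = \<theta> / t"
  have th: "\<theta> = u * t" using t_pos by (simp add: u_def)
  have "(9/10) / \<rho> \<le> u" "u \<le> (185/100) / \<rho>" using \<theta> t_pos by (auto simp: u_def divide_simps)
  moreover have "(9/10) / \<rho> > 0" using rho by simp
  ultimately have u: "0 \<le> u" "u \<le> (185/100) / \<rho>" by auto
  have "(185/100) / \<rho> \<le> (185/100) / (565/100)" using rho by (intro divide_left_mono) auto
  then have u2: "u \<le> 328/1000" using u by simp
  have "u * \<rho> \<le> 185/100" using u rho by (simp add: divide_simps mult_ac)
  then have ur: "(u * \<rho>)\<^sup>2 \<le> (185/100)\<^sup>2" using u rho by (intro power_mono) auto
  have eq: "(u * \<rho>)\<^sup>2 = S * u\<^sup>2" by (simp add: power_mult_distrib rho(2))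
  have Su: "S * u\<^sup>2 \<le> (185/100)\<^sup>2" using ur unfolding eq .
  have Su3: "S * u ^ 3 \<le> (185/100)\<^sup>2 * (328/1000)"
  proof -
    have "S * u\<^sup>2 * u \<le> (185/100)\<^sup>2 * (328/1000)" using Su u u2 S_ge by (intro mult_mono) auto
    then show ?thesis by (simp add: power3_eq_cube power2_eq_square mult_ac)
  qed
  define \<psi> where "\<psi> = Im (Lq (qt t \<theta>)) - real n * \<theta>"
  have "\<bar>\<psi>\<bar> \<le> S * u ^ 3 + 2/3 * u + 2/100"
  proof -
    have e: "real n * (u * t) = S * u" by (simp add: n_t[symmetric])
    show ?thesis unfolding \<psi>_def th e by (rule near_zero_Im[OF t_pos t_le]) (use u u2 in auto)
  qed
  then have "\<bar>\<psi>\<bar> \<le> 3/2" using Su3 u2 by (simp add: power2_eq_square)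
  then have "\<bar>\<psi>\<bar> \<le> pi / 2" using pi_gt3 by simp
  then have "cos \<psi> \<ge> 0" by (intro cos_ge_zero) auto
  then show ?thesis unfolding f_eq \<psi>_def by simp
qed

text \<open>The factor \<open>u / ((185/100) / \<rho>)\<close> is at least 1 on this arc; inserting
  it makes the Gaussian bound an exact derivative. The 8/10 is the least value of 1 / (1 + u^2) for
  u up to 1/2.\<close>

lemma piece3:
  assumes \<theta>: "\<theta> \<in> {(185/100) / \<rho> * t..t / 2}"
  shows "- (A * (1055/1000)) * (\<theta> / t / ((185/100) / \<rho>) * exp (- (8/10) * S * (\<theta> / t)\<^sup>2)) \<le> f \<theta>"
proof -
  define u where "u = \<theta> / t"
  have th: "\<theta> = u * t" using t_pos by (simp add: u_def)
  have u1: "(185/100) / \<rho> \<le> u" "u \<le> 1/2" using \<theta> t_pos by (auto simp: u_def divide_simps)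
  have p: "(185/100) / \<rho> > 0" using rho by simp
  have u: "0 \<le> u" using order_trans[OF less_imp_le[OF p] u1(1)] .
  have uu: "u\<^sup>2 \<le> 1/4" using power_mono[OF u1(2) u, of 2] by (simp add: power2_eq_square)
  have e: "9 * (1 + u\<^sup>2) * t / 8 * (101/100) + 3 * (1 + u) * t / 4 \<le> 2/100"
    by (rule error_half[OF t_pos t_le]) (use u u1 in auto)
  have R: "Re (Lq (qt t \<theta>)) \<le> S - ln 2 / 4 + Lo0 t - S * u\<^sup>2 / (1 + u\<^sup>2) + u\<^sup>2 / 8 + 2/100"
    unfolding th by (rule near_zero_Re_upper[OF t_pos t_le _ _ e]) (use u u1 in auto)
  have "S * u\<^sup>2 / (5/4) \<le> S * u\<^sup>2 / (1 + u\<^sup>2)" using S_ge uu by (intro divide_left_mono) (auto simp: add_pos_nonneg)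
  then have "Re (Lq (qt t \<theta>)) \<le> (S - ln 2 / 4 + Lo0 t) + 515/10000 + (- (8/10) * S * u\<^sup>2)" using R uu by simp
  then have "- exp ((S - ln 2 / 4 + Lo0 t) + 515/10000 + (- (8/10) * S * u\<^sup>2)) \<le> f \<theta>" by (rule f_lower)
  moreover have "exp ((S - ln 2 / 4 + Lo0 t) + 515/10000 + (- (8/10) * S * u\<^sup>2)) \<le> A * (1055/1000) * (u / ((185/100) / \<rho>) * exp (- (8/10) * S * u\<^sup>2))"
  proof -
    have "exp (515/10000) \<le> (1055/1000 :: real)"
      using exp_bound[of "515/10000 :: real"] by (simp add: power2_eq_square)
    moreover have "1 \<le> u / ((185/100) / \<rho>)" using u1 unfolding pos_le_divide_eq[OF p] by simp
    ultimately have "A * exp (515/10000) * (1 * exp (- (8/10) * S * u\<^sup>2)) \<le> A * (1055/1000) * (u / ((185/100) / \<rho>) * exp (- (8/10) * S * u\<^sup>2))"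
      using A_pos by (intro mult_mono mult_nonneg_nonneg) auto
    then show ?thesis by (simp only: A_def exp_add mult_1)
  qed
  ultimately show ?thesis unfolding u_def by simp
qed

text \<open>The additive constant collects 1/8 / 4 from \<open>exponent_comparison\<close> and the
  error 1/10.\<close>

lemma piece4:
  assumes \<theta>: "\<theta> \<in> {t / 2..3 * t}"
  shows "- (A * exp (- S / 5 + 1315/10000)) \<le> f \<theta>"
proof -
  define u where "u = \<theta> / t"
  have th: "\<theta> = u * t" using t_pos by (simp add: u_def)
  have u: "1/2 \<le> u" "u \<le> 3" using \<theta> t_pos by (auto simp: u_def divide_simps)
  have e: "9 * (1 + u\<^sup>2) * t / 8 * (101/100) + 3 * (1 + u) * t / 4 \<le> 1/10"
    by (rule error_three[OF t_pos t_le]) (use u in auto)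
  have "Re (Lq (qt t \<theta>)) \<le> S - ln 2 / 4 + Lo0 t - S * u\<^sup>2 / (1 + u\<^sup>2) + u\<^sup>2 / 8 + 1/10"
    unfolding th by (rule near_zero_Re_upper[OF t_pos t_le _ _ e]) (use u in auto)
  moreover have "- (S * u\<^sup>2 / (1 + u\<^sup>2)) + 1/8 * u\<^sup>2 \<le> - S / 5 + 1/8 / 4"
    by (rule exponent_comparison[OF u S_ge]) auto
  ultimately have "Re (Lq (qt t \<theta>)) \<le> (S - ln 2 / 4 + Lo0 t) + (- S / 5 + 1315/10000)" by argo
  from f_lower[OF this] show ?thesis by (simp only: exp_add A_def)
qed

lemma Lo0_exp: "exp (Lo0 t) \<ge> 41/10"
proof -
  have "(41/10 :: real) \<le> (1 + 36/100 + (36/100)\<^sup>2 / 2) ^ 4" by (simp add: power2_eq_square power_numeral_reduce)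
  also have "\<dots> \<le> exp (36/100) ^ 4" by (intro power_mono exp_lower_Taylor_quadratic) auto
  also have "\<dots> = exp (144/100)" by (simp flip: exp_of_nat_mult)
  also have "\<dots> \<le> exp (Lo0 t)" using Lo0_ge[OF t_pos t_le] by simp
  finally show ?thesis .
qed

text \<open>The peaks at pi and 0 differ by the factor \<open>exp (- 2 * Lo0 t)\<close>, at most 1 /
  4.1^2.\<close>

lemma near_pi_factor: "exp (S - ln 2 / 4 - Lo0 t) \<le> A * (100/1681)"
proof -
  have "exp (S - ln 2 / 4 - Lo0 t) = A * (1 / (exp (Lo0 t))\<^sup>2)"
    by (simp add: A_def exp_add exp_diff power2_eq_square)
  also have "\<dots> \<le> A * (1 / (41/10)\<^sup>2)"
    using A_pos Lo0_exp by (intro mult_left_mono divide_left_mono power_mono) auto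
  finally show ?thesis by (simp add: power2_eq_square)
qed

text \<open>The Gaussian exponent that remains near pi once the correction 5/4 u^2 is
  absorbed.\<close>

private definition k where "k = 8/10 * S - 5/4"

lemma k_ge: "k \<ge> 24" "S \<le> 132/100 * k" using S_ge by (auto simp: k_def)

lemma piece8:
  assumes \<theta>: "\<theta> \<in> {pi - 3 * t..pi - t / 2}"
  shows "- (A * (100/1681) * exp (- S / 5 + 4125/10000)) \<le> f \<theta>"
proof -
  define u where "u = (pi - \<theta>) / t"
  have "u * t = pi - \<theta>" using t_pos by (simp add: u_def)
  then have th: "\<theta> = pi - u * t" by simp
  have u: "1/2 \<le> u" "u \<le> 3" using \<theta> t_pos by (auto simp: u_def divide_simps)
  have e: "9 * (1 + u\<^sup>2) * t / 8 * (101/100) + 3 * (1 + u) * t / 4 \<le> 1/10"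
    by (rule error_three[OF t_pos t_le]) (use u in auto)
  have "Re (Lq (qt t \<theta>)) \<le> S - ln 2 / 4 - Lo0 t - S * u\<^sup>2 / (1 + u\<^sup>2) + 5/4 * u\<^sup>2 + 1/10"
    unfolding th by (rule near_pi_Re[OF t_pos t_le _ _ e]) (use u in auto)
  moreover have "- (S * u\<^sup>2 / (1 + u\<^sup>2)) + 5/4 * u\<^sup>2 \<le> - S / 5 + 5/4 / 4"
    by (rule exponent_comparison[OF u S_ge]) auto
  ultimately have "Re (Lq (qt t \<theta>)) \<le> (S - ln 2 / 4 - Lo0 t) + (- S / 5 + 4125/10000)" by argo
  from f_lower[OF this] have "- (exp (S - ln 2 / 4 - Lo0 t) * exp (- S / 5 + 4125/10000)) \<le> f \<theta>" by (simp only: exp_add)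
  moreover have "exp (S - ln 2 / 4 - Lo0 t) * exp (- S / 5 + 4125/10000) \<le> A * (100/1681) * exp (- S / 5 + 4125/10000)"
    by (intro mult_right_mono near_pi_factor) auto
  ultimately show ?thesis by argo
qed

lemma near_pi_gauss:
  assumes u: "0 \<le> u" "u \<le> 1/2" and \<theta>: "\<theta> = pi - u * t"
  shows "- (A * (100/1681) * (1021/1000) * exp (- k * u\<^sup>2)) \<le> f \<theta>"
proof -
  have uu: "u\<^sup>2 \<le> 1/4" using power_mono[OF u(2,1), of 2] by (simp add: power2_eq_square)
  have e: "9 * (1 + u\<^sup>2) * t / 8 * (101/100) + 3 * (1 + u) * t / 4 \<le> 2/100"
    by (rule error_half[OF t_pos t_le]) (use u in auto)
  have R: "Re (Lq (qt t \<theta>)) \<le> S - ln 2 / 4 - Lo0 t - S * u\<^sup>2 / (1 + u\<^sup>2) + 5/4 * u\<^sup>2 + 2/100"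
    unfolding \<theta> by (rule near_pi_Re[OF t_pos t_le _ _ e]) (use u in auto)
  have "S * u\<^sup>2 / (5/4) \<le> S * u\<^sup>2 / (1 + u\<^sup>2)" using S_ge uu by (intro divide_left_mono) (auto simp: add_pos_nonneg)
  then have "Re (Lq (qt t \<theta>)) \<le> (S - ln 2 / 4 - Lo0 t) + 2/100 + (- k * u\<^sup>2)" using R by (simp add: k_def algebra_simps)
  from f_lower[OF this] have "- (exp (S - ln 2 / 4 - Lo0 t) * exp (2/100) * exp (- k * u\<^sup>2)) \<le> f \<theta>" by (simp only: exp_add)
  moreover have "exp (S - ln 2 / 4 - Lo0 t) * exp (2/100) * exp (- k * u\<^sup>2) \<le> A * (100/1681) * (1021/1000) * exp (- k * u\<^sup>2)"
    using exp_bound[of "2/100 :: real"] A_pos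
    by (intro mult_right_mono mult_mono near_pi_factor) (auto simp: power2_eq_square)
  ultimately show ?thesis by argo
qed

text \<open>For \<open>k * u\<^sup>2 \<ge> 1\<close> the bound \<open>exp (- x) \<le> 1 / x\<close>
  has an elementary antiderivative; nearer to pi, in \<open>piece10\<close>, the Gaussian is bounded
  by 1.\<close>

lemma piece9:
  assumes \<theta>: "\<theta> \<in> {pi - t / 2..pi - t / sqrt k}"
  shows "- (A * (100/1681) * (1021/1000)) * (t\<^sup>2 / (k * (pi - \<theta>)\<^sup>2)) \<le> f \<theta>"
proof -
  define u where "u = (pi - \<theta>) / t"
  have ut: "u * t = pi - \<theta>" using t_pos by (simp add: u_def)
  then have th: "\<theta> = pi - u * t" by simp
  have sk: "sqrt k > 0" using k_ge by simp
  have u: "1 / sqrt k \<le> u" "u \<le> 1/2"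
  proof -
    have "1 / sqrt k * t \<le> u * t" using \<theta> ut by simp
    then show "1 / sqrt k \<le> u" using t_pos by (rule mult_right_le_imp_le)
    show "u \<le> 1/2" using \<theta> t_pos by (auto simp: u_def divide_simps)
  qed
  have u0: "u > 0" using less_le_trans[OF _ u(1), of 0] sk by simp
  have ku: "k * u\<^sup>2 > 0" using u0 k_ge by simp
  have "exp (- k * u\<^sup>2) \<le> 1 / (k * u\<^sup>2)"
  proof -
    have "k * u\<^sup>2 \<le> exp (k * u\<^sup>2)" using exp_ge_add_one_self[of "k * u\<^sup>2"] by linarith
    then have "1 / exp (k * u\<^sup>2) \<le> 1 / (k * u\<^sup>2)" using ku by (intro divide_left_mono) auto
    then show ?thesis by (simp add: exp_minus inverse_eq_divide)
  qed
  also have "\<dots> = t\<^sup>2 / (k * (pi - \<theta>)\<^sup>2)"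
    unfolding ut[symmetric] using t_pos by (simp add: power_mult_distrib)
  finally have "A * (100/1681) * (1021/1000) * exp (- k * u\<^sup>2) \<le> A * (100/1681) * (1021/1000) * (t\<^sup>2 / (k * (pi - \<theta>)\<^sup>2))"
    using A_pos by (intro mult_left_mono) auto
  then show ?thesis using near_pi_gauss[OF _ u(2) th] u0 by simp
qed

lemma piece10:
  assumes \<theta>: "\<theta> \<in> {pi - t / sqrt k..pi}"
  shows "- (A * (100/1681) * (1021/1000)) \<le> f \<theta>"
proof -
  define u where "u = (pi - \<theta>) / t"
  have ut: "u * t = pi - \<theta>" using t_pos by (simp add: u_def)
  then have th: "\<theta> = pi - u * t" by simp
  have sk: "sqrt k \<ge> 2" using k_ge by (intro real_le_rsqrt) auto
  have u: "0 \<le> u" "u \<le> 1 / sqrt k"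
  proof -
    have "u * t \<le> 1 / sqrt k * t" using \<theta> ut by simp
    then show "u \<le> 1 / sqrt k" using t_pos by (rule mult_right_le_imp_le)
    show "0 \<le> u" using \<theta> t_pos by (auto simp: u_def)
  qed
  moreover have "1 / sqrt k \<le> 1 / 2" using sk k_ge by (intro divide_left_mono) auto
  ultimately have "- (A * (100/1681) * (1021/1000) * exp (- k * u\<^sup>2)) \<le> f \<theta>" by (intro near_pi_gauss th) auto
  moreover have "A * (100/1681) * (1021/1000) * exp (- k * u\<^sup>2) \<le> A * (100/1681) * (1021/1000) * 1"
    using A_pos k_ge by (intro mult_left_mono) auto
  ultimately show ?thesis by simp
qed

lemma piece_mid:
  assumes "\<theta> \<in> {3 * t..pi / 2 - 3 * t} \<union> {pi / 2..pi - 3 * t}"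
  shows "- exp ((29/200) / t + 7/20) \<le> f \<theta>"
  by (rule f_lower[OF middle_bound[OF t_pos t_le assms]])

lemma piece6:
  assumes \<theta>: "\<theta> \<in> {pi / 2 - 3 * t..pi / 2}"
  shows "- exp ((1838/10000) / t + 27/100) \<le> f \<theta>"
proof -
  define v where "v = (pi / 2 - \<theta>) / t"
  have "v * t = pi / 2 - \<theta>" using t_pos by (simp add: v_def)
  then have th: "\<theta> = pi / 2 - v * t" by simp
  have v: "0 \<le> v" "v \<le> 3" using \<theta> t_pos by (auto simp: v_def divide_simps)
  show ?thesis unfolding th by (rule f_lower[OF quarter_arc_inner[OF t_pos t_le v]])
qed

section \<open>Integrals over the arcs\<close>

lemma order_points:
  "0 \<le> (9/10) / \<rho> * t" "(9/10) / \<rho> * t \<le> (185/100) / \<rho> * t" "(185/100) / \<rho> * t \<le> t / 2" "t / 2 \<le> 3 * t"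
  "3 * t \<le> pi / 2 - 3 * t" "pi / 2 - 3 * t \<le> pi / 2" "pi / 2 \<le> pi - 3 * t" "pi - 3 * t \<le> pi - t / 2"
  "pi - t / 2 \<le> pi - t / sqrt k" "pi - t / sqrt k \<le> pi"
proof -
  have tp: "t > 0" "t \<le> 642/100000" using t_pos t_le by auto
  show "0 \<le> (9/10) / \<rho> * t" using rho tp by simp
  show "(9/10) / \<rho> * t \<le> (185/100) / \<rho> * t" using rho tp by (intro mult_right_mono divide_right_mono) auto
  have "(185/100) / \<rho> \<le> (185/100) / (565/100)" using rho by (intro divide_left_mono) auto
  then have "(185/100) / \<rho> * t \<le> 1/2 * t" using tp by (intro mult_right_mono) auto
  then show "(185/100) / \<rho> * t \<le> t / 2" by simp
  show "t / 2 \<le> 3 * t" "pi / 2 - 3 * t \<le> pi / 2" "pi - 3 * t \<le> pi - t / 2" using tp by auto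
  show "3 * t \<le> pi / 2 - 3 * t" "pi / 2 \<le> pi - 3 * t" using tp pi_gt3 by argo+
  have sk: "sqrt k \<ge> 2" using k_ge by (intro real_le_rsqrt) auto
  then have "t / sqrt k \<le> t / 2" using tp k_ge by (intro divide_left_mono) auto
  then show "pi - t / 2 \<le> pi - t / sqrt k" by simp
  show "pi - t / sqrt k \<le> pi" using tp k_ge by simp
qed

lemma rho_nz: "\<rho> \<noteq> 0" using rho by simp

lemma integral1: "6011/10000 * (A * t / \<rho>) \<le> integral {0..(9/10) / \<rho> * t} f"
proof -
  define c where "c = S / (3 * t\<^sup>2)"
  define \<Psi> where "\<Psi> \<theta> = A * (915/1000) * (\<theta> - c * \<theta> ^ 3)" for \<theta>
  have "\<Psi> ((9/10) / \<rho> * t) - \<Psi> 0 \<le> integral {0..(9/10) / \<rho> * t} f"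
  proof (rule integral_ge_antiderivative[OF order_points(1) f_cont _ piece1])
    fix x
    have "(\<Psi> has_real_derivative A * (915/1000) * (1 - c * (3 * x\<^sup>2))) (at x)"
      unfolding \<Psi>_def by (auto intro!: derivative_eq_intros)
    moreover have "c * (3 * x\<^sup>2) = S * (x / t)\<^sup>2" by (simp add: c_def power_divide)
    ultimately show "(\<Psi> has_real_derivative A * (915/1000) * (1 - S * (x / t)\<^sup>2)) (at x)" by simp
  qed
  moreover have "\<Psi> ((9/10) / \<rho> * t) - \<Psi> 0 = (915/1000) * (657/1000) * (A * t / \<rho>)"
  proof -
    \<comment> \<open>The integral of 1 - v^2 over [0, 0.9] is 0.9 - 0.243 = 0.657.\<close>
    have "c * ((9/10) / \<rho> * t) ^ 3 = (243/1000) * (t / \<rho>)"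
      unfolding c_def rho(2)[symmetric] using t_pos rho_nz by (simp add: field_simps power2_eq_square power3_eq_cube)
    then have "\<Psi> ((9/10) / \<rho> * t) = A * (915/1000) * ((9/10) / \<rho> * t - (243/1000) * (t / \<rho>))" unfolding \<Psi>_def by simp
    also have "\<dots> = (915/1000) * (657/1000) * (A * t / \<rho>)" by (simp add: field_simps)
    finally show ?thesis by (simp add: \<Psi>_def)
  qed
  moreover have "A * t / \<rho> \<ge> 0" using A_pos t_pos rho by simp
  ultimately show ?thesis by argo
qed

lemma integral2: "0 \<le> integral {(9/10) / \<rho> * t..(185/100) / \<rho> * t} f"
  by (intro integral_nonneg integrable_continuous_interval f_cont piece2)

lemma integral3: "- (25/1000) * (A * t / \<rho>) \<le> integral {(185/100) / \<rho> * t..t / 2} f"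
proof -
  \<comment> \<open>The denominator 2.96 is 2 * 0.8 * 1.85, from differentiating the
    Gaussian.\<close>
  define K where "K = (1055/1000) / (296/100) * (A * t / \<rho>)"
  define \<Psi> where "\<Psi> \<theta> = K * exp (- (8/10) * S * (\<theta> / t)\<^sup>2)" for \<theta>
  have X: "A * t / \<rho> \<ge> 0" using A_pos t_pos rho by simp
  have K0: "K \<ge> 0" unfolding K_def using X by simp
  have "\<Psi> (t / 2) - \<Psi> ((185/100) / \<rho> * t) \<le> integral {(185/100) / \<rho> * t..t / 2} f"
  proof (rule integral_ge_antiderivative[OF order_points(3) f_cont _ piece3])
    fix x
    have "(\<Psi> has_real_derivative K * (exp (- (8/10) * S * (x / t)\<^sup>2) * (- (8/10) * S * (2 * (x / t) * (1 / t))))) (at x)"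
      unfolding \<Psi>_def using t_pos by (auto intro!: derivative_eq_intros)
    moreover have "K * (exp (- (8/10) * S * (x / t)\<^sup>2) * (- (8/10) * S * (2 * (x / t) * (1 / t)))) =
       - (A * (1055/1000)) * (x / t / ((185/100) / \<rho>) * exp (- (8/10) * S * (x / t)\<^sup>2))"
    proof -
      have "K * (E * (- (8/10) * S * (2 * (x / t) * (1 / t)))) = - (A * (1055/1000)) * (x / t / ((185/100) / \<rho>) * E)" for E
        unfolding K_def rho(2)[symmetric] using t_pos rho_nz by (simp add: field_simps power2_eq_square)
      then show ?thesis .
    qed
    ultimately show "(\<Psi> has_real_derivative - (A * (1055/1000)) * (x / t / ((185/100) / \<rho>) * exp (- (8/10) * S * (x / t)\<^sup>2))) (at x)"
      by simp
  qed
  moreover have "\<Psi> (t / 2) \<ge> 0" using K0 by (simp add: \<Psi>_def)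
  moreover have "\<Psi> ((185/100) / \<rho> * t) \<le> K * (67/1000)"
  proof -
    have "(8/10) * S * ((185/100) / \<rho> * t / t)\<^sup>2 = 2738/1000"
      unfolding rho(2)[symmetric] using t_pos rho_nz by (simp add: field_simps power2_eq_square)
    then have "\<Psi> ((185/100) / \<rho> * t) = K * exp (- (2738/1000))" by (simp add: \<Psi>_def)
    also have "\<dots> \<le> K * (67/1000)"
    proof (intro mult_left_mono K0)
      have "exp (- (2738/1000) :: real) \<le> 1 / (1 + (2738/1000) / real 16 + ((2738/1000) / real 16)\<^sup>2 / 2) ^ 16"
        by (rule exp_minus_le_power) auto
      also have "\<dots> \<le> 67/1000" by (simp add: power2_eq_square power_divide)
      finally show "exp (- (2738/1000) :: real) \<le> 67/1000" .
    qed
    finally show ?thesis .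
  qed
  moreover have "K * (67/1000) \<le> (25/1000) * (A * t / \<rho>)" using X by (simp add: K_def)
  ultimately show ?thesis by argo
qed

lemma rho_exp_le:
  assumes "c \<ge> 0" "\<alpha> \<ge> 1/64" "exp (- (\<alpha> * 32 - c)) \<le> B"
  shows "\<rho> * exp (- \<alpha> * S + c) \<le> 5657/1000 * B"
proof -
  have "\<rho> * exp (- \<alpha> * S + c) = \<rho> * exp (- \<alpha> * S) * exp c" by (simp only: exp_add mult.assoc)
  also have "\<dots> \<le> 5657/1000 * exp (- \<alpha> * 32) * exp c"
    unfolding \<rho>_def using assms by (intro mult_right_mono sqrt_mult_exp_le S_ge) auto
  also have "\<dots> = 5657/1000 * exp (- (\<alpha> * 32 - c))" by (simp add: exp_diff exp_minus field_simps)
  also have "\<dots> \<le> 5657/1000 * B" using assms by (intro mult_left_mono) auto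
  finally show ?thesis .
qed

lemma integral4: "- (29/1000) * (A * t / \<rho>) \<le> integral {t / 2..3 * t} f"
proof -
  have X: "A * t / \<rho> \<ge> 0" using A_pos t_pos rho by simp
  have "exp (- (1/5 * 32 - 1315/10000) :: real) \<le> 1 / (1 + (62685/10000) / real 32 + ((62685/10000) / real 32)\<^sup>2 / 2) ^ 32"
    using exp_minus_le_power[of "62685/10000" 32] by simp
  also have "\<dots> \<le> 2/1000" by (simp add: power2_eq_square power_divide)
  finally have "\<rho> * exp (- (1/5) * S + 1315/10000) \<le> 5657/1000 * (2/1000)" by (intro rho_exp_le) auto
  then have r: "\<rho> * exp (- S / 5 + 1315/10000) \<le> 5657/1000 * (2/1000)" by simp
  have "- (A * exp (- S / 5 + 1315/10000)) * (3 * t - t / 2) \<le> integral {t / 2..3 * t} f"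
    by (rule integral_ge_const[OF order_points(4) f_cont piece4])
  moreover have "A * exp (- S / 5 + 1315/10000) * (3 * t - t / 2) = (A * t / \<rho>) * (\<rho> * exp (- S / 5 + 1315/10000)) * (5/2)"
    using rho_nz by (simp add: field_simps)
  moreover have "(A * t / \<rho>) * (\<rho> * exp (- S / 5 + 1315/10000)) \<le> (A * t / \<rho>) * (5657/1000 * (2/1000))"
    using r X by (intro mult_left_mono)
  ultimately show ?thesis using X by argo
qed

text \<open>The bounds on the arcs around and beside pi / 2 do not contain \<open>A\<close>.
  Comparing them with the peak gains the factor 3.444 = 0.84 * 4.1, from
  \<open>exp (- ln 2 / 4)\<close> and \<open>exp (Lo0 t)\<close>.\<close>

lemma A_ge: "exp S \<le> A * (1000/3444)"
proof -
  have "(84/100 :: real) \<le> exp (- ln 2 / 4)"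
  proof (rule power_le_imp_le_base)
    have "(exp (- ln 2 / 4) :: real) ^ Suc 3 = exp (- ln 2)" by (simp only: exp_of_nat_mult[symmetric]) simp
    also have "\<dots> = 1 / 2" by (simp add: exp_minus)
    finally show "(84/100 :: real) ^ Suc 3 \<le> exp (- ln 2 / 4) ^ Suc 3" by (simp add: power_numeral_reduce)
  qed auto
  then have "(84/100) * (41/10) \<le> exp (- ln 2 / 4) * exp (Lo0 t)" using Lo0_exp by (intro mult_mono) auto
  then have "exp S * (3444/1000) \<le> exp S * (exp (- ln 2 / 4) * exp (Lo0 t))" by (intro mult_left_mono) auto
  also have "\<dots> = A" by (simp add: A_def flip: exp_add)
  finally show ?thesis by simp
qed

lemma inverse_t: "1 / t = 48 / pi\<^sup>2 * S" unfolding S_def using t_pos by simp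

lemma pi_square_ge: "pi\<^sup>2 \<ge> 9869/1000"
proof -
  have "(31415/10000)\<^sup>2 \<le> pi\<^sup>2" using pi_approx by (intro power_mono) auto
  then show ?thesis by (simp add: power2_eq_square)
qed

text \<open>An exponent \<kappa> / t equals 48 \<kappa> / pi^2 times S, and \<alpha> is the fraction
  of S that is saved against the peak.\<close>

lemma exponent_le:
  assumes "\<kappa> \<ge> 0" "\<kappa> * 48 \<le> (1 - \<alpha>) * (9869/1000)" "\<alpha> \<le> 1"
  shows "\<kappa> / t \<le> S + (- \<alpha> * S)"
proof -
  have "\<kappa> * 48 \<le> (1 - \<alpha>) * pi\<^sup>2" using assms pi_square_ge mult_left_mono[OF pi_square_ge, of "1 - \<alpha>"] by simp
  then have "\<kappa> * 48 / pi\<^sup>2 \<le> 1 - \<alpha>" by (simp add: divide_simps)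
  then have "(\<kappa> * 48 / pi\<^sup>2) * S \<le> (1 - \<alpha>) * S" using S_ge by (intro mult_right_mono) auto
  moreover have "\<kappa> / t = \<kappa> * (1 / t)" by simp
  ultimately show ?thesis unfolding inverse_t by (simp add: algebra_simps)
qed

text \<open>The costliest arc: the secondary maximum saves only 0.106 S in the exponent, and the arc
  of length 3 t consumes more than a third of the positive contribution.\<close>

lemma integral6: "- (225/1000) * (A * t / \<rho>) \<le> integral {pi / 2 - 3 * t..pi / 2} f"
proof -
  have X: "A * t / \<rho> \<ge> 0" using A_pos t_pos rho by simp
  have "exp (- (106/1000 * 32 - 27/100) :: real) \<le> 1 / (1 + (3122/1000) / real 16 + ((3122/1000) / real 16)\<^sup>2 / 2) ^ 16"
    using exp_minus_le_power[of "3122/1000" 16] by simp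
  also have "\<dots> \<le> 455/10000" by (simp add: power2_eq_square power_divide)
  finally have r: "\<rho> * exp (- (106/1000) * S + 27/100) \<le> 5657/1000 * (455/10000)" by (intro rho_exp_le) auto
  have "(1838/10000) / t \<le> S + (- (106/1000) * S)" by (rule exponent_le) auto
  then have "exp ((1838/10000) / t + 27/100) \<le> exp (S + (- (106/1000) * S + 27/100))" by simp
  also have "\<dots> = exp S * exp (- (106/1000) * S + 27/100)" by (simp only: exp_add)
  also have "\<dots> \<le> A * (1000/3444) * exp (- (106/1000) * S + 27/100)" by (intro mult_right_mono A_ge) auto
  finally have "exp ((1838/10000) / t + 27/100) * (3 * t) \<le> A * (1000/3444) * exp (- (106/1000) * S + 27/100) * (3 * t)"
    using t_pos by (intro mult_right_mono) auto
  also have "\<dots> = (A * t / \<rho>) * (\<rho> * exp (- (106/1000) * S + 27/100)) * (3 * (1000/3444))"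
    using rho_nz by (simp add: field_simps)
  also have "\<dots> \<le> (A * t / \<rho>) * (5657/1000 * (455/10000)) * (3 * (1000/3444))"
    using r X by (intro mult_right_mono mult_left_mono) auto
  finally have "exp ((1838/10000) / t + 27/100) * (3 * t) \<le> (225/1000) * (A * t / \<rho>)" using X by argo
  moreover have "- exp ((1838/10000) / t + 27/100) * (pi / 2 - (pi / 2 - 3 * t)) \<le> integral {pi / 2 - 3 * t..pi / 2} f"
    by (rule integral_ge_const[OF order_points(6) f_cont piece6])
  ultimately show ?thesis by simp
qed

text \<open>These arcs have length of order 1 instead of t. Comparison with
  \<open>A * t / \<rho>\<close> therefore costs a further factor 1 / t, proportional to S, and the
  decay of S^(3/2) exp (- 0.294 S) is needed.\<close>

lemma integral_mid: "- (101/1000) * (A * t / \<rho>) \<le> integral {3 * t..pi / 2 - 3 * t} f + integral {pi / 2..pi - 3 * t} f"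
proof -
  define B where "B = exp ((29/200) / t + 7/20)"
  have B: "B \<ge> 0" by (simp add: B_def)
  have X: "A * t / \<rho> \<ge> 0" using A_pos t_pos rho by simp
  have i5: "- B * ((pi / 2 - 3 * t) - 3 * t) \<le> integral {3 * t..pi / 2 - 3 * t} f" unfolding B_def
    by (rule integral_ge_const[OF order_points(5) f_cont piece_mid]) auto
  have i7: "- B * ((pi - 3 * t) - pi / 2) \<le> integral {pi / 2..pi - 3 * t} f" unfolding B_def
    by (rule integral_ge_const[OF order_points(7) f_cont piece_mid]) auto
  have "B * ((pi / 2 - 3 * t) - 3 * t) + B * ((pi - 3 * t) - pi / 2) = B * pi - B * (9 * t)" by (simp add: algebra_simps)
  then have i: "B * ((pi / 2 - 3 * t) - 3 * t) + B * ((pi - 3 * t) - pi / 2) \<le> B * pi" using B t_pos by simp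
  have "(29/200) / t \<le> S + (- (294/1000) * S)" by (rule exponent_le) auto
  then have "B \<le> exp (S + (- (294/1000) * S + 7/20))" unfolding B_def by simp
  also have "\<dots> = exp S * exp (- (294/1000) * S + 7/20)" by (simp only: exp_add)
  also have "\<dots> \<le> A * (1000/3444) * exp (- (294/1000) * S + 7/20)" by (intro mult_right_mono A_ge) auto
  finally have "B * pi \<le> A * (1000/3444) * exp (- (294/1000) * S + 7/20) * pi" by (intro mult_right_mono) auto
  also have "\<dots> = (A * t / \<rho>) * (\<rho> * exp (- (294/1000) * S + 7/20) * (pi * (1 / t))) * (1000/3444)"
    using rho_nz t_pos by (simp add: field_simps)
  also have "\<dots> \<le> (A * t / \<rho>) * (1528/100 * (32 * (5657/1000) * (125/1000000))) * (1000/3444)"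
  proof (intro mult_right_mono mult_left_mono X)
    have "pi * (1 / t) = 48 / pi * S" unfolding inverse_t by (simp add: power2_eq_square)
    also have "\<dots> \<le> 1528/100 * S"
    proof (intro mult_right_mono)
      show "48 / pi \<le> 1528/100" using pi_approx by (simp add: divide_simps)
    qed (use S_ge in auto)
    finally have "\<rho> * exp (- (294/1000) * S + 7/20) * (pi * (1 / t)) \<le> \<rho> * exp (- (294/1000) * S + 7/20) * (1528/100 * S)"
      using rho by (intro mult_left_mono) auto
    also have "\<dots> = 1528/100 * ((S * sqrt S * exp (- (294/1000) * S)) * exp (7/20))" by (simp only: \<rho>_def exp_add mult_ac)
    also have "\<dots> \<le> 1528/100 * ((32 * (5657/1000) * exp (- (294/1000) * 32)) * exp (7/20))"
      by (intro mult_left_mono mult_right_mono mult_sqrt_exp_le S_ge) auto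
    also have "\<dots> = 1528/100 * (32 * (5657/1000) * exp (- (9058/1000)))" by (simp flip: exp_add)
    also have "\<dots> \<le> 1528/100 * (32 * (5657/1000) * (125/1000000))"
    proof (intro mult_left_mono)
      have "exp (- (9058/1000) :: real) \<le> 1 / (1 + (9058/1000) / real 64 + ((9058/1000) / real 64)\<^sup>2 / 2) ^ 64"
        by (rule exp_minus_le_power) auto
      also have "\<dots> \<le> 125/1000000" by (simp add: power2_eq_square power_divide)
      finally show "exp (- (9058/1000) :: real) \<le> 125/1000000" .
    qed auto
    finally show "\<rho> * exp (- (294/1000) * S + 7/20) * (pi * (1 / t)) \<le> 1528/100 * (32 * (5657/1000) * (125/1000000))" .
  qed auto
  finally have "B * pi \<le> (101/1000) * (A * t / \<rho>)" using X by argo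
  then show ?thesis using i i5 i7 by argo
qed

lemma integral8: "- (3/1000) * (A * t / \<rho>) \<le> integral {pi - 3 * t..pi - t / 2} f"
proof -
  have X: "A * t / \<rho> \<ge> 0" using A_pos t_pos rho by simp
  have "exp (- (1/5 * 32 - 4125/10000) :: real) \<le> 1 / (1 + (59875/10000) / real 32 + ((59875/10000) / real 32)\<^sup>2 / 2) ^ 32"
    using exp_minus_le_power[of "59875/10000" 32] by simp
  also have "\<dots> \<le> 26/10000" by (simp add: power2_eq_square power_divide)
  finally have "\<rho> * exp (- (1/5) * S + 4125/10000) \<le> 5657/1000 * (26/10000)" by (intro rho_exp_le) auto
  then have r: "\<rho> * exp (- S / 5 + 4125/10000) \<le> 5657/1000 * (26/10000)" by simp
  have "- (A * (100/1681) * exp (- S / 5 + 4125/10000)) * ((pi - t / 2) - (pi - 3 * t)) \<le> integral {pi - 3 * t..pi - t / 2} f"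
    by (rule integral_ge_const[OF order_points(8) f_cont piece8])
  moreover have "A * (100/1681) * exp (- S / 5 + 4125/10000) * ((pi - t / 2) - (pi - 3 * t)) = (A * t / \<rho>) * (\<rho> * exp (- S / 5 + 4125/10000)) * (250/1681)"
    using rho_nz by (simp add: field_simps)
  moreover have "(A * t / \<rho>) * (\<rho> * exp (- S / 5 + 4125/10000)) \<le> (A * t / \<rho>) * (5657/1000 * (26/10000))"
    using r X by (intro mult_left_mono)
  ultimately show ?thesis using X by argo
qed

lemma inverse_sqrt_k: "t / sqrt k \<le> 115/100 * (t / \<rho>)"
proof -
  have "\<rho> \<le> sqrt (132/100 * k)" unfolding \<rho>_def using k_ge by simp
  also have "\<dots> = sqrt (132/100) * sqrt k" by (simp only: real_sqrt_mult)
  also have "\<dots> \<le> 115/100 * sqrt k"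
    using k_ge by (intro mult_right_mono real_le_lsqrt) (auto simp: power2_eq_square)
  finally have "\<rho> \<le> 115/100 * sqrt k" .
  then show ?thesis using t_pos rho k_ge by (simp add: field_simps)
qed

text \<open>The antiderivative of 1 / (pi - \<theta>)^2 is dominated by its value at the inner end,
  which gives the same bound C t / sqrt k as the constant minorant on the last arc.\<close>

lemma integral9: "- (70/1000) * (A * t / \<rho>) \<le> integral {pi - t / 2..pi - t / sqrt k} f"
proof -
  define C where "C = A * (100/1681) * (1021/1000)"
  define \<Psi> where "\<Psi> \<theta> = - C * (t\<^sup>2 / k) / (pi - \<theta>)" for \<theta>
  have C: "C \<ge> 0" using A_pos by (simp add: C_def)
  have k0: "k > 0" "sqrt k > 0" using k_ge by auto
  have "\<Psi> (pi - t / sqrt k) - \<Psi> (pi - t / 2) \<le> integral {pi - t / 2..pi - t / sqrt k} f"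
  proof (rule integral_ge_antiderivative[OF order_points(9) f_cont _ piece9])
    fix x assume "x \<in> {pi - t / 2..pi - t / sqrt k}"
    moreover have "t / sqrt k > 0" using t_pos k0 by simp
    ultimately have x: "pi - x \<noteq> 0" by auto
    show "(\<Psi> has_real_derivative - (A * (100/1681) * (1021/1000)) * (t\<^sup>2 / (k * (pi - x)\<^sup>2))) (at x)"
      unfolding \<Psi>_def C_def[symmetric] using x k0
      by (auto intro!: derivative_eq_intros simp: power2_eq_square)
  qed
  moreover have "\<Psi> (pi - t / 2) \<le> 0" using C k0 t_pos by (auto simp: \<Psi>_def)
  moreover have "\<Psi> (pi - t / sqrt k) = - (C * (t / sqrt k))"
  proof -
    have "k = sqrt k * sqrt k" using k0 by simp
    then have "t\<^sup>2 / k / (t / sqrt k) = t / sqrt k" using t_pos k0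
      by (metis (no_types, lifting) divide_divide_eq_left divide_divide_eq_right mult.commute nonzero_mult_div_cancel_left power2_eq_square order_less_irrefl)
    moreover have "- C * w / z = - (C * (w / z))" "pi - (pi - z) = z" for w z by simp_all
    ultimately show ?thesis by (simp only: \<Psi>_def)
  qed
  moreover have "C * (t / sqrt k) \<le> C * (115/100 * (t / \<rho>))" by (intro mult_left_mono inverse_sqrt_k C)
  moreover have "C * (115/100 * (t / \<rho>)) = (100/1681) * (1021/1000) * (115/100) * (A * t / \<rho>)" by (simp add: C_def)
  moreover have "A * t / \<rho> \<ge> 0" using A_pos t_pos rho by simp
  ultimately show ?thesis by argo
qed

lemma integral10: "- (70/1000) * (A * t / \<rho>) \<le> integral {pi - t / sqrt k..pi} f"
proof -
  define C where "C = A * (100/1681) * (1021/1000)"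
  have C: "C \<ge> 0" using A_pos by (simp add: C_def)
  have "- C * (pi - (pi - t / sqrt k)) \<le> integral {pi - t / sqrt k..pi} f"
    unfolding C_def by (rule integral_ge_const[OF order_points(10) f_cont piece10])
  moreover have "C * (t / sqrt k) \<le> C * (115/100 * (t / \<rho>))" by (intro mult_left_mono inverse_sqrt_k C)
  moreover have "C * (115/100 * (t / \<rho>)) = (100/1681) * (1021/1000) * (115/100) * (A * t / \<rho>)" by (simp add: C_def)
  moreover have "A * t / \<rho> \<ge> 0" using A_pos t_pos rho by simp
  ultimately show ?thesis by simp
qed

text \<open>In units of \<open>A * t / \<rho>\<close> the first arc contributes 0.6011, and the
  losses 0.025, 0.029, 0.225, 0.101, 0.003, 0.070 and 0.070 add up to 0.523.\<close>

lemma a_pos_aux: "a n > 0"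
proof -
  have comb: "integral {x..z} f = integral {x..y} f + integral {y..z} f" if "x \<le> y" "y \<le> z" for x y z
    using that by (intro Henstock_Kurzweil_Integration.integral_combine[symmetric] integrable_continuous_interval f_cont) auto
  note o = order_points
  have X: "A * t / \<rho> > 0" using A_pos t_pos rho by simp
  define I where "I x = integral {0..x} f" for x
  have step: "I y = I x + integral {x..y} f" if "0 \<le> x" "x \<le> y" for x y
    unfolding I_def by (rule comb[OF that])
  note p = o(1) order_trans[OF o(1) o(2)]
  have p2: "0 \<le> (185/100) / \<rho> * t" using o(1,2) by (rule order_trans)
  have p3: "0 \<le> t / 2" "0 \<le> 3 * t" using t_pos by auto
  have p5: "0 \<le> pi / 2 - 3 * t" "0 \<le> pi / 2" "0 \<le> pi - 3 * t" "0 \<le> pi - t / 2" "0 \<le> pi - t / sqrt k"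
    using o t_pos by argo+
  have "I pi = integral {0..(9/10) / \<rho> * t} f + integral {(9/10) / \<rho> * t..(185/100) / \<rho> * t} f + integral {(185/100) / \<rho> * t..t / 2} f
     + integral {t / 2..3 * t} f + integral {3 * t..pi / 2 - 3 * t} f + integral {pi / 2 - 3 * t..pi / 2} f + integral {pi / 2..pi - 3 * t} f
     + integral {pi - 3 * t..pi - t / 2} f + integral {pi - t / 2..pi - t / sqrt k} f + integral {pi - t / sqrt k..pi} f"
    unfolding step[OF p5(5) o(10)] step[OF p5(4) o(9)] step[OF p5(3) o(8)] step[OF p5(2) o(7)] step[OF p5(1) o(6)]
      step[OF p3(2) o(5)] step[OF p3(1) o(4)] step[OF p2 o(3)] step[OF o(1) o(2)] by (simp only: I_def)
  then have "I pi > 0"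
    using integral1 integral2 integral3 integral4 integral6 integral_mid integral8 integral9 integral10 X by argo
  moreover have "I pi = pi * a n * exp (- t) ^ n"
    unfolding I_def f_def[abs_def]
    by (rule integral_unique, rule a_integral(2)) (use t_pos in auto)
  ultimately have "0 < pi * a n * exp (- t) ^ n" by simp
  then show ?thesis by (simp add: zero_less_mult_iff)
qed

end

theorem a_pos_large: "n \<ge> 5000 \<Longrightarrow> a n > 0"
  by (rule a_pos_aux) auto

theorem theorem1p1:
  shows "(\<forall>n. a n \<ge> 0) \<and> (\<forall>n. a n = of_int \<bar>int (e_count n) - int (o_count n)\<bar>)"
proof -
  have nonneg: "a n \<ge> 0" for n
    using a_nonneg_small[of n] a_pos_large[of n] by (cases "n < 5000") auto
  then show ?thesis by (simp only: abs_count_diff abs_of_nonneg simp_thms)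
qed

end
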